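(* Let $N$ be a positive integer, $1<p<N$ and $p^*=\frac{Np}{N-p}$. Let $$S_p=\inf\left\{\int_{\mathbb{R}^N}|\nabla u|^p\,dx \;:\; u\in \dot{W}^{1,p}(\mathbb{R}^N),\ \|u\|_{L^{p^*}(\mathbb{R}^N)}=1\right\}$$ be the best constant in the Sobolev inequality $S_p\left(\int_{\mathbb{R}^N}|u|^{p^*}\,dx\right)^{p/p^*}\le\int_{\mathbb{R}^N}|\nabla u|^p\,dx$ for $u\in\dot{W}^{1,p}(\mathbb{R}^N)$. Then $S_p$ is attained, i.e. there exists $u\in\dot{W}^{1,p}(\mathbb{R}^N)$ with $\|u\|_{L^{p^*}(\mathbb{R}^N)}=1$ and $\int_{\mathbb{R}^N}|\nabla u|^p\,dx=S_p$.
   Context: For $1<p<N$ and $p^*=\frac{Np}{N-p}$, $\dot{W}^{1,p}(\mathbb{R}^N)=\{u\in L^{p^*}(\mathbb{R}^N) : |\nabla u|\in L^p(\mathbb{R}^N)\}$, where functions are real-valued and $\nabla u$ is the weak (distributional) gradient. *)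

theory Defs
  imports "HOL-Analysis.Analysis"
begin

definition partial_deriv :: "'n \<Rightarrow> (real ^ 'n \<Rightarrow> real) \<Rightarrow> real ^ 'n \<Rightarrow> real" where
  "partial_deriv i f x = frechet_derivative f (at x) (axis i 1)"

primrec C_k :: "nat \<Rightarrow> (real ^ 'n \<Rightarrow> real) \<Rightarrow> bool" where
  "C_k 0 f \<longleftrightarrow> continuous_on UNIV f"
| "C_k (Suc k) f \<longleftrightarrow> (\<forall>x. f differentiable (at x)) \<and> (\<forall>i. C_k k (partial_deriv i f))"

definition test_functions :: "(real ^ 'n \<Rightarrow> real) set" where
  "test_functions = {\<phi>. (\<forall>k. C_k k \<phi>) \<and> compact (closure {x. \<phi> x \<noteq> 0})}"

definition locally_integrable :: "(real ^ 'n \<Rightarrow> 'b::euclidean_space) \<Rightarrow> bool" where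
  "locally_integrable f \<longleftrightarrow> (\<forall>K. compact K \<longrightarrow> set_integrable lebesgue K f)"

definition has_weak_gradient :: "(real ^ 'n \<Rightarrow> real) \<Rightarrow> (real ^ 'n \<Rightarrow> real ^ 'n) \<Rightarrow> bool" where
  "has_weak_gradient u g \<longleftrightarrow>
     locally_integrable u \<and> locally_integrable g \<and>
     (\<forall>\<phi>\<in>test_functions. \<forall>i.
        (\<integral>x. u x * partial_deriv i \<phi> x \<partial>lebesgue) = - (\<integral>x. g x $ i * \<phi> x \<partial>lebesgue))"

(* Weak gradients are unique only up to null sets, so this picks a representative. *)
definition weak_gradient :: "(real ^ 'n \<Rightarrow> real) \<Rightarrow> real ^ 'n \<Rightarrow> real ^ 'n" where
  "weak_gradient u = (SOME g. has_weak_gradient u g)"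

(* Functions, not classes modulo equality almost everywhere. *)
definition Lp_space :: "real \<Rightarrow> (real ^ 'n \<Rightarrow> real) set" where
  "Lp_space q = {f \<in> borel_measurable lebesgue. integrable lebesgue (\<lambda>x. \<bar>f x\<bar> powr q)}"

definition Lp_norm :: "real \<Rightarrow> (real ^ 'n \<Rightarrow> real) \<Rightarrow> real" where
  "Lp_norm q f = (\<integral>x. \<bar>f x\<bar> powr q \<partial>lebesgue) powr (1 / q)"

definition sobolev_exponent :: "nat \<Rightarrow> real \<Rightarrow> real" where
  "sobolev_exponent N p = real N * p / (real N - p)"

definition homogeneous_sobolev :: "real \<Rightarrow> (real ^ 'n \<Rightarrow> real) set" where
  "homogeneous_sobolev p =
     {u \<in> Lp_space (sobolev_exponent CARD('n) p).
        (\<exists>g. has_weak_gradient u g) \<and> (\<lambda>x. norm (weak_gradient u x)) \<in> Lp_space p}"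

definition gradient_energy :: "real \<Rightarrow> (real ^ 'n \<Rightarrow> real) \<Rightarrow> real" where
  "gradient_energy p u = (\<integral>x. norm (weak_gradient u x) powr p \<partial>lebesgue)"

definition sobolev_constant :: "'n::finite itself \<Rightarrow> real \<Rightarrow> real" where
  "sobolev_constant _ p =
     Inf {gradient_energy p u | u :: real ^ 'n \<Rightarrow> real.
            u \<in> homogeneous_sobolev p \<and> Lp_norm (sobolev_exponent CARD('n) p) u = 1}"

end

theory Submission
  imports Defs "HOL-Computational_Algebra.Polynomial"
begin

text \<open>
The minimiser is explicit, so no minimising sequence is studied. Let \<open>N\<close> be the dimension,
\<open>d = N - 1\<close>, \<open>q = p / (p - 1)\<close>, \<open>g(y) = 1 + |y|\<^sup>q / q\<close> and \<open>U = g powr (-(N - p) / p)\<close>, the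
Aubin--Talenti function. It suffices to show that the quotient of the energy by the \<open>p\<close>-th power of
the \<open>p*\<close>-norm is smallest at \<open>U\<close>; a multiple of \<open>U\<close> then attains the infimum.

The inequality is derived from convex geometry, following Bobkov and Ledoux. A positive function
\<open>u\<close> is written as \<open>f powr (-(N - p) / p)\<close>, so that the integral of \<open>u\<close> to the power \<open>p*\<close> is the integral
of \<open>f\<close> to the power \<open>-N\<close>, and the energy of \<open>u\<close> is a constant times the integral of \<open>|Df|\<^sup>p / f\<^sup>N\<close>.
The geometric ingredient (\<open>brunn_minkowski_equal_sections\<close>) says: if \<open>h(x + s y) \<le> f(x) + s g(y)\<close>
for all \<open>x, y\<close>, and the supremum of the integrals over hyperplanes orthogonal to one axis is the
same for \<open>f\<close> and \<open>g\<close> to the power \<open>-d\<close>, then the integral of \<open>h\<close> to the power \<open>-d\<close> is at least that of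
\<open>f\<close> plus \<open>s\<close> times that of \<open>g\<close>. It is proved by integrating out one coordinate at a
time, each step being an instance of \<open>|A + s B| \<ge> |A| + s |B|\<close> on the line. For small \<open>s\<close> one may take
\<open>h = f + s (1 - |Df|\<^sup>p / p)\<close> up to a small error, because the Legendre transform of \<open>g\<close> is
\<open>|y|\<^sup>p / p - 1\<close> (\<open>inf_convolution_lower_bound\<close>). The terms of first order in \<open>s\<close> bound the integral of
\<open>g\<close> to the power \<open>-d\<close> by the energy and the mass of \<open>f\<close> (\<open>equal_sections_inequality\<close>). Replacing \<open>f\<close> by
the multiple that meets the condition on hyperplanes and minimising over that multiple gives the
sharp inequality (\<open>sharp_inequality_profile_like\<close>), with equality at \<open>f = g\<close>.

That argument asks for \<open>f\<close> to be continuously differentiable and a multiple of \<open>g\<close> near infinity. For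
\<open>v\<close> continuously differentiable with compact support it is applied to \<open>u = sqrt (v\<^sup>2 + e\<^sup>2 U\<^sup>2)\<close>, and
\<open>e\<close> tends to zero (\<open>sharp_sobolev_C1\<close>). Cut-offs remove the support condition
(\<open>sharp_sobolev_C1_global\<close>) and mollification the differentiability
(\<open>sharp_sobolev_weak\<close>): convolving does not increase the energy, and Fatou's lemma recovers the norm.
Finally, weak gradients are unique almost everywhere, so the representative chosen by the
definition of the energy may be replaced by any other one.
\<close>

section \<open>One-dimensional Brunn--Minkowski\<close>

text \<open>If \<open>A\<close> has no largest element, the rationals that lie below a point of \<open>A\<close> are cofinal in \<open>A\<close>, so
countably many initial segments exhaust \<open>A\<close> and continuity from below applies.\<close>
lemma emeasure_eq_SUP_initial_segments:
  fixes A :: "real set"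
  assumes A[measurable]: "A \<in> sets borel" and ne: "A \<noteq> {}"
  shows "emeasure lborel A = (SUP a\<in>A. emeasure lborel (A \<inter> {..a}))"
proof (rule antisym)
  show "(SUP a\<in>A. emeasure lborel (A \<inter> {..a})) \<le> emeasure lborel A"
    by (rule SUP_least) (auto intro!: emeasure_mono)
  show "emeasure lborel A \<le> (SUP a\<in>A. emeasure lborel (A \<inter> {..a}))"
  proof (cases "\<exists>a\<in>A. \<forall>x\<in>A. x \<le> a")
    case True
    then obtain a where "a \<in> A" "A \<inter> {..a} = A" by blast
    then show ?thesis by (metis (mono_tags, lifting) SUP_upper)
  next
    case False
    define R where "R = {r \<in> \<rat>. \<exists>a\<in>A. r \<le> a}"
    have "countable R" by (rule countable_subset[OF _ countable_rat]) (auto simp: R_def)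
    obtain a0 where "a0 \<in> A" using ne by blast
    obtain r0 where "r0 \<in> \<rat>" "r0 < a0" using Rats_dense_in_real[of "a0 - 1" a0] by auto
    then have "R \<noteq> {}" using \<open>a0 \<in> A\<close> by (auto simp: R_def intro!: exI[of _ r0] bexI[of _ a0])
    define r where "r = from_nat_into R"
    have rR: "r n \<in> R" for n unfolding r_def using \<open>R \<noteq> {}\<close> by (rule from_nat_into)
    have range: "range r = R" unfolding r_def using \<open>R \<noteq> {}\<close> \<open>countable R\<close> by (simp add: range_from_nat_into)
    define E where "E n = A \<inter> {..Max (r ` {..n})}" for n :: nat
    have inc: "incseq E"
    proof (rule incseq_SucI)
      fix n
      have "Max (r ` {..n}) \<le> Max (r ` {..Suc n})" by (rule Max_mono) auto
      then show "E n \<subseteq> E (Suc n)" unfolding E_def by (auto intro: order.trans)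
    qed
    have "A = (\<Union>n. E n)"
    proof (intro set_eqI iffI)
      fix x assume x: "x \<in> A"
      then obtain y where "y \<in> A" "x < y" using False by force
      then obtain q where "q \<in> \<rat>" "x < q" "q < y" using Rats_dense_in_real by blast
      then have "q \<in> range r" unfolding range R_def using \<open>y \<in> A\<close> \<open>q < y\<close> by (auto intro!: bexI[of _ y])
      then obtain n where "q = r n" by auto
      then have "x \<le> Max (r ` {..n})"
        using \<open>x < q\<close> by (intro order.trans[OF _ Max_ge[of _ "r n"]]) auto
      then show "x \<in> (\<Union>n. E n)" using x by (auto simp: E_def)
    qed (auto simp: E_def)
    then have "emeasure lborel A = emeasure lborel (\<Union>n. E n)" by simp
    also have "\<dots> = (SUP n. emeasure lborel (E n))"
      by (rule SUP_emeasure_incseq[symmetric, OF _ inc]) (auto simp: E_def)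
    also have "\<dots> \<le> (SUP a\<in>A. emeasure lborel (A \<inter> {..a}))"
    proof (rule SUP_least)
      fix n
      have "Max (r ` {..n}) \<in> r ` {..n}" by (rule Max_in) auto
      then have "Max (r ` {..n}) \<in> R" using rR by (metis imageE)
      then obtain a where "a \<in> A" "Max (r ` {..n}) \<le> a" by (auto simp: R_def)
      then show "emeasure lborel (E n) \<le> (SUP a\<in>A. emeasure lborel (A \<inter> {..a}))"
        unfolding E_def
        by (intro SUP_upper2[of a] emeasure_mono) (auto intro: order.trans simp del: Max_le_iff Max_ge_iff)
    qed
    finally show ?thesis .
  qed
qed

lemma emeasure_lborel_affine_vimage:
  fixes A :: "real set"
  assumes [measurable]: "A \<in> sets borel" and c: "c \<noteq> 0"
  shows "ennreal \<bar>c\<bar> * emeasure lborel {x. t + c * x \<in> A} = emeasure lborel A"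
proof -
  have "emeasure lborel A = ennreal \<bar>c\<bar> * (\<integral>\<^sup>+x. indicator A (t + c * x) \<partial>lborel)"
    using nn_integral_real_affine[of "indicator A" c t] c by simp
  also have "(\<integral>\<^sup>+x. indicator A (t + c * x) \<partial>lborel) = (\<integral>\<^sup>+x. indicator {x. t + c * x \<in> A} x \<partial>lborel)"
    by (intro nn_integral_cong) (auto simp: indicator_def)
  also have "\<dots> = emeasure lborel {x. t + c * x \<in> A}"
    by (rule nn_integral_indicator) measurable
  finally show ?thesis by simp
qed

text \<open>Put \<open>D = - s B\<close>. For \<open>a \<in> A\<close> and \<open>e \<in> D\<close> the translate by \<open>-e\<close> of the part of \<open>A\<close> below \<open>a\<close>, and
the reflection \<open>a - y\<close> of the part of \<open>D\<close> below \<open>e\<close>, both lie in \<open>C\<close>, on opposite sides of the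
point \<open>a - e\<close>. Hence their measures add up, and the suprema over \<open>a\<close> and \<open>e\<close> give the claim.\<close>
lemma brunn_minkowski_real:
  fixes A B C :: "real set"
  assumes [measurable]: "A \<in> sets borel" "B \<in> sets borel" "C \<in> sets borel"
    and ne: "A \<noteq> {}" "B \<noteq> {}" and s: "0 < s"
    and sub: "\<And>x y. x \<in> A \<Longrightarrow> y \<in> B \<Longrightarrow> x + s * y \<in> C"
  shows "emeasure lborel A + ennreal s * emeasure lborel B \<le> emeasure lborel C"
proof -
  define D where "D = {y. 0 + (- 1 / s) * y \<in> B}"
  have D[measurable]: "D \<in> sets borel" unfolding D_def by measurable
  have "ennreal s * (ennreal \<bar>- 1 / s\<bar> * emeasure lborel D) = ennreal s * emeasure lborel B"
    unfolding D_def by (subst emeasure_lborel_affine_vimage) (use s in auto)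
  moreover have "ennreal s * ennreal \<bar>- 1 / s\<bar> = 1"
    using s by (simp flip: ennreal_mult)
  ultimately have mD: "emeasure lborel D = ennreal s * emeasure lborel B"
    by (simp flip: mult.assoc)
  obtain b where "b \<in> B" using ne by blast
  then have Dne: "D \<noteq> {}" using s by (auto simp: D_def intro!: exI[of _ "- s * b"])
  have step: "emeasure lborel (A \<inter> {..a}) + emeasure lborel (D \<inter> {..d}) \<le> emeasure lborel C"
    if a: "a \<in> A" and d: "d \<in> D" for a d
  proof -
    have dB: "- d / s \<in> B" using d by (simp add: D_def)
    have "emeasure lborel (A \<inter> {..a}) = emeasure lborel {x. d + 1 * x \<in> A \<inter> {..a}}"
      using emeasure_lborel_affine_vimage[of "A \<inter> {..a}" 1 d] by simp
    also have "\<dots> \<le> emeasure lborel (C \<inter> {..a - d})"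
    proof (rule emeasure_mono)
      show "{x. d + 1 * x \<in> A \<inter> {..a}} \<subseteq> C \<inter> {..a - d}"
      proof (rule subsetI)
        fix x assume x: "x \<in> {x. d + 1 * x \<in> A \<inter> {..a}}"
        then have "(d + x) + s * (- d / s) \<in> C" by (intro sub dB) auto
        then show "x \<in> C \<inter> {..a - d}" using s x by auto
      qed
    qed auto
    finally have 1: "emeasure lborel (A \<inter> {..a}) \<le> emeasure lborel (C \<inter> {..a - d})" .
    have "emeasure lborel (D \<inter> {..d}) = emeasure lborel {x. a + (- 1) * x \<in> D \<inter> {..d}}"
      using emeasure_lborel_affine_vimage[of "D \<inter> {..d}" "-1" a] by simp
    also have "\<dots> \<le> emeasure lborel (C \<inter> {a - d..})"
    proof (rule emeasure_mono)
      show "{x. a + (- 1) * x \<in> D \<inter> {..d}} \<subseteq> C \<inter> {a - d..}"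
      proof (rule subsetI)
        fix x assume x: "x \<in> {x. a + (- 1) * x \<in> D \<inter> {..d}}"
        then have "0 + (- 1 / s) * (a - x) \<in> B" by (simp add: D_def)
        then have "a + s * (0 + (- 1 / s) * (a - x)) \<in> C" by (intro sub a)
        then show "x \<in> C \<inter> {a - d..}" using s x by auto
      qed
    qed auto
    also have "emeasure lborel (C \<inter> {a - d..}) = emeasure lborel (C \<inter> {a - d<..})"
      by (rule emeasure_eq_AE) (use AE_lborel_singleton[of "a - d"] in auto)
    finally have 2: "emeasure lborel (D \<inter> {..d}) \<le> emeasure lborel (C \<inter> {a - d<..})" .
    have "emeasure lborel (C \<inter> {..a - d}) + emeasure lborel (C \<inter> {a - d<..})
        = emeasure lborel ((C \<inter> {..a - d}) \<union> (C \<inter> {a - d<..}))"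
      by (rule plus_emeasure) auto
    also have "(C \<inter> {..a - d}) \<union> (C \<inter> {a - d<..}) = C" by auto
    finally show ?thesis using add_mono[OF 1 2] by simp
  qed
  have "emeasure lborel A + emeasure lborel (D \<inter> {..d}) \<le> emeasure lborel C" if "d \<in> D" for d
    unfolding emeasure_eq_SUP_initial_segments[OF assms(1) ne(1)]
    using ne(1) step that
    by (subst ennreal_SUP_add_left[symmetric]) (auto intro!: SUP_least)
  then have "emeasure lborel A + emeasure lborel D \<le> emeasure lborel C"
    unfolding emeasure_eq_SUP_initial_segments[OF D Dne]
    using Dne by (subst ennreal_SUP_add_right) (auto intro!: SUP_least)
  then show ?thesis by (simp add: mD)
qed

lemma nn_integral_layer_cake:
  fixes f :: "real \<Rightarrow> ennreal"
  assumes [measurable]: "f \<in> borel_measurable borel"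
  shows "(\<integral>\<^sup>+x. f x \<partial>lborel) = (\<integral>\<^sup>+l. indicator {0<..} l * emeasure lborel {x. ennreal l < f x} \<partial>lborel)"
proof -
  have lev: "(\<integral>\<^sup>+l. indicator {0<..} l * indicator {y. ennreal l < f y} x \<partial>lborel) = f x" for x
  proof -
    have "(\<integral>\<^sup>+l. indicator {0<..} l * indicator {y. ennreal l < f y} x \<partial>lborel)
        = (\<integral>\<^sup>+l. indicator {l. 0 < l \<and> ennreal l < f x} l \<partial>lborel)"
      by (intro nn_integral_cong) (auto simp: indicator_def)
    also have "\<dots> = emeasure lborel {l. 0 < l \<and> ennreal l < f x}"
      by (rule nn_integral_indicator) measurable
    also have "\<dots> = f x"
    proof (cases "f x")
      case (real r)
      then have "{l. 0 < l \<and> ennreal l < f x} = {0<..<r}"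
        by (auto simp: ennreal_less_iff)
      then show ?thesis using real by simp
    next
      case top
      then have eq: "{l. 0 < l \<and> ennreal l < f x} = {0::real<..}" by auto
      have "ennreal r \<le> emeasure lborel {0::real<..}" for r :: real
      proof (cases "r \<ge> 0")
        case True
        have "ennreal r = emeasure lborel {0<..r}" using True by simp
        also have "\<dots> \<le> emeasure lborel {0::real<..}" by (rule emeasure_mono) auto
        finally show ?thesis .
      qed (simp add: ennreal_neg)
      note bnd = this
      have "emeasure lborel {0::real<..} = top"
      proof (cases "emeasure lborel {0::real<..}")
        case (real r)
        then show ?thesis using bnd[of "r + 1"] by (simp add: ennreal_le_iff2)
      qed auto
      then show ?thesis using top eq by simp
    qed
    finally show ?thesis .
  qed
  have "(\<integral>\<^sup>+x. f x \<partial>lborel) = (\<integral>\<^sup>+x. \<integral>\<^sup>+l. indicator {0<..} l * indicator {y. ennreal l < f y} x \<partial>lborel \<partial>lborel)"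
    by (simp add: lev)
  also have "\<dots> = (\<integral>\<^sup>+l. \<integral>\<^sup>+x. indicator {0<..} l * indicator {y. ennreal l < f y} x \<partial>lborel \<partial>lborel)"
  proof (rule lborel_pair.Fubini'[symmetric])
    have "(\<lambda>p::real\<times>real. indicator {0<..} (snd p) * indicator {p. ennreal (snd p) < f (fst p)} p :: ennreal) \<in> borel_measurable (lborel \<Otimes>\<^sub>M lborel)"
      by measurable
    then show "(\<lambda>(x, l). indicator {0<..} l * indicator {y. ennreal l < f y} x :: ennreal) \<in> borel_measurable (lborel \<Otimes>\<^sub>M lborel)"
      by (rule measurable_cong[THEN iffD1, rotated]) (auto simp: indicator_def)
  qed
  also have "\<dots> = (\<integral>\<^sup>+l. indicator {0<..} l * emeasure lborel {x. ennreal l < f x} \<partial>lborel)"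
    by (intro nn_integral_cong) (subst nn_integral_cmult, auto)
  finally show ?thesis .
qed

text \<open>Equal suprema make the superlevel sets of \<open>\<phi>\<close> and \<open>\<psi>\<close> nonempty at the same levels, as the
Brunn--Minkowski inequality demands; its integral over all levels is the claim.\<close>
lemma level_sets_superadditive:
  fixes \<phi> \<psi> w :: "real \<Rightarrow> ennreal"
  assumes [measurable]: "\<phi> \<in> borel_measurable borel" "\<psi> \<in> borel_measurable borel" "w \<in> borel_measurable borel"
    and s: "0 < s"
    and sup: "(SUP x. \<phi> x) = L" "(SUP x. \<psi> x) = L"
    and lev: "\<And>l x y. 0 < l \<Longrightarrow> ennreal l < \<phi> x \<Longrightarrow> ennreal l < \<psi> y \<Longrightarrow> ennreal l \<le> w (x + s * y)"
  shows "(\<integral>\<^sup>+x. \<phi> x \<partial>lborel) + ennreal s * (\<integral>\<^sup>+x. \<psi> x \<partial>lborel) \<le> (\<integral>\<^sup>+x. w x \<partial>lborel)"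
proof -
  have key: "emeasure lborel {x. ennreal l < \<phi> x} + ennreal s * emeasure lborel {x. ennreal l < \<psi> x}
      \<le> emeasure lborel {x. ennreal l < w x}" if l: "0 < l" for l
  proof (cases "ennreal l < L")
    case True
    have ne: "\<exists>x. ennreal l < \<phi> x" "\<exists>x. ennreal l < \<psi> x"
      using True unfolding sup(1)[symmetric] less_SUP_iff apply blast
      using True unfolding sup(2)[symmetric] less_SUP_iff by blast
    show ?thesis
    proof (rule brunn_minkowski_real)
      fix x y assume xy: "x \<in> {x. ennreal l < \<phi> x}" "y \<in> {x. ennreal l < \<psi> x}"
      then have "ennreal l < min (\<phi> x) (\<psi> y)" by simp
      \<comment> \<open>A level strictly between turns the weak inequality for \<open>w\<close> into a strict one.\<close>
      then obtain e where e: "ennreal l < e" "e < min (\<phi> x) (\<psi> y)" using dense by blast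
      obtain r where r: "e = ennreal r" "0 \<le> r" using e(2) by (cases e) auto
      have "0 < r" using e(1) l r by (simp add: ennreal_less_iff)
      then have "ennreal r \<le> w (x + s * y)" using e r by (intro lev) auto
      then show "x + s * y \<in> {x. ennreal l < w x}" using e(1) r by simp
    qed (use ne s in auto)
  next
    case False
    have "\<phi> x \<le> L" "\<psi> x \<le> L" for x using sup by (metis SUP_upper UNIV_I)+
    then have "{x. ennreal l < \<phi> x} = {}" "{x. ennreal l < \<psi> x} = {}"
      using False by (auto simp: not_less dest: order.trans leD)
    then show ?thesis by simp
  qed
  have m[measurable]: "(\<lambda>l. emeasure lborel {x. ennreal l < f x}) \<in> borel_measurable borel"
    if [measurable]: "f \<in> borel_measurable borel" for f :: "real \<Rightarrow> ennreal"
  proof -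
    have "{p \<in> space (borel \<Otimes>\<^sub>M lborel). ennreal (fst p) < f (snd p)} \<in> sets (borel \<Otimes>\<^sub>M lborel)"
      by measurable
    from lborel.measurable_emeasure_Pair[OF this] show ?thesis
      by (simp add: space_pair_measure vimage_def)
  qed
  have "(\<integral>\<^sup>+x. \<phi> x \<partial>lborel) + ennreal s * (\<integral>\<^sup>+x. \<psi> x \<partial>lborel)
     = (\<integral>\<^sup>+l. indicator {0<..} l * emeasure lborel {x. ennreal l < \<phi> x}
         + ennreal s * (indicator {0<..} l * emeasure lborel {x. ennreal l < \<psi> x}) \<partial>lborel)"
    unfolding nn_integral_layer_cake[OF assms(1)] nn_integral_layer_cake[OF assms(2)]
    by (simp add: nn_integral_add nn_integral_cmult)
  also have "\<dots> \<le> (\<integral>\<^sup>+l. indicator {0<..} l * emeasure lborel {x. ennreal l < w x} \<partial>lborel)"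
    using key by (intro nn_integral_mono) (auto simp: indicator_def)
  also have "\<dots> = (\<integral>\<^sup>+x. w x \<partial>lborel)" by (rule nn_integral_layer_cake[symmetric]) simp
  finally show ?thesis .
qed

section \<open>Integrating out coordinates\<close>

text \<open>For \<open>\<phi>\<close>, \<open>\<psi>\<close>, \<open>w\<close> equal to \<open>f\<close>, \<open>g\<close>, \<open>h\<close> to the power \<open>-m\<close> this says \<open>h(x + s y) \<le> f(x) + s g(y)\<close>, the
hypothesis of the Borell--Brascamp--Lieb inequality with exponent \<open>-1 / m\<close>. The thresholds \<open>a\<close> and \<open>b\<close>
replace the roots of \<open>\<phi>\<close> and \<open>\<psi>\<close>, so that the values \<open>0\<close> and \<open>\<infinity>\<close> need no convention and \<open>m = 0\<close>
makes sense: there the relation compares the sets where the functions are at least \<open>1\<close>.\<close>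
definition pow_concave :: "nat \<Rightarrow> real \<Rightarrow> ('a::real_vector \<Rightarrow> ennreal) \<Rightarrow> ('a \<Rightarrow> ennreal) \<Rightarrow> ('a \<Rightarrow> ennreal) \<Rightarrow> bool" where
  "pow_concave m s \<phi> \<psi> w \<longleftrightarrow>
     (\<forall>x y a b. 0 < a \<longrightarrow> 0 < b \<longrightarrow> ennreal (1 / a ^ m) \<le> \<phi> x \<longrightarrow> ennreal (1 / b ^ m) \<le> \<psi> y
        \<longrightarrow> ennreal (1 / (a + s * b) ^ m) \<le> w (x + s *\<^sub>R y))"

lemma pow_concaveD:
  assumes "pow_concave m s \<phi> \<psi> w" "0 < a" "0 < b" "ennreal (1 / a ^ m) \<le> \<phi> x" "ennreal (1 / b ^ m) \<le> \<psi> y"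
  shows "ennreal (1 / (a + s * b) ^ m) \<le> w (x + s *\<^sub>R y)"
  using assms unfolding pow_concave_def by blast

lemma power_tangent:
  fixes x t :: real
  assumes "0 \<le> x" "0 < t"
  shows "t ^ Suc m + real (Suc m) * t ^ m * (x - t) \<le> x ^ Suc m"
proof -
  have "1 + real (Suc m) * ((x - t) / t) \<le> (1 + (x - t) / t) ^ Suc m"
    by (rule Bernoulli_inequality) (use assms in \<open>simp add: field_simps\<close>)
  then have "t ^ Suc m * (1 + real (Suc m) * ((x - t) / t)) \<le> t ^ Suc m * (1 + (x - t) / t) ^ Suc m"
    using assms by (intro mult_left_mono) auto
  also have "t ^ Suc m * (1 + (x - t) / t) ^ Suc m = x ^ Suc m"
  proof -
    have "t * (1 + (x - t) / t) = x" using assms by (simp add: field_simps)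
    then show ?thesis by (metis power_mult_distrib)
  qed
  also have "t ^ Suc m * (1 + real (Suc m) * ((x - t) / t)) = t ^ Suc m + real (Suc m) * t ^ m * (x - t)"
    using assms by (simp add: field_simps)
  finally show ?thesis .
qed

text \<open>The perspective \<open>\<alpha>\<close> to the \<open>m + 1\<close> over \<open>a\<close> to the \<open>m\<close> of a convex power is sublinear: both terms on
the right lie above the tangent of the power at the common ratio \<open>(\<alpha> + s \<beta>) / (a + s b)\<close>.\<close>
lemma perspective_power_subadditive:
  fixes a b \<alpha> \<beta> s :: real
  assumes "0 < a" "0 < b" "0 < \<alpha>" "0 < \<beta>" "0 < s"
  shows "(\<alpha> + s * \<beta>) ^ Suc m / (a + s * b) ^ m \<le> \<alpha> ^ Suc m / a ^ m + s * (\<beta> ^ Suc m / b ^ m)"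
proof -
  define t where "t = (\<alpha> + s * \<beta>) / (a + s * b)"
  have ab: "0 < a + s * b" using assms by (simp add: add_pos_pos)
  have t: "0 < t" unfolding t_def using assms ab by (simp add: add_pos_pos)
  have e: "c * (\<gamma> / c) ^ Suc m = \<gamma> ^ Suc m / c ^ m" if "0 < c" for c \<gamma> :: real
    using that by (simp add: power_divide)
  have 1: "a * (t ^ Suc m + real (Suc m) * t ^ m * (\<alpha> / a - t)) \<le> a * (\<alpha> / a) ^ Suc m"
    using assms t by (intro mult_left_mono power_tangent) auto
  have 2: "(s * b) * (t ^ Suc m + real (Suc m) * t ^ m * (\<beta> / b - t)) \<le> (s * b) * (\<beta> / b) ^ Suc m"
    using assms t by (intro mult_left_mono power_tangent) auto
  have "a * (\<alpha> / a - t) + (s * b) * (\<beta> / b - t) = 0"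
  proof -
    have "a * (\<alpha> / a - t) + (s * b) * (\<beta> / b - t) = \<alpha> + s * \<beta> - (a + s * b) * t"
      using assms by (simp add: right_diff_distrib distrib_right)
    also have "(a + s * b) * t = \<alpha> + s * \<beta>" unfolding t_def using ab by simp
    finally show ?thesis by simp
  qed
  then have z: "real (Suc m) * t ^ m * (a * (\<alpha> / a - t) + (s * b) * (\<beta> / b - t)) = 0" by simp
  have "(\<alpha> + s * \<beta>) ^ Suc m / (a + s * b) ^ m = (a + s * b) * t ^ Suc m"
    unfolding t_def using e[OF ab] by simp
  also have "\<dots> = a * (t ^ Suc m + real (Suc m) * t ^ m * (\<alpha> / a - t))
      + (s * b) * (t ^ Suc m + real (Suc m) * t ^ m * (\<beta> / b - t))"
  proof -
    have "a * (K + L * X) + (s * b) * (K + L * Y) = (a + s * b) * K + L * (a * X + (s * b) * Y)" for K L X Y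
      by (simp add: algebra_simps)
    then show ?thesis using z by simp
  qed
  also have "\<dots> \<le> a * (\<alpha> / a) ^ Suc m + (s * b) * (\<beta> / b) ^ Suc m"
    using 1 2 by (rule add_mono)
  also have "\<dots> = \<alpha> ^ Suc m / a ^ m + s * (\<beta> ^ Suc m / b ^ m)"
    using e[OF assms(1), of \<alpha>] e[OF assms(2), of \<beta>] by (simp only: mult.assoc)
  finally show ?thesis .
qed

text \<open>Functions with infinite supremum are brought within reach of the level set argument by cutting
them off at a great height, at the cost of a factor \<open>c < 1\<close> in the integral.\<close>
lemma exists_normalised_truncation:
  fixes \<phi> :: "real \<Rightarrow> ennreal"
  assumes [measurable]: "\<phi> \<in> borel_measurable borel" and c: "0 < c" "c < 1" and t: "0 < t"
    and le: "ennreal t \<le> (\<integral>\<^sup>+x. \<phi> x \<partial>lborel)"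
  obtains \<phi>' r where "\<phi>' \<in> borel_measurable borel" "0 < r" "(SUP x. \<phi>' x) = (1::ennreal)"
    "\<And>x. \<phi>' x \<le> ennreal r * \<phi> x" "ennreal (r * (c * t)) \<le> (\<integral>\<^sup>+x. \<phi>' x \<partial>lborel)"
proof -
  have "c * t < t" using c t by simp
  then have "ennreal (c * t) < (\<integral>\<^sup>+x. \<phi> x \<partial>lborel)"
    using le t by (intro less_le_trans[OF _ le]) (simp add: ennreal_less_iff c(1) less_imp_le)
  also have "(\<integral>\<^sup>+x. \<phi> x \<partial>lborel) = (\<integral>\<^sup>+x. (SUP n. inf (\<phi> x) (of_nat n)) \<partial>lborel)"
    by (simp add: inf_SUP[symmetric] ennreal_SUP_of_nat_eq_top)
  also have "\<dots> = (SUP n. (\<integral>\<^sup>+x. inf (\<phi> x) (of_nat n) \<partial>lborel))"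
    by (rule nn_integral_monotone_convergence_SUP)
       (auto simp: incseq_def le_fun_def intro!: le_infI2)
  finally obtain n :: nat where n: "ennreal (c * t) < (\<integral>\<^sup>+x. inf (\<phi> x) (of_nat n) \<partial>lborel)"
    by (auto simp: less_SUP_iff)
  define A where "A = (SUP x. inf (\<phi> x) (of_nat n))"
  have "A \<le> of_nat n" unfolding A_def by (rule SUP_least) simp
  then have Atop: "A < top" by (rule le_less_trans) (simp add: of_nat_less_top)
  have "A \<noteq> 0"
  proof
    assume "A = 0"
    then have "inf (\<phi> x) (of_nat n) = 0" for x
      unfolding A_def by (metis SUP_upper UNIV_I le_zero_eq)
    then show False using n by simp
  qed
  then obtain q where q: "A = ennreal q" "0 < q" using Atop by (cases A) (auto simp: ennreal_less_zero_iff)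
  show ?thesis
  proof (rule that[of "\<lambda>x. ennreal (1 / q) * inf (\<phi> x) (of_nat n)" "1 / q"])
    show "(SUP x. ennreal (1 / q) * inf (\<phi> x) (of_nat n)) = 1"
      using q by (simp add: SUP_mult_left_ennreal[symmetric] A_def[symmetric] ennreal_mult[symmetric])
    show "ennreal (1 / q * (c * t)) \<le> (\<integral>\<^sup>+x. ennreal (1 / q) * inf (\<phi> x) (of_nat n) \<partial>lborel)"
      using q n c t by (simp add: nn_integral_cmult ennreal_mult' less_imp_le mult_left_mono del: times_divide_eq_left)
  qed (use q in \<open>auto intro: mult_left_mono\<close>)
qed

text \<open>Integrating out one variable lowers the exponent by one. With both suprema normalised to \<open>1\<close> the
superlevel sets can be compared; undoing the normalisation produces the left side of
\<open>perspective_power_subadditive\<close>.\<close>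
lemma pow_concave_nn_integral_real:
  fixes \<phi> \<psi> w :: "real \<Rightarrow> ennreal"
  assumes [measurable]: "\<phi> \<in> borel_measurable borel" "\<psi> \<in> borel_measurable borel" "w \<in> borel_measurable borel"
    and s: "0 < s" and pc: "pow_concave (Suc m) s \<phi> \<psi> w"
    and ab: "0 < a" "0 < b"
    and le: "ennreal (1 / a ^ m) \<le> (\<integral>\<^sup>+x. \<phi> x \<partial>lborel)" "ennreal (1 / b ^ m) \<le> (\<integral>\<^sup>+x. \<psi> x \<partial>lborel)"
  shows "ennreal (1 / (a + s * b) ^ m) \<le> (\<integral>\<^sup>+x. w x \<partial>lborel)"
proof (cases "\<integral>\<^sup>+x. w x \<partial>lborel")
  case (real W)
  have abp: "0 < a + s * b" using ab s by (simp add: add_pos_pos)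
  have "c * (1 / (a + s * b) ^ m) \<le> W" if c: "0 < c" "c < 1" for c
  proof -
    obtain \<phi>' r where \<phi>': "\<phi>' \<in> borel_measurable borel" "0 < r" "(SUP x. \<phi>' x) = 1"
      "\<And>x. \<phi>' x \<le> ennreal r * \<phi> x" "ennreal (r * (c * (1 / a ^ m))) \<le> (\<integral>\<^sup>+x. \<phi>' x \<partial>lborel)"
      by (rule exists_normalised_truncation[OF assms(1) c _ le(1)]) (use ab in auto)
    obtain \<psi>' t where \<psi>': "\<psi>' \<in> borel_measurable borel" "0 < t" "(SUP x. \<psi>' x) = 1"
      "\<And>x. \<psi>' x \<le> ennreal t * \<psi> x" "ennreal (t * (c * (1 / b ^ m))) \<le> (\<integral>\<^sup>+x. \<psi>' x \<partial>lborel)"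
      by (rule exists_normalised_truncation[OF assms(2) c _ le(2)]) (use ab in auto)
    define \<alpha> \<beta> where "\<alpha> = root (Suc m) r" and "\<beta> = root (Suc m) t"
    have \<alpha>: "0 < \<alpha>" "\<alpha> ^ Suc m = r" and \<beta>: "0 < \<beta>" "\<beta> ^ Suc m = t"
      using \<phi>'(2) \<psi>'(2) by (auto simp: \<alpha>_def \<beta>_def simp del: power_Suc)
    define T where "T = (\<alpha> + s * \<beta>) ^ Suc m"
    have Tp: "0 < \<alpha> + s * \<beta>" "0 < T" unfolding T_def using \<alpha> \<beta> s by (auto simp: add_pos_pos simp del: power_Suc)
    have scale: "ennreal (1 / (\<gamma> * root (Suc m) (1 / l)) ^ Suc m) \<le> f"
      if l: "0 < l" "ennreal l < f'" "f' \<le> ennreal (\<gamma> ^ Suc m) * f" and \<gamma>: "0 < \<gamma>" for \<gamma> l f f'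
    proof (cases f)
      case (real F)
      have eq: "(\<gamma> * root (Suc m) (1 / l)) ^ Suc m = \<gamma> ^ Suc m / l"
        using l by (simp add: power_mult_distrib del: power_Suc)
      have "ennreal l \<le> ennreal (\<gamma> ^ Suc m) * ennreal F" using l real by simp
      then have "l \<le> \<gamma> ^ Suc m * F" using real \<gamma> by (simp add: ennreal_mult[symmetric] del: power_Suc)
      then show ?thesis unfolding eq using real l \<gamma>
        by (simp add: field_simps del: power_Suc)
    qed simp
    have "(\<integral>\<^sup>+x. \<phi>' x \<partial>lborel) + ennreal s * (\<integral>\<^sup>+x. \<psi>' x \<partial>lborel) \<le> (\<integral>\<^sup>+x. ennreal T * w x \<partial>lborel)"
    proof (rule level_sets_superadditive)
      fix l x y assume l: "0 < l" "ennreal l < \<phi>' x" "ennreal l < \<psi>' y"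
      \<comment> \<open>\<open>\<alpha> \<mu>\<close> and \<open>\<beta> \<mu>\<close> are the thresholds that belong to the level \<open>l\<close>.\<close>
      define \<mu> where "\<mu> = root (Suc m) (1 / l)"
      have \<mu>: "0 < \<mu>" "\<mu> ^ Suc m = 1 / l" using l by (auto simp: \<mu>_def simp del: power_Suc)
      have "ennreal (1 / (\<alpha> * \<mu>) ^ Suc m) \<le> \<phi> x"
        unfolding \<mu>_def using l \<phi>'(4)[of x] \<alpha> by (intro scale) auto
      moreover have "ennreal (1 / (\<beta> * \<mu>) ^ Suc m) \<le> \<psi> y"
        unfolding \<mu>_def using l \<psi>'(4)[of y] \<beta> by (intro scale) auto
      ultimately have "ennreal (1 / (\<alpha> * \<mu> + s * (\<beta> * \<mu>)) ^ Suc m) \<le> w (x + s *\<^sub>R y)"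
        using \<alpha> \<beta> \<mu> by (intro pow_concaveD[OF pc]) auto
      moreover have "\<alpha> * \<mu> + s * (\<beta> * \<mu>) = (\<alpha> + s * \<beta>) * \<mu>" by (simp add: algebra_simps)
      then have "1 / (\<alpha> * \<mu> + s * (\<beta> * \<mu>)) ^ Suc m = l / T"
        unfolding T_def using \<mu> by (simp add: power_mult_distrib del: power_Suc)
      ultimately have "ennreal T * ennreal (l / T) \<le> ennreal T * w (x + s * y)"
        by (intro mult_left_mono) auto
      then show "ennreal l \<le> ennreal T * w (x + s * y)"
        using Tp l by (simp add: ennreal_mult[symmetric])
    qed (use \<phi>' \<psi>' s in auto)
    also have "\<dots> = ennreal (T * W)" using real Tp by (simp add: nn_integral_cmult ennreal_mult)
    finally have 1: "(\<integral>\<^sup>+x. \<phi>' x \<partial>lborel) + ennreal s * (\<integral>\<^sup>+x. \<psi>' x \<partial>lborel) \<le> ennreal (T * W)" .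
    have "ennreal (r * (c * (1 / a ^ m)) + s * (t * (c * (1 / b ^ m))))
       = ennreal (r * (c * (1 / a ^ m))) + ennreal s * ennreal (t * (c * (1 / b ^ m)))"
    proof -
      have n: "0 \<le> r * (c * (1 / a ^ m))" "0 \<le> t * (c * (1 / b ^ m))"
        using \<phi>'(2) \<psi>'(2) c ab by auto
      show ?thesis
        using ennreal_plus[OF n(1) mult_nonneg_nonneg[OF less_imp_le[OF s] n(2)]]
          ennreal_mult[OF less_imp_le[OF s] n(2)] by (simp only:)
    qed
    also have "\<dots> \<le> ennreal (T * W)"
      by (rule order.trans[OF add_mono[OF \<phi>'(5) mult_left_mono[OF \<psi>'(5)]] 1]) simp
    finally have 2: "r * (c * (1 / a ^ m)) + s * (t * (c * (1 / b ^ m))) \<le> T * W"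
      using real Tp by (simp add: ennreal_le_iff)
    have "c * (T / (a + s * b) ^ m) \<le> c * (r / a ^ m + s * (t / b ^ m))"
      using perspective_power_subadditive[OF ab \<alpha>(1) \<beta>(1) s, of m] c
      unfolding \<alpha>(2) \<beta>(2) T_def by (intro mult_left_mono) auto
    also have "\<dots> \<le> T * W" using 2 by (simp add: algebra_simps)
    finally have "T * (c * (1 / (a + s * b) ^ m)) \<le> T * W" by (simp add: mult.commute)
    then show ?thesis using Tp(2) by (rule mult_left_le_imp_le)
  qed
  then have "1 / (a + s * b) ^ m \<le> W" by (rule field_le_mult_one_interval)
  then show ?thesis using real by simp
qed simp

lemma borel_measurable_vec_lambda:
  fixes f :: "'a \<Rightarrow> 'n::finite \<Rightarrow> real"
  assumes "\<And>i. (\<lambda>w. f w i) \<in> borel_measurable M"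
  shows "(\<lambda>w. \<chi> i. f w i) \<in> borel_measurable M"
  by (rule borel_measurable_euclidean_space[THEN iffD2])
     (auto simp: Basis_vec_def inner_axis assms)

definition coord_upd :: "real ^ 'n \<Rightarrow> 'n \<Rightarrow> real \<Rightarrow> real ^ 'n" where
  "coord_upd x i t = (\<chi> j. if j = i then t else x $ j)"

definition partial_integral :: "'n set \<Rightarrow> (real ^ 'n \<Rightarrow> ennreal) \<Rightarrow> real ^ 'n \<Rightarrow> ennreal" where
  "partial_integral S F x = (\<integral>\<^sup>+y. F (\<chi> i. if i \<in> S then y i else x $ i) \<partial>(\<Pi>\<^sub>M i\<in>S. lborel))"

interpretation lborel_product: product_sigma_finite "\<lambda>_. lborel :: real measure" ..

lemma measurable_merge_coords:
  fixes S :: "'n::finite set"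
  shows "(\<lambda>p. \<chi> i. if i \<in> S then snd p i else fst p $ i) \<in> borel_measurable (borel \<Otimes>\<^sub>M (\<Pi>\<^sub>M i\<in>S. (lborel :: real measure)))"
proof (rule borel_measurable_vec_lambda)
  fix i show "(\<lambda>p. if i \<in> S then snd p i else fst p $ i) \<in> borel_measurable (borel \<Otimes>\<^sub>M (\<Pi>\<^sub>M i\<in>S. (lborel :: real measure)))"
  proof (cases "i \<in> S")
    case True
    have "(\<lambda>y. y i) \<in> measurable (\<Pi>\<^sub>M i\<in>S. (lborel :: real measure)) borel"
      using measurable_component_singleton[OF True, of "\<lambda>_. lborel :: real measure"] by simp
    then show ?thesis using True by simp
  next
    case False
    have [measurable]: "(\<lambda>x::real^'n. x $ i) \<in> borel_measurable borel"
      by (intro borel_measurable_continuous_onI continuous_intros)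
    show ?thesis using False by simp
  qed
qed

lemma measurable_partial_integral [measurable]:
  fixes F :: "real ^ 'n::finite \<Rightarrow> ennreal"
  assumes [measurable]: "F \<in> borel_measurable borel"
  shows "partial_integral S F \<in> borel_measurable borel"
proof -
  interpret S: sigma_finite_measure "\<Pi>\<^sub>M i\<in>S. (lborel :: real measure)"
    by (rule lborel_product.sigma_finite) simp
  have "(\<lambda>p. F (\<chi> i. if i \<in> S then snd p i else fst p $ i)) \<in> borel_measurable (borel \<Otimes>\<^sub>M (\<Pi>\<^sub>M i\<in>S. (lborel :: real measure)))"
    using measurable_merge_coords by (rule measurable_compose) simp
  then show ?thesis unfolding partial_integral_def[abs_def]
    by (intro S.borel_measurable_nn_integral) (simp add: case_prod_beta')
qed

lemma measurable_merge_coords_right: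
  fixes S :: "'n::finite set"
  shows "(\<lambda>y. \<chi> i. if i \<in> S then y i else x $ i) \<in> borel_measurable (\<Pi>\<^sub>M i\<in>S. (lborel :: real measure))"
  using measurable_compose[OF measurable_Pair1' measurable_merge_coords, of x S, unfolded fst_conv snd_conv]
  by (simp cong: if_cong)

lemma measurable_partial_integrand:
  fixes F :: "real ^ 'n::finite \<Rightarrow> ennreal"
  assumes "F \<in> borel_measurable borel"
  shows "(\<lambda>y. F (\<chi> i. if i \<in> S then y i else x $ i)) \<in> borel_measurable (\<Pi>\<^sub>M i\<in>S. (lborel :: real measure))"
  using measurable_merge_coords_right assms by (rule measurable_compose)

lemma partial_integral_insert:
  fixes F :: "real ^ 'n::finite \<Rightarrow> ennreal"
  assumes [measurable]: "F \<in> borel_measurable borel" and i: "i \<notin> S"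
  shows "partial_integral (insert i S) F x = (\<integral>\<^sup>+t. partial_integral S F (coord_upd x i t) \<partial>lborel)"
proof -
  have "partial_integral (insert i S) F x
      = (\<integral>\<^sup>+t. \<integral>\<^sup>+y. F (\<chi> j. if j \<in> insert i S then (y(i := t)) j else x $ j) \<partial>(\<Pi>\<^sub>M i\<in>S. lborel) \<partial>lborel)"
    unfolding partial_integral_def
    by (rule lborel_product.product_nn_integral_insert_rev[OF finite i measurable_partial_integrand[OF assms(1)]])
  also have "\<dots> = (\<integral>\<^sup>+t. partial_integral S F (coord_upd x i t) \<partial>lborel)"
    unfolding partial_integral_def
    by (intro nn_integral_cong arg_cong[where f = F]) (use i in \<open>auto simp: vec_eq_iff coord_upd_def\<close>)
  finally show ?thesis .
qed

lemma partial_integral_empty [simp]: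
  fixes F :: "real ^ 'n::finite \<Rightarrow> ennreal"
  shows "partial_integral {} F x = F x"
  unfolding partial_integral_def by (simp add: PiM_empty nn_integral_count_space_finite)

lemma coord_upd_measurable [measurable]: "(\<lambda>t. coord_upd x i t) \<in> borel_measurable borel"
  unfolding coord_upd_def by (rule borel_measurable_vec_lambda) auto

lemma coord_upd_add_scaleR:
  "coord_upd x i t + s *\<^sub>R coord_upd y i u = coord_upd (x + s *\<^sub>R y) i (t + s * u)"
  by (auto simp: coord_upd_def vec_eq_iff)

text \<open>Each integrated coordinate uses up one unit of the exponent.\<close>
lemma pow_concave_partial_integral:
  fixes \<phi> \<psi> w :: "real ^ 'n::finite \<Rightarrow> ennreal"
  assumes [measurable]: "\<phi> \<in> borel_measurable borel" "\<psi> \<in> borel_measurable borel" "w \<in> borel_measurable borel"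
    and s: "0 < s" and "pow_concave (m + card S) s \<phi> \<psi> w"
  shows "pow_concave m s (partial_integral S \<phi>) (partial_integral S \<psi>) (partial_integral S w)"
  using finite[of S] assms(5)
proof (induction S arbitrary: m rule: finite_induct)
  case empty
  then show ?case by (simp add: pow_concave_def)
next
  case (insert i S)
  then have IH: "pow_concave (Suc m) s (partial_integral S \<phi>) (partial_integral S \<psi>) (partial_integral S w)"
    by simp
  show ?case
    unfolding pow_concave_def
  proof (intro allI impI)
    fix x y :: "real ^ 'n" and a b :: real
    assume ab: "0 < a" "0 < b"
      and le: "ennreal (1 / a ^ m) \<le> partial_integral (insert i S) \<phi> x"
        "ennreal (1 / b ^ m) \<le> partial_integral (insert i S) \<psi> y"
    have "ennreal (1 / (a + s * b) ^ m) \<le> (\<integral>\<^sup>+t. partial_integral S w (coord_upd (x + s *\<^sub>R y) i t) \<partial>lborel)"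
    proof (rule pow_concave_nn_integral_real[OF _ _ _ s _ ab])
      show "pow_concave (Suc m) s (\<lambda>t. partial_integral S \<phi> (coord_upd x i t))
         (\<lambda>t. partial_integral S \<psi> (coord_upd y i t)) (\<lambda>t. partial_integral S w (coord_upd (x + s *\<^sub>R y) i t))"
        unfolding pow_concave_def
      proof (intro allI impI)
        fix t u c d :: real
        assume "0 < c" "0 < d" "ennreal (1 / c ^ Suc m) \<le> partial_integral S \<phi> (coord_upd x i t)"
          "ennreal (1 / d ^ Suc m) \<le> partial_integral S \<psi> (coord_upd y i u)"
        from pow_concaveD[OF IH this]
        show "ennreal (1 / (c + s * d) ^ Suc m) \<le> partial_integral S w (coord_upd (x + s *\<^sub>R y) i (t + s *\<^sub>R u))"
          by (simp only: coord_upd_add_scaleR real_scaleR_def)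
      qed
    qed (use le insert.hyps in \<open>simp_all add: partial_integral_insert\<close>)
    then show "ennreal (1 / (a + s * b) ^ m) \<le> partial_integral (insert i S) w (x + s *\<^sub>R y)"
      using insert.hyps by (simp add: partial_integral_insert)
  qed
qed

lemma lborel_vec_eq_PiM:
  "(lborel :: (real ^ 'n::finite) measure) = distr (\<Pi>\<^sub>M i\<in>UNIV. lborel) borel (\<lambda>y. \<chi> i. y i)"
proof (rule lborel_eqI)
  have m: "(\<lambda>y. \<chi> i. y i) \<in> borel_measurable (\<Pi>\<^sub>M i\<in>(UNIV::'n set). (lborel :: real measure))"
    using measurable_merge_coords_right[of UNIV] by simp
  fix l u :: "real ^ 'n"
  assume lu: "\<And>b. b \<in> Basis \<Longrightarrow> l \<bullet> b \<le> u \<bullet> b"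
  have lu': "l $ i \<le> u $ i" for i using lu[of "axis i 1"] by (simp add: inner_axis axis_in_Basis_iff)
  have "emeasure (distr (\<Pi>\<^sub>M i\<in>UNIV. lborel) borel (\<lambda>y. \<chi> i. y i)) (box l u)
     = emeasure (\<Pi>\<^sub>M i\<in>(UNIV::'n set). lborel) (\<Pi>\<^sub>E i\<in>UNIV. {l $ i <..< u $ i})"
    by (subst emeasure_distr[OF m]) (auto intro!: arg_cong2[where f = emeasure] simp: space_PiM mem_box_cart PiE_def Pi_def)
  also have "\<dots> = (\<Prod>i\<in>UNIV. emeasure lborel {l $ i <..< u $ i})"
    by (rule lborel_product.emeasure_PiM) auto
  also have "\<dots> = ennreal (\<Prod>i\<in>UNIV. (u - l) $ i)"
    using lu' by (subst prod_ennreal[symmetric]) auto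
  also have "(\<Prod>i\<in>UNIV. (u - l) $ i) = (\<Prod>b\<in>Basis. (u - l) \<bullet> b)"
    by (subst prod.reindex_bij_betw[of "\<lambda>i. axis i 1" UNIV Basis, symmetric])
       (auto simp: bij_betw_def inj_on_def Basis_vec_def axis_eq_axis inner_axis)
  finally show "emeasure (distr (\<Pi>\<^sub>M i\<in>UNIV. lborel) borel (\<lambda>y. \<chi> i. y i)) (box l u) = ennreal (\<Prod>b\<in>Basis. (u - l) \<bullet> b)" .
qed simp

lemma nn_integral_lborel_eq_partial_integral:
  fixes F :: "real ^ 'n::finite \<Rightarrow> ennreal"
  assumes [measurable]: "F \<in> borel_measurable borel"
  shows "(\<integral>\<^sup>+x. F x \<partial>lborel) = partial_integral UNIV F x0"
  unfolding partial_integral_def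
  using measurable_merge_coords_right[of UNIV]
  by (subst lborel_vec_eq_PiM, subst nn_integral_distr) auto

definition section_integral :: "'n \<Rightarrow> (real ^ 'n \<Rightarrow> ennreal) \<Rightarrow> real \<Rightarrow> ennreal" where
  "section_integral i F t = partial_integral (UNIV - {i}) F (coord_upd 0 i t)"

lemma measurable_section_integral [measurable]:
  fixes F :: "real ^ 'n::finite \<Rightarrow> ennreal"
  assumes [measurable]: "F \<in> borel_measurable borel"
  shows "section_integral i F \<in> borel_measurable borel"
  unfolding section_integral_def[abs_def] by measurable

lemma nn_integral_section_integral:
  fixes F :: "real ^ 'n::finite \<Rightarrow> ennreal"
  assumes [measurable]: "F \<in> borel_measurable borel"
  shows "(\<integral>\<^sup>+x. F x \<partial>lborel) = (\<integral>\<^sup>+t. section_integral i F t \<partial>lborel)"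
  unfolding section_integral_def nn_integral_lborel_eq_partial_integral[OF assms, of 0]
  using partial_integral_insert[OF assms, of i "UNIV - {i}" 0] by (simp add: insert_absorb)

lemma section_integral_cmult:
  fixes F :: "real ^ 'n::finite \<Rightarrow> ennreal"
  assumes [measurable]: "F \<in> borel_measurable borel"
  shows "section_integral i (\<lambda>x. c * F x) t = c * section_integral i F t"
  unfolding section_integral_def partial_integral_def
  by (rule nn_integral_cmult) (rule measurable_partial_integrand[OF assms])

text \<open>Both sides of the defining implication scale alike. With exponent \<open>0\<close> after integration, this lets
the comparison at level \<open>1\<close> speak about every level.\<close>
lemma pow_concave_scale:
  assumes pc: "pow_concave m s \<phi> \<psi> w" and s: "0 < s" and m: "0 < m" and c: "0 < c"
  shows "pow_concave m s (\<lambda>x. ennreal c * \<phi> x) (\<lambda>x. ennreal c * \<psi> x) (\<lambda>x. ennreal c * w x)"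
  unfolding pow_concave_def
proof (intro allI impI)
  fix x y a b
  assume ab: "0 < a" "0 < b" and le: "ennreal (1 / a ^ m) \<le> ennreal c * \<phi> x" "ennreal (1 / b ^ m) \<le> ennreal c * \<psi> y"
  define \<rho> where "\<rho> = root m c"
  have \<rho>: "0 < \<rho>" "\<rho> ^ m = c" using m c by (auto simp: \<rho>_def)
  have eq: "ennreal (1 / (e * \<rho>) ^ m) = ennreal (inverse c) * ennreal (1 / e ^ m)" if "0 < e" for e
  proof -
    have "1 / (e * \<rho>) ^ m = inverse c * (1 / e ^ m)"
      using \<rho> by (simp add: power_mult_distrib field_simps)
    then show ?thesis using that c by (metis ennreal_mult less_imp_le zero_less_divide_1_iff zero_less_power positive_imp_inverse_positive)
  qed
  have cc: "ennreal (inverse c) * (ennreal c * z) = z" for z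
    using c by (simp add: mult.assoc[symmetric] ennreal_mult[symmetric])
  have cc': "ennreal c * (ennreal (inverse c) * z) = z" for z
    using c by (simp add: mult.assoc[symmetric] ennreal_mult[symmetric])
  have abp: "0 < a + s * b" if "0 < s" using ab that by (simp add: add_pos_pos)
  have "ennreal (1 / (a * \<rho>) ^ m) \<le> \<phi> x" "ennreal (1 / (b * \<rho>) ^ m) \<le> \<psi> y"
    using mult_left_mono[OF le(1), of "ennreal (inverse c)"] mult_left_mono[OF le(2), of "ennreal (inverse c)"] c ab
    unfolding cc eq[OF ab(1)] eq[OF ab(2)] by simp_all
  then have "ennreal (1 / (a * \<rho> + s * (b * \<rho>)) ^ m) \<le> w (x + s *\<^sub>R y)"
    using ab \<rho> by (intro pow_concaveD[OF pc]) auto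
  also have "a * \<rho> + s * (b * \<rho>) = (a + s * b) * \<rho>" by (simp add: algebra_simps)
  finally have "ennreal c * (ennreal (inverse c) * ennreal (1 / (a + s * b) ^ m)) \<le> ennreal c * w (x + s *\<^sub>R y)"
    unfolding eq[OF abp[OF s]] by (intro mult_left_mono) auto
  then show "ennreal (1 / (a + s * b) ^ m) \<le> ennreal c * w (x + s *\<^sub>R y)"
    unfolding cc' .
qed

text \<open>Integrating out the \<open>d\<close> coordinates other than \<open>i\<close> leaves exponent \<open>0\<close>, that is, an inclusion
between superlevel sets of the integrals over hyperplanes. Because these integrals have equal suprema, the
last coordinate is handled by \<open>level_sets_superadditive\<close>. In this way the integrals add up,
where without the condition on the suprema only their minimum would bound the right side.\<close>
theorem brunn_minkowski_equal_sections:
  fixes \<phi> \<psi> w :: "real ^ 'n::finite \<Rightarrow> ennreal"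
  assumes [measurable]: "\<phi> \<in> borel_measurable borel" "\<psi> \<in> borel_measurable borel" "w \<in> borel_measurable borel"
    and s: "0 < s" and d: "CARD('n) = Suc d" "0 < d" and pc: "pow_concave d s \<phi> \<psi> w"
    and sup: "(SUP t. section_integral i \<phi> t) = (SUP t. section_integral i \<psi> t)"
  shows "(\<integral>\<^sup>+x. \<phi> x \<partial>lborel) + ennreal s * (\<integral>\<^sup>+x. \<psi> x \<partial>lborel) \<le> (\<integral>\<^sup>+x. w x \<partial>lborel)"
  unfolding nn_integral_section_integral[of _ i, OF assms(1)] nn_integral_section_integral[of _ i, OF assms(2)]
    nn_integral_section_integral[of _ i, OF assms(3)]
proof (rule level_sets_superadditive)
  fix l t u :: real
  assume l: "0 < l" "ennreal l < section_integral i \<phi> t" "ennreal l < section_integral i \<psi> u"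
  let ?n = "\<lambda>F x. ennreal (1 / l) * F x"
  have card: "card (UNIV - {i}) = d" using d by simp
  have cc: "ennreal l * (ennreal (1 / l) * z) = z" for z
    using l by (simp add: mult.assoc[symmetric] ennreal_mult[symmetric])
  have one: "1 \<le> ?n (section_integral i F) t" if "ennreal l < section_integral i F t" for F t
    using mult_left_mono[OF less_imp_le[OF that], of "ennreal (1 / l)"] l by (simp add: ennreal_mult[symmetric])
  have "pow_concave d s (?n \<phi>) (?n \<psi>) (?n w)"
    using pc s d l by (intro pow_concave_scale) auto
  then have "pow_concave 0 s (partial_integral (UNIV - {i}) (?n \<phi>)) (partial_integral (UNIV - {i}) (?n \<psi>)) (partial_integral (UNIV - {i}) (?n w))"
    using card s by (intro pow_concave_partial_integral) auto
  from pow_concaveD[OF this, of 1 1 "coord_upd 0 i t" "coord_upd 0 i u"]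
  have "1 \<le> section_integral i (?n w) (t + s * u)"
    using l one[of \<phi> t] one[of \<psi> u]
    unfolding section_integral_def[symmetric] coord_upd_add_scaleR
    by (simp add: section_integral_cmult section_integral_def[symmetric])
  then have "ennreal l * 1 \<le> ennreal l * (?n (section_integral i w) (t + s * u))"
    by (intro mult_left_mono) (simp_all add: section_integral_cmult)
  then show "ennreal l \<le> section_integral i w (t + s * u)" unfolding cc by simp
qed (use s sup in auto)

section \<open>Functions with continuous gradients\<close>

lemma continuous_zero_outside_ball:
  fixes D :: "'a::euclidean_space \<Rightarrow> 'b::real_normed_vector"
  assumes c: "continuous_on UNIV D" and z: "\<And>x. R < norm x \<Longrightarrow> D x = 0"
  shows "uniformly_continuous_on UNIV D" "\<exists>M>0. \<forall>x. norm (D x) \<le> M"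
proof -
  have uc: "uniformly_continuous_on (cball 0 (R + 2)) D"
    by (rule compact_uniformly_continuous[OF continuous_on_subset[OF c]]) auto
  show "uniformly_continuous_on UNIV D"
    unfolding uniformly_continuous_on_def
  proof (intro allI impI)
    fix e :: real assume e: "0 < e"
    obtain d where d: "d > 0" "\<And>x y. x \<in> cball 0 (R + 2) \<Longrightarrow> y \<in> cball 0 (R + 2) \<Longrightarrow> dist y x < d \<Longrightarrow> dist (D y) (D x) < e"
      using uc e unfolding uniformly_continuous_on_def by metis
    have "dist (D y) (D x) < e" if xy: "dist y x < min d 1" for x y
    proof (cases "norm x \<le> R + 1")
      case True
      then have "norm y \<le> R + 2" using xy norm_triangle_sub[of y x] by (simp add: dist_norm)
      then show ?thesis using True xy by (intro d(2)) auto
    next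
      case False
      then have "R < norm y" using xy norm_triangle_sub[of x y] by (simp add: dist_norm norm_minus_commute)
      then show ?thesis using False z[of x] z[of y] e by simp
    qed
    then show "\<exists>d>0. \<forall>x\<in>UNIV. \<forall>x'\<in>UNIV. dist x' x < d \<longrightarrow> dist (D x') (D x) < e"
      using d(1) by (intro exI[of _ "min d 1"]) auto
  qed
  have "compact (D ` cball 0 R)"
    by (rule compact_continuous_image[OF continuous_on_subset[OF c]]) auto
  then have "bounded (D ` cball 0 R)" by (rule compact_imp_bounded)
  then obtain M where M: "M > 0" "\<And>y. y \<in> D ` cball 0 R \<Longrightarrow> norm y \<le> M"
    unfolding bounded_pos by blast
  have "norm (D x) \<le> M" for x
  proof (cases "norm x \<le> R")
    case True
    then show ?thesis by (intro M(2)) auto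
  next
    case False
    then show ?thesis using z[of x] M(1) by simp
  qed
  then show "\<exists>M>0. \<forall>x. norm (D x) \<le> M" using M(1) by blast
qed

lemma GDERIV_imp_continuous_on: "(\<And>x. GDERIV f x :> Df x) \<Longrightarrow> continuous_on S f"
  unfolding gderiv_def by (auto intro!: continuous_at_imp_continuous_on has_derivative_continuous)

lemma GDERIV_unique: "GDERIV f x :> D \<Longrightarrow> GDERIV f x :> E \<Longrightarrow> D = E"
  unfolding gderiv_def
  by (drule (1) has_derivative_unique) (metis inner_commute vector_eq_ldot)

lemma GDERIV_cong_open:
  assumes "GDERIV f x :> D" "open S" "x \<in> S" "\<And>y. y \<in> S \<Longrightarrow> f y = g y"
  shows "GDERIV g x :> D"
  using assms has_derivative_transform_within_open[of f _ x UNIV S g] unfolding gderiv_def by auto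

lemma GDERIV_zero_outside_ball:
  fixes f :: "'a::real_inner \<Rightarrow> real"
  assumes f: "\<And>x. GDERIV f x :> Df x" and f0: "\<And>x. r < norm x \<Longrightarrow> f x = 0" and x: "r < norm x"
  shows "Df x = 0"
proof (rule GDERIV_unique[OF f])
  have "open {x::'a. r < norm x}" by (intro open_Collect_less continuous_intros)
  then show "GDERIV f x :> 0"
    using f0 x by (intro GDERIV_cong_open[OF GDERIV_const[of 0], where S = "{x. r < norm x}"]) auto
qed

lemma GDERIV_linearization_bound:
  fixes f :: "'a::real_inner \<Rightarrow> real"
  assumes f: "\<And>x. GDERIV f x :> Df x"
    and B: "\<And>t. 0 \<le> t \<Longrightarrow> t \<le> 1 \<Longrightarrow> norm (Df (a + t *\<^sub>R (b - a)) - Df a) \<le> B"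
  shows "\<bar>f b - f a - Df a \<bullet> (b - a)\<bar> \<le> norm (b - a) * B"
proof -
  have "norm (f b - f a - (b - a) \<bullet> Df a) \<le> norm (b - a) * B"
  proof (rule differentiable_bound_linearization[where S="(\<lambda>t. a + t *\<^sub>R (b - a)) ` {0..1}" and f' = "\<lambda>x h. h \<bullet> Df x"])
    show "a \<in> (\<lambda>t. a + t *\<^sub>R (b - a)) ` {0..1}"
      by (rule image_eqI[of _ _ 0]) auto
  next
    fix x assume "x \<in> (\<lambda>t. a + t *\<^sub>R (b - a)) ` {0..1}"
    then have "norm (Df x - Df a) \<le> B" using B by auto
    then have le: "norm h * norm (Df x - Df a) \<le> B * norm h" for h :: 'a
      using mult_right_mono[of "norm (Df x - Df a)" B "norm h"] by (simp add: mult.commute)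
    have "0 \<le> B" using \<open>norm (Df x - Df a) \<le> B\<close> norm_ge_zero order.trans by blast
    then show "onorm ((\<lambda>h. h \<bullet> Df x) - (\<lambda>h. h \<bullet> Df a)) \<le> B"
    proof (rule onorm_bound)
      fix h
      have "norm (h \<bullet> (Df x - Df a)) \<le> norm h * norm (Df x - Df a)"
        by (simp add: Cauchy_Schwarz_ineq2)
      then show "norm (((\<lambda>h. h \<bullet> Df x) - (\<lambda>h. h \<bullet> Df a)) h) \<le> B * norm h"
        using le[of h] by (simp add: inner_diff_right)
    qed
  qed (use f in \<open>auto simp: gderiv_def intro: has_derivative_at_withinI\<close>)
  then show ?thesis by (simp add: inner_commute)
qed

lemma Youngs_inequality_weighted:
  fixes p q c a b :: real
  assumes pq: "1 < p" "1 < q" "1 / p + 1 / q = 1" and c: "0 < c" and ab: "0 \<le> a" "0 \<le> b"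
  shows "a * b \<le> c powr (- p / q) * (a powr p / p) + c * (b powr q / q)"
proof -
  have "a * b = (c powr (- 1 / q) * a) * (c powr (1 / q) * b)"
    using c by (simp add: powr_minus field_simps)
  also have "\<dots> \<le> (c powr (- 1 / q) * a) powr p / p + (c powr (1 / q) * b) powr q / q"
    using ab by (intro Youngs_inequality pq) auto
  also have "\<dots> = c powr (- p / q) * (a powr p / p) + c * (b powr q / q)"
    using c ab pq by (simp add: powr_mult powr_powr)
  finally show ?thesis .
qed

section \<open>The extremal profile\<close>

text \<open>Up to a constant factor in the variable and in the value, the power \<open>-(N - p) / p\<close> of this function is the Aubin--Talenti
extremal of the Sobolev inequality, for \<open>q\<close> the exponent conjugate to \<open>p\<close>.\<close>
definition profile :: "real \<Rightarrow> 'a::real_inner \<Rightarrow> real" where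
  "profile q y = 1 + norm y powr q / q"

text \<open>At the origin the value is \<open>0\<close> for every \<open>q\<close>, which is the gradient of the profile when \<open>1 < q\<close>.\<close>
definition profile_grad :: "real \<Rightarrow> 'a::real_inner \<Rightarrow> 'a" where
  "profile_grad q y = norm y powr (q - 2) *\<^sub>R y"

lemma profile_ge_1: "0 < q \<Longrightarrow> 1 \<le> profile q y"
  by (simp add: profile_def)

lemma profile_pos [simp]: "0 < q \<Longrightarrow> 0 < profile q y"
  using profile_ge_1[of q y] by simp

lemma profile_nonneg [simp]: "0 < q \<Longrightarrow> 0 \<le> profile q y"
  using profile_ge_1[of q y] by simp

lemma norm_profile_grad: "norm (profile_grad q y) = norm y powr (q - 1)"
proof (cases "y = 0")
  case False
  then have "norm y powr (q - 2) * norm y powr 1 = norm y powr (q - 1)"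
    by (subst powr_add[symmetric]) simp
  then show ?thesis using False by (simp add: profile_grad_def)
qed (simp add: profile_grad_def)

lemma continuous_on_profile_grad:
  assumes q: "1 < q"
  shows "continuous_on UNIV (profile_grad q :: 'a::real_inner \<Rightarrow> 'a)"
proof -
  have "isCont (profile_grad q) x" for x :: 'a
  proof (cases "x = 0")
    case True
    have "((\<lambda>y::'a. norm y powr (q - 1)) \<longlongrightarrow> norm (0::'a) powr (q - 1)) (at 0)"
      using q by (intro tendsto_powr' tendsto_norm tendsto_ident_at tendsto_const) auto
    then have "((\<lambda>y::'a. norm (profile_grad q y)) \<longlongrightarrow> 0) (at 0)"
      using q by (simp add: norm_profile_grad)
    then have "(profile_grad q \<longlongrightarrow> (0::'a)) (at 0)" by (rule tendsto_norm_zero_cancel)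
    then show ?thesis using True by (simp add: isCont_def profile_grad_def)
  next
    case False
    then show ?thesis
      unfolding profile_grad_def[abs_def] by (intro continuous_intros) auto
  qed
  then show ?thesis by (simp add: continuous_on_eq_continuous_at)
qed

lemma GDERIV_profile:
  fixes y :: "'a::real_inner"
  assumes q: "1 < q"
  shows "GDERIV (profile q) y :> profile_grad q y"
proof (cases "y = 0")
  case False
  have "GDERIV (\<lambda>y. norm y powr q) y :> (q * norm y powr (q - 1)) *\<^sub>R sgn y"
    using False by (intro GDERIV_DERIV_compose GDERIV_norm has_real_derivative_powr) auto
  then have "GDERIV (\<lambda>y. 1 + norm y powr q * (1 / q)) y :>
      0 + ((norm y powr q) *\<^sub>R 0 + (1 / q) *\<^sub>R ((q * norm y powr (q - 1)) *\<^sub>R sgn y))"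
    by (intro GDERIV_add GDERIV_mult GDERIV_const)
  also have "0 + ((norm y powr q) *\<^sub>R 0 + (1 / q) *\<^sub>R ((q * norm y powr (q - 1)) *\<^sub>R sgn y)) = profile_grad q y"
  proof -
    have "norm y powr (q - 1) = norm y powr (q - 2) * norm y powr 1"
      by (subst powr_add[symmetric]) simp
    then show ?thesis using False q by (simp add: profile_grad_def sgn_div_norm)
  qed
  finally show ?thesis by (simp add: profile_def[abs_def])
next
  case True
  have "((\<lambda>h::'a. norm h powr (q - 1)) \<longlongrightarrow> norm (0::'a) powr (q - 1)) (at 0)"
    using q by (intro tendsto_powr' tendsto_norm tendsto_ident_at tendsto_const) auto
  then have "((\<lambda>h::'a. norm h powr (q - 1) / q) \<longlongrightarrow> 0) (at 0)"
    using q by (intro tendsto_eq_intros) auto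
  moreover have "norm h powr (q - 1) / q = norm (norm h powr q / q) / norm h" for h :: 'a
  proof (cases "h = 0")
    case False
    have "norm h powr q = norm h powr (q - 1) * norm h powr 1"
      by (subst powr_add[symmetric]) simp
    then show ?thesis using False q by simp
  qed simp
  ultimately show ?thesis
    using True q by (simp add: gderiv_def has_derivative_at profile_def profile_grad_def)
qed

lemma continuous_on_profile: "1 < q \<Longrightarrow> continuous_on UNIV (profile q :: 'a::real_inner \<Rightarrow> real)"
  by (rule GDERIV_imp_continuous_on[OF GDERIV_profile])

text \<open>Expanding, the claim becomes Young's inequality for the product of \<open>|x|\<close> and \<open>|z|\<close> to the power \<open>q - 1\<close>.\<close>
lemma profile_convex:
  fixes x z :: "'a::real_inner"
  assumes q: "1 < q"
  shows "profile q z + profile_grad q z \<bullet> (x - z) \<le> profile q x"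
proof -
  define p where "p = q / (q - 1)"
  have p: "1 < p" "1 / p + 1 / q = 1" using q by (auto simp: p_def field_simps)
  have zz: "profile_grad q z \<bullet> z = norm z powr q"
  proof (cases "z = 0")
    case False
    have "norm z powr q = norm z powr (q - 2) * (norm z powr 1 * norm z powr 1)"
      by (subst powr_add[symmetric])+ simp
    then show ?thesis using False by (simp add: profile_grad_def power2_norm_eq_inner[symmetric] power2_eq_square)
  qed (use q in \<open>simp add: profile_grad_def\<close>)
  have "profile_grad q z \<bullet> x \<le> norm (profile_grad q z) * norm x"
    by (rule norm_cauchy_schwarz)
  also have "\<dots> \<le> norm (profile_grad q z) powr p / p + norm x powr q / q"
    by (intro Youngs_inequality p q) auto
  also have "norm (profile_grad q z) powr p = norm z powr q"
    unfolding norm_profile_grad using q by (simp add: powr_powr p_def)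
  also have "norm z powr q / p = norm z powr q - norm z powr q / q"
  proof -
    have "1 / p = 1 - 1 / q" using p by simp
    then have "norm z powr q * (1 / p) = norm z powr q * (1 - 1 / q)" by simp
    then show ?thesis by (simp add: right_diff_distrib)
  qed
  finally show ?thesis by (simp add: profile_def inner_diff_right zz)
qed

section \<open>Functions that agree with a multiple of the profile near infinity\<close>

text \<open>Equality with a multiple of the profile near infinity leaves a remainder with compact support,
whose gradient is uniformly continuous, while the multiple of the profile itself is convex. Together these give
first-order estimates that are uniform over the whole space.\<close>
definition profile_like :: "real \<Rightarrow> ('a::euclidean_space \<Rightarrow> real) \<Rightarrow> ('a \<Rightarrow> 'a) \<Rightarrow> bool" where
  "profile_like q f Df \<longleftrightarrow> (\<forall>x. 0 < f x) \<and> (\<forall>x. GDERIV f x :> Df x) \<and> continuous_on UNIV Df \<and>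
     (\<exists>\<kappa> R. 0 < \<kappa> \<and> (\<forall>x. R < norm x \<longrightarrow> f x = \<kappa> * profile q x))"

lemma profile_like_decompose:
  fixes f :: "'a::euclidean_space \<Rightarrow> real"
  assumes q: "1 < q" and pl: "profile_like q f Df"
  obtains \<kappa> r Dr R where "0 < \<kappa>" "\<And>x. f x = \<kappa> * profile q x + r x" "\<And>x. Df x = \<kappa> *\<^sub>R profile_grad q x + Dr x"
    "\<And>x. GDERIV r x :> Dr x" "continuous_on UNIV Dr" "\<And>x. R < norm x \<Longrightarrow> r x = 0" "\<And>x. R < norm x \<Longrightarrow> Dr x = 0"
proof -
  obtain \<kappa> R where k: "0 < \<kappa>" "\<And>x. R < norm x \<Longrightarrow> f x = \<kappa> * profile q x"
    and f: "\<And>x. GDERIV f x :> Df x" and c: "continuous_on UNIV Df"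
    using pl unfolding profile_like_def by auto
  define r where "r x = f x - \<kappa> * profile q x" for x
  define Dr where "Dr x = Df x - \<kappa> *\<^sub>R profile_grad q x" for x
  have d: "GDERIV r x :> Dr x" for x
  proof -
    have "GDERIV r x :> Df x - (\<kappa> *\<^sub>R profile_grad q x + profile q x *\<^sub>R 0)"
      unfolding r_def by (intro GDERIV_diff GDERIV_mult GDERIV_const f GDERIV_profile q)
    then show ?thesis by (simp add: Dr_def)
  qed
  have z: "Dr x = 0" if "R < norm x" for x
    using k(2) that by (intro GDERIV_zero_outside_ball[OF d, of R]) (simp add: r_def)
  show ?thesis
    by (rule that[of \<kappa> r Dr R])
       (use k d z c in \<open>auto simp: r_def Dr_def intro!: continuous_intros continuous_on_profile_grad q\<close>)
qed

text \<open>The error does not depend on \<open>z\<close>. The multiple of the profile lies above its tangents. For the remainder, a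
displacement \<open>s |y|\<close> within the modulus of continuity of the gradient costs at most \<open>s e |y|\<close>; a longer one
costs at most \<open>2 M s |y|\<close>, and since then \<open>|y|\<close> is at least of order \<open>1 / s\<close>, this is small compared with
\<open>s |y|\<^sup>q\<close>.\<close>
lemma profile_like_lower_bound:
  fixes f :: "'a::euclidean_space \<Rightarrow> real"
  assumes q: "1 < q" and pl: "profile_like q f Df" and e: "0 < e"
  obtains s0 where "0 < s0" "\<And>s y z. 0 < s \<Longrightarrow> s < s0 \<Longrightarrow>
     f z - s * (Df z \<bullet> y) - s * e * (1 + norm y powr q) \<le> f (z - s *\<^sub>R y)"
proof -
  obtain \<kappa> r Dr R where k: "0 < \<kappa>" and f: "\<And>x. f x = \<kappa> * profile q x + r x"
    and Df: "\<And>x. Df x = \<kappa> *\<^sub>R profile_grad q x + Dr x"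
    and r: "\<And>x. GDERIV r x :> Dr x" and c: "continuous_on UNIV Dr" and z: "\<And>x. R < norm x \<Longrightarrow> Dr x = 0"
    using profile_like_decompose[OF q pl] by metis
  obtain M where M: "M > 0" "\<And>x. norm (Dr x) \<le> M" using continuous_zero_outside_ball(2)[OF c z] by blast
  obtain d where d: "d > 0" "\<And>x y. dist y x < d \<Longrightarrow> dist (Dr y) (Dr x) < e"
    using continuous_zero_outside_ball(1)[OF c z] e unfolding uniformly_continuous_on_def by (metis UNIV_I)
  \<comment> \<open>The choice makes \<open>2 M |y| \<le> e |y|\<^sup>q\<close> whenever \<open>s < s0\<close> and \<open>s |y| \<ge> d\<close>.\<close>
  define s0 where "s0 = d * (e / (2 * M)) powr (1 / (q - 1))"
  have s0: "0 < s0" unfolding s0_def using d e M by simp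
  have err: "\<bar>r (z - s *\<^sub>R y) - r z - Dr z \<bullet> (- s *\<^sub>R y)\<bar> \<le> s * e * (1 + norm y powr q)"
    if s: "0 < s" "s < s0" for s :: real and y z :: 'a
  proof (cases "s * norm y < d")
    case True
    have "\<bar>r (z - s *\<^sub>R y) - r z - Dr z \<bullet> (z - s *\<^sub>R y - z)\<bar> \<le> norm (z - s *\<^sub>R y - z) * e"
    proof (rule GDERIV_linearization_bound[OF r])
      fix t :: real assume t: "0 \<le> t" "t \<le> 1"
      have "t * (s * norm y) \<le> 1 * (s * norm y)" using t s by (intro mult_right_mono) auto
      then have "t * s * norm y < d" using True unfolding mult_1_left mult.assoc by (rule le_less_trans)
      then have "dist (z + t *\<^sub>R (z - s *\<^sub>R y - z)) z < d" using t s by (simp add: dist_norm abs_mult)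
      from d(2)[OF this] show "norm (Dr (z + t *\<^sub>R (z - s *\<^sub>R y - z)) - Dr z) \<le> e" by (simp add: dist_norm)
    qed
    also have "norm (z - s *\<^sub>R y - z) * e = s * e * norm y" using s by simp
    also have "\<dots> \<le> s * e * (1 + norm y powr q)"
    proof -
      have "norm y \<le> 1 + norm y powr q"
      proof (cases "norm y \<le> 1")
        case False
        then have "norm y powr 1 \<le> norm y powr q" using q by (intro powr_mono) auto
        then show ?thesis using False by simp
      qed (simp add: add_increasing2)
      then show ?thesis using s e by (intro mult_left_mono) auto
    qed
    finally show ?thesis by simp
  next
    case False
    have y: "0 < norm y" using False d s by (auto intro: ccontr)
    have "\<bar>r (z - s *\<^sub>R y) - r z - Dr z \<bullet> (z - s *\<^sub>R y - z)\<bar> \<le> norm (z - s *\<^sub>R y - z) * (2 * M)"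
    proof (rule GDERIV_linearization_bound[OF r])
      fix t :: real
      show "norm (Dr (z + t *\<^sub>R (z - s *\<^sub>R y - z)) - Dr z) \<le> 2 * M"
        using norm_triangle_ineq4[of "Dr (z + t *\<^sub>R (z - s *\<^sub>R y - z))" "Dr z"] M(2)[of "z + t *\<^sub>R (z - s *\<^sub>R y - z)"] M(2)[of z]
        by linarith
    qed
    also have "norm (z - s *\<^sub>R y - z) * (2 * M) = s * (2 * M * norm y)" using s by simp
    also have "\<dots> \<le> s * (e * norm y powr q)"
    proof -
      have "s / d \<le> (e / (2 * M)) powr (1 / (q - 1))"
        using s d unfolding s0_def by (simp add: field_simps)
      moreover have "1 / norm y \<le> s / d" using False y d by (simp add: field_simps)
      ultimately have "1 / norm y \<le> (e / (2 * M)) powr (1 / (q - 1))" by simp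
      then have "(1 / norm y) powr (q - 1) \<le> ((e / (2 * M)) powr (1 / (q - 1))) powr (q - 1)"
        using q by (intro powr_mono2) auto
      also have "\<dots> = e / (2 * M)" using q e M by (simp add: powr_powr)
      also have "(1 / norm y) powr (q - 1) = 1 / norm y powr (q - 1)"
        using y by (simp add: powr_divide)
      finally have "2 * M \<le> e * norm y powr (q - 1)"
        using y M by (simp add: field_simps)
      then have "2 * M * norm y \<le> e * norm y powr (q - 1) * norm y"
        using y by (intro mult_right_mono) auto
      also have "\<dots> = e * (norm y powr (q - 1) * norm y powr 1)" using y by simp
      also have "norm y powr (q - 1) * norm y powr 1 = norm y powr q"
        by (subst powr_add[symmetric]) simp
      finally show ?thesis using s by (intro mult_left_mono) auto
    qed
    also have "\<dots> \<le> s * e * (1 + norm y powr q)" using s e by (simp add: algebra_simps)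
    finally show ?thesis by simp
  qed
  show ?thesis
  proof (rule that[OF s0])
    fix s :: real and y z :: 'a assume s: "0 < s" "s < s0"
    have "profile q z + profile_grad q z \<bullet> (z - s *\<^sub>R y - z) \<le> profile q (z - s *\<^sub>R y)"
      by (rule profile_convex[OF q])
    then have "\<kappa> * (profile q z + profile_grad q z \<bullet> (z - s *\<^sub>R y - z)) \<le> \<kappa> * profile q (z - s *\<^sub>R y)"
      using k by (intro mult_left_mono) auto
    moreover have "r z + Dr z \<bullet> (- s *\<^sub>R y) - s * e * (1 + norm y powr q) \<le> r (z - s *\<^sub>R y)"
      using err[OF s, of z y] by linarith
    ultimately show "f z - s * (Df z \<bullet> y) - s * e * (1 + norm y powr q) \<le> f (z - s *\<^sub>R y)"
      unfolding f Df by (simp add: algebra_simps inner_add_left)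
  qed
qed

text \<open>Inside the ball by compactness, outside it by the explicit formulas; the powers match because
\<open>(q - 1) p = q\<close>.\<close>
lemma profile_like_comparable:
  fixes f :: "'a::euclidean_space \<Rightarrow> real"
  assumes pq: "1 < p" "1 < q" "1 / p + 1 / q = 1" and pl: "profile_like q f Df"
  obtains C where "0 < C" "\<And>x. profile q x \<le> C * f x" "\<And>x. f x \<le> C * profile q x" "\<And>x. norm (Df x) powr p \<le> C * f x"
proof -
  note q = pq(2)
  obtain \<kappa> r Dr R where k: "0 < \<kappa>" and f: "\<And>x. f x = \<kappa> * profile q x + r x"
    and Df: "\<And>x. Df x = \<kappa> *\<^sub>R profile_grad q x + Dr x"
    and r: "\<And>x. GDERIV r x :> Dr x" and c: "continuous_on UNIV Dr" and z: "\<And>x. R < norm x \<Longrightarrow> r x = 0" "\<And>x. R < norm x \<Longrightarrow> Dr x = 0"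
    using profile_like_decompose[OF q pl] by metis
  have fp: "0 < f x" for x using pl by (auto simp: profile_like_def)
  have cf: "continuous_on UNIV f"
    using pl by (intro GDERIV_imp_continuous_on[of f Df]) (simp add: profile_like_def)
  have cDf: "continuous_on UNIV Df" using pl by (auto simp: profile_like_def)
  have bnd: "\<exists>C. \<forall>x. norm x \<le> R \<longrightarrow> h x \<le> C" if "continuous_on UNIV h" for h :: "'a \<Rightarrow> real"
  proof -
    have "compact (h ` cball 0 R)" by (rule compact_continuous_image[OF continuous_on_subset[OF that]]) auto
    then have "bounded (h ` cball 0 R)" by (rule compact_imp_bounded)
    then obtain B where "\<And>y. y \<in> h ` cball 0 R \<Longrightarrow> norm y \<le> B"
      unfolding bounded_iff by blast
    then have "\<forall>x. norm x \<le> R \<longrightarrow> h x \<le> B" by (auto intro: order.trans[OF abs_ge_self])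
    then show ?thesis by blast
  qed
  have cpr: "continuous_on UNIV (profile q :: 'a \<Rightarrow> real)" by (rule continuous_on_profile[OF q])
  have ne: "f x \<noteq> 0" "profile q x \<noteq> 0" for x :: 'a
    using fp[of x] less_imp_neq[OF profile_pos[of q x]] q by auto
  obtain C1 where C1: "\<And>x. norm x \<le> R \<Longrightarrow> profile q x / f x \<le> C1"
    using bnd[of "\<lambda>x. profile q x / f x"] cpr cf ne by (auto intro!: continuous_intros)
  obtain C2 where C2: "\<And>x. norm x \<le> R \<Longrightarrow> f x / profile q x \<le> C2"
    using bnd[of "\<lambda>x. f x / profile q x"] cpr cf ne by (auto intro!: continuous_intros)
  have "continuous_on UNIV (\<lambda>x. norm (Df x) powr p / f x)"
    using cDf cf ne(1) pq(1) by (intro continuous_intros continuous_on_powr') auto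
  then obtain C3 where C3: "\<And>x. norm x \<le> R \<Longrightarrow> norm (Df x) powr p / f x \<le> C3"
    using bnd by blast
  define C where "C = 1 + \<bar>C1\<bar> + \<bar>C2\<bar> + \<bar>C3\<bar> + 1 / \<kappa> + \<kappa> + \<kappa> powr (p - 1) * q"
  have "0 < 1 / \<kappa>" "0 \<le> \<kappa> powr (p - 1) * q" using k q by auto
  then
  have C: "1 \<le> C" "C1 \<le> C" "C2 \<le> C" "C3 \<le> C" "1 / \<kappa> \<le> C" "\<kappa> \<le> C" "\<kappa> powr (p - 1) * q \<le> C"
    unfolding C_def using k by linarith+
  show ?thesis
  proof (rule that[of C])
    fix x
    show "profile q x \<le> C * f x"
    proof (cases "norm x \<le> R")
      case True
      then have "profile q x / f x \<le> C" using C1[of x] C by simp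
      then show ?thesis using fp[of x] by (simp add: field_simps)
    next
      case False
      then have "profile q x = 1 / \<kappa> * f x" using f[of x] z(1)[of x] k by simp
      also have "\<dots> \<le> C * f x" using C fp[of x] by (intro mult_right_mono) auto
      finally show ?thesis .
    qed
    show "f x \<le> C * profile q x"
    proof (cases "norm x \<le> R")
      case True
      then have "f x / profile q x \<le> C" using C2[of x] C by simp
      then show ?thesis using profile_pos[of q x] q by (simp add: field_simps)
    next
      case False
      then have "f x = \<kappa> * profile q x" using f[of x] z(1)[of x] by simp
      also have "\<dots> \<le> C * profile q x" using C profile_pos[of q x] q by (intro mult_right_mono) auto
      finally show ?thesis .
    qed
    show "norm (Df x) powr p \<le> C * f x"
    proof (cases "norm x \<le> R")
      case True
      then have "norm (Df x) powr p / f x \<le> C" using C3[of x] C by simp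
      then show ?thesis using fp[of x] by (simp add: field_simps)
    next
      case False
      then have D: "Df x = \<kappa> *\<^sub>R profile_grad q x" and fx: "f x = \<kappa> * profile q x"
        using f[of x] Df[of x] z[of x] by simp_all
      have "(q - 1) * p = q" using pq by (simp add: field_simps)
      then have "norm (Df x) powr p = \<kappa> powr p * norm x powr q"
        unfolding D using k by (simp add: norm_profile_grad powr_mult powr_powr)
      also have "\<dots> = (\<kappa> powr (p - 1) * q) * (\<kappa> * (norm x powr q / q))"
      proof -
        have "\<kappa> powr p = \<kappa> powr (p - 1) * \<kappa> powr 1" by (subst powr_add[symmetric]) simp
        then show ?thesis using k q by simp
      qed
      also have "\<dots> \<le> C * (\<kappa> * (norm x powr q / q))"
        using C k q by (intro mult_right_mono) auto
      also have "\<dots> \<le> C * f x" unfolding fx profile_def using C k q by (intro mult_left_mono) auto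
      finally show ?thesis .
    qed
  qed (use C in simp)
qed

text \<open>A lower bound for the infimal convolution of \<open>f\<close> with the profile at the point \<open>z = x + s y\<close>, to first
order in \<open>s\<close>. Young's inequality bounds \<open>Df(z) \<bullet> y\<close> by what the error term leaves of \<open>|y|\<^sup>q / q\<close> plus a
multiple of \<open>|Df(z)|\<^sup>p / p\<close>, so the bound no longer involves \<open>y\<close>. As \<open>e\<close> tends to \<open>0\<close> the rate
becomes \<open>1 - |Df|\<^sup>p / p\<close>, the negative of the Legendre transform of the profile, as in the Hopf--Lax formula.\<close>
lemma inf_convolution_lower_bound:
  fixes f :: "'a::euclidean_space \<Rightarrow> real"
  assumes pq: "1 < p" "1 < q" "1 / p + 1 / q = 1" and pl: "profile_like q f Df"
    and e: "0 < e" "e * q < 1"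
  obtains s0 where "0 < s0" "\<And>s x y. 0 < s \<Longrightarrow> s < s0 \<Longrightarrow>
     f (x + s *\<^sub>R y) + s * (1 - e - (1 - e * q) powr (- p / q) * (norm (Df (x + s *\<^sub>R y)) powr p / p))
       \<le> f x + s * profile q y"
proof -
  obtain s0 where s0: "0 < s0" and lb: "\<And>s y z. 0 < s \<Longrightarrow> s < s0 \<Longrightarrow>
     f z - s * (Df z \<bullet> y) - s * e * (1 + norm y powr q) \<le> f (z - s *\<^sub>R y)"
    using profile_like_lower_bound[OF pq(2) pl e(1)] by metis
  show ?thesis
  proof (rule that[OF s0])
    fix s :: real and x y :: 'a assume s: "0 < s" "s < s0"
    define z where "z = x + s *\<^sub>R y"
    define Y where "Y = norm y powr q"
    have xz: "x = z - s *\<^sub>R y" by (simp add: z_def)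
    have "Df z \<bullet> y \<le> norm (Df z) * norm y" by (rule norm_cauchy_schwarz)
    also have "\<dots> \<le> (1 - e * q) powr (- p / q) * (norm (Df z) powr p / p) + (1 - e * q) * (Y / q)"
      unfolding Y_def using e by (intro Youngs_inequality_weighted pq) auto
    also have "(1 - e * q) * (Y / q) = Y / q - e * Y" using pq by (simp add: field_simps)
    finally have "s * (Df z \<bullet> y) \<le> s * ((1 - e * q) powr (- p / q) * (norm (Df z) powr p / p) + (Y / q - e * Y))"
      using s by (intro mult_left_mono) auto
    moreover have "f z - s * (Df z \<bullet> y) - s * e * (1 + Y) \<le> f x"
      unfolding xz Y_def by (rule lb[OF s])
    ultimately have "f z + s * (1 - e - (1 - e * q) powr (- p / q) * (norm (Df z) powr p / p)) \<le> f x + s * (1 + Y / q)"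
      by (simp add: algebra_simps)
    then show "f (x + s *\<^sub>R y) + s * (1 - e - (1 - e * q) powr (- p / q) * (norm (Df (x + s *\<^sub>R y)) powr p / p))
       \<le> f x + s * profile q y"
      unfolding z_def profile_def Y_def by simp
  qed
qed

section \<open>Integrals of powers of the profile\<close>

lemma nn_integral_one_plus_abs_powr_finite:
  assumes a: "1 < a"
  shows "(\<integral>\<^sup>+t. ennreal ((1 + \<bar>t\<bar>) powr - a) \<partial>(lborel :: real measure)) < \<infinity>"
proof -
  define g where "g t = ennreal ((1 + t) powr - a) * indicator {0..} t" for t :: real
  have [measurable]: "g \<in> borel_measurable borel" unfolding g_def by measurable
  have "(\<integral>\<^sup>+t. g t \<partial>lborel) = ennreal (0 - (1 + 0) powr (1 - a) / (1 - a))"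
    unfolding g_def
  proof (rule nn_integral_FTC_atLeast[where F = "\<lambda>t. (1 + t) powr (1 - a) / (1 - a)"])
    show "DERIV (\<lambda>t. (1 + t) powr (1 - a) / (1 - a)) x :> (1 + x) powr - a" if "0 \<le> x" for x :: real
      using that a by (auto intro!: derivative_eq_intros)
    have "filterlim (\<lambda>t::real. 1 + t) at_top at_top"
      by (rule filterlim_tendsto_add_at_top[OF tendsto_const filterlim_ident])
    then have "((\<lambda>t::real. (1 + t) powr (1 - a) / (1 - a)) \<longlongrightarrow> 0 / (1 - a)) at_top"
      using a by (intro tendsto_divide tendsto_neg_powr tendsto_const) auto
    then show "((\<lambda>t::real. (1 + t) powr (1 - a) / (1 - a)) \<longlongrightarrow> 0) at_top" by simp
  qed auto
  then have fin: "(\<integral>\<^sup>+t. g t \<partial>lborel) < \<infinity>" by simp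
  have refl: "(\<integral>\<^sup>+t. g (0 + (-1) * t) \<partial>lborel) = (\<integral>\<^sup>+t. g t \<partial>lborel)"
    using nn_integral_real_affine[of g "-1" 0] by simp
  have "(\<integral>\<^sup>+t. ennreal ((1 + \<bar>t\<bar>) powr - a) \<partial>lborel) \<le> (\<integral>\<^sup>+t. g t + g (0 + (-1) * t) \<partial>lborel)"
  proof (rule nn_integral_mono)
    fix t :: real
    show "ennreal ((1 + \<bar>t\<bar>) powr - a) \<le> g t + g (0 + (-1) * t)"
      by (cases "0 \<le> t") (auto simp: g_def intro: add_increasing add_increasing2)
  qed
  also have "\<dots> = (\<integral>\<^sup>+t. g t \<partial>lborel) + (\<integral>\<^sup>+t. g (0 + (-1) * t) \<partial>lborel)"
    by (rule nn_integral_add) auto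
  also have "\<dots> < \<infinity>" unfolding refl using fin by simp
  finally show ?thesis .
qed

text \<open>Distributing the decay evenly over the coordinates replaces a radial power by a product, whose
integral factorises.\<close>
lemma inverse_profile_power_le_prod:
  fixes z :: "real ^ 'n::finite"
  assumes q: "1 < q" and S: "S \<noteq> {}" "finite S"
  shows "1 / profile q z ^ m \<le> (2 powr q * q) ^ m * (\<Prod>j\<in>S. (1 + \<bar>z $ j\<bar>) powr - (q * real m / real (card S)))"
proof -
  define C where "C = 2 powr q * q"
  define P where "P = profile q z"
  define k where "k = card S"
  have k: "0 < k" using S by (simp add: k_def card_gt_0_iff)
  have C: "0 < C" using q by (simp add: C_def)
  have P: "1 \<le> P" using q by (simp add: P_def profile_ge_1)
  have le: "(C * P) powr - (real m / real k) \<le> (1 + \<bar>z $ j\<bar>) powr - (q * real m / real k)" for j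
  proof -
    define t where "t = \<bar>z $ j\<bar>"
    have t: "0 \<le> t" "t \<le> norm z" by (auto simp: t_def component_le_norm_cart)
    have "(1 + t) powr q \<le> (2 * max 1 t) powr q" using t q by (intro powr_mono2) auto
    also have "\<dots> = 2 powr q * max 1 t powr q" by (rule powr_mult)
    also have "max 1 t powr q \<le> q + t powr q"
      using q by (auto simp: max_def intro: add_increasing2)
    also have "\<dots> \<le> q + norm z powr q" using t q by (intro add_left_mono powr_mono2) auto
    also have "2 powr q * (q + norm z powr q) = C * P"
      using q by (simp add: C_def P_def profile_def field_simps)
    finally have "(1 + t) powr q \<le> C * P" by simp
    then have "(C * P) powr - (real m / real k) \<le> ((1 + t) powr q) powr - (real m / real k)"
      using t by (intro powr_mono2') auto
    then show ?thesis by (simp add: powr_powr t_def)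
  qed
  have "1 / (C * P) ^ m = (C * P) powr - real m"
    using C P by (simp add: powr_minus powr_realpow divide_inverse)
  also have "\<dots> = ((C * P) powr - (real m / real k)) ^ k"
    using k C P by (simp add: powr_realpow[symmetric] powr_powr)
  also have "\<dots> = (\<Prod>j\<in>S. (C * P) powr - (real m / real k))" by (simp add: k_def)
  also have "\<dots> \<le> (\<Prod>j\<in>S. (1 + \<bar>z $ j\<bar>) powr - (q * real m / real k))"
    using le by (intro prod_mono) auto
  finally have "C ^ m * (1 / (C * P) ^ m) \<le> C ^ m * (\<Prod>j\<in>S. (1 + \<bar>z $ j\<bar>) powr - (q * real m / real k))"
    using C by (intro mult_left_mono) auto
  moreover have "C ^ m * (1 / (C * P) ^ m) = 1 / P ^ m" using C by (simp add: power_mult_distrib)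
  ultimately show ?thesis unfolding C_def P_def k_def by argo
qed

text \<open>The bound is uniform in the coordinates that are not integrated; it serves both for integrals over the
whole space and for integrals over hyperplanes.\<close>
lemma partial_integral_profile_bounded:
  fixes S :: "'n::finite set"
  assumes q: "1 < q" and S: "S \<noteq> {}" and m: "real (card S) < q * real m"
  shows "\<exists>K<\<infinity>. \<forall>x. partial_integral S (\<lambda>z. ennreal (1 / profile q z ^ m)) x \<le> K"
proof -
  define a where "a = q * real m / real (card S)"
  define C where "C = (2 powr q * q) ^ m"
  have cS: "0 < card S" using S by (simp add: card_gt_0_iff)
  have a: "1 < a" using m cS by (simp add: a_def)
  define I where "I = (\<integral>\<^sup>+t. ennreal ((1 + \<bar>t\<bar>) powr - a) \<partial>(lborel :: real measure))"
  have I: "I < \<infinity>" unfolding I_def by (rule nn_integral_one_plus_abs_powr_finite[OF a])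
  have C: "0 \<le> C" using q by (simp add: C_def)
  show ?thesis
  proof (intro exI[of _ "ennreal C * (\<Prod>j\<in>S. I)"] conjI allI)
    show "ennreal C * (\<Prod>j\<in>S. I) < \<infinity>"
      using I by (simp add: ennreal_mult_less_top power_less_top_ennreal)
    fix x
    have m: "(\<lambda>y. \<Prod>j\<in>S. ennreal ((1 + \<bar>y j\<bar>) powr - a)) \<in> borel_measurable (\<Pi>\<^sub>M i\<in>S. (lborel :: real measure))"
    proof (rule borel_measurable_prod_ennreal)
      fix j assume j: "j \<in> S"
      have "(\<lambda>y. y j) \<in> measurable (\<Pi>\<^sub>M i\<in>S. (lborel :: real measure)) borel"
        using measurable_component_singleton[OF j, of "\<lambda>_. lborel :: real measure"] by simp
      then show "(\<lambda>y. ennreal ((1 + \<bar>y j\<bar>) powr - a)) \<in> borel_measurable (\<Pi>\<^sub>M i\<in>S. (lborel :: real measure))"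
        by measurable
    qed
    have "partial_integral S (\<lambda>z. ennreal (1 / profile q z ^ m)) x
       \<le> (\<integral>\<^sup>+y. ennreal C * (\<Prod>j\<in>S. ennreal ((1 + \<bar>y j\<bar>) powr - a)) \<partial>(\<Pi>\<^sub>M i\<in>S. lborel))"
      unfolding partial_integral_def
    proof (rule nn_integral_mono)
      fix y
      define z where "z = (\<chi> i. if i \<in> S then y i else x $ i)"
      have "1 / profile q z ^ m \<le> C * (\<Prod>j\<in>S. (1 + \<bar>z $ j\<bar>) powr - a)"
        using inverse_profile_power_le_prod[OF q S finite, of z m] by (simp add: C_def a_def)
      also have "(\<Prod>j\<in>S. (1 + \<bar>z $ j\<bar>) powr - a) = (\<Prod>j\<in>S. (1 + \<bar>y j\<bar>) powr - a)"
        by (intro prod.cong) (auto simp: z_def)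
      finally have "ennreal (1 / profile q z ^ m) \<le> ennreal (C * (\<Prod>j\<in>S. (1 + \<bar>y j\<bar>) powr - a))"
        by (rule ennreal_leI)
      also have "\<dots> = ennreal C * (\<Prod>j\<in>S. ennreal ((1 + \<bar>y j\<bar>) powr - a))"
        using C by (subst prod_ennreal) (auto intro!: ennreal_mult prod_nonneg)
      finally show "ennreal (1 / profile q z ^ m) \<le> ennreal C * (\<Prod>j\<in>S. ennreal ((1 + \<bar>y j\<bar>) powr - a))" .
    qed
    also have "\<dots> = ennreal C * (\<integral>\<^sup>+y. (\<Prod>j\<in>S. ennreal ((1 + \<bar>y j\<bar>) powr - a)) \<partial>(\<Pi>\<^sub>M i\<in>S. lborel))"
      by (rule nn_integral_cmult[OF m])
    also have "(\<integral>\<^sup>+y. (\<Prod>j\<in>S. ennreal ((1 + \<bar>y j\<bar>) powr - a)) \<partial>(\<Pi>\<^sub>M i\<in>S. lborel)) = (\<Prod>j\<in>S. I)"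
      unfolding I_def by (rule lborel_product.product_nn_integral_prod) auto
    finally show "partial_integral S (\<lambda>z. ennreal (1 / profile q z ^ m)) x \<le> ennreal C * (\<Prod>j\<in>S. I)" .
  qed
qed

lemma borel_measurable_profile [measurable]: "1 < q \<Longrightarrow> (profile q :: 'a::euclidean_space \<Rightarrow> real) \<in> borel_measurable borel"
  by (intro borel_measurable_continuous_onI continuous_on_profile)

lemma integrable_inverse_profile_power:
  assumes q: "1 < q" and m: "real CARD('n::finite) < q * real m"
  shows "integrable lborel (\<lambda>z::real^'n. 1 / profile q z ^ m)"
proof (rule integrableI_bounded)
  show "(\<lambda>z::real^'n. 1 / profile q z ^ m) \<in> borel_measurable lborel"
    using q by measurable
  obtain K where K: "K < \<infinity>" "partial_integral UNIV (\<lambda>z::real^'n. ennreal (1 / profile q z ^ m)) 0 \<le> K"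
    using partial_integral_profile_bounded[OF q, of "UNIV :: 'n set" m] m by auto
  have "(\<integral>\<^sup>+z. ennreal (norm (1 / profile q z ^ m)) \<partial>(lborel :: (real^'n) measure)) = (\<integral>\<^sup>+z. ennreal (1 / profile q z ^ m) \<partial>(lborel :: (real^'n) measure))"
    using q by simp
  also have "\<dots> = partial_integral UNIV (\<lambda>z::real^'n. ennreal (1 / profile q z ^ m)) 0"
    using q by (intro nn_integral_lborel_eq_partial_integral) measurable
  finally show "(\<integral>\<^sup>+z. ennreal (norm (1 / profile q z ^ m)) \<partial>(lborel :: (real^'n) measure)) < \<infinity>"
    using K by simp
qed

lemma integral_lborel_scaleR:
  fixes f :: "'a::euclidean_space \<Rightarrow> real"
  assumes [measurable]: "f \<in> borel_measurable borel" and c: "0 < c"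
  shows "(\<integral>x. f (c *\<^sub>R x) \<partial>lborel) = (\<integral>x. f x \<partial>lborel) / c ^ DIM('a)"
proof -
  have "(\<integral>x. f x \<partial>lborel) = (\<integral>x. f x \<partial>density (distr lborel borel (\<lambda>x. 0 + c *\<^sub>R x)) (\<lambda>_. ennreal (\<bar>c\<bar> ^ DIM('a))))"
    by (subst lborel_affine[of c 0]) (use c in \<open>simp_all add: ennreal_power\<close>)
  also have "\<dots> = c ^ DIM('a) * (\<integral>x. f (c *\<^sub>R x) \<partial>lborel)"
    using c by (subst integral_density) (auto simp: integral_distr)
  finally show ?thesis using c by simp
qed

lemma inverse_power_tangent:
  fixes x y :: real
  assumes "0 < x" "0 < y"
  shows "1 / y ^ d - real d * (x - y) / y ^ Suc d \<le> 1 / x ^ d"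
proof -
  define t where "t = y / x"
  have t: "0 < t" using assms by (simp add: t_def)
  have "1 + real d * (t - 1) \<le> t ^ d"
    using Bernoulli_inequality[of "t - 1" d] t by simp
  moreover have "(x - y) / y = - (1 - 1 / t)" using assms by (simp add: t_def field_simps)
  then have "real d * ((x - y) / y) = - (real d * (1 - 1 / t))" by (simp only: mult_minus_right)
  moreover have "1 - 1 / t \<le> t - 1"
  proof -
    have "0 \<le> (t - 1)\<^sup>2 / t" using t by simp
    then show ?thesis using t by (simp add: field_simps power2_eq_square)
  qed
  then have "real d * (1 - 1 / t) \<le> real d * (t - 1)" by (intro mult_left_mono) auto
  moreover have "real d * (t - 1) = - real d + real d * t" by (simp add: algebra_simps)
  ultimately have "1 - real d * ((x - y) / y) \<le> t ^ d" by linarith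
  then have "(1 - real d * ((x - y) / y)) / y ^ d \<le> t ^ d / y ^ d"
    using assms by (intro divide_right_mono) auto
  moreover have "t ^ d / y ^ d = 1 / x ^ d" using assms by (simp add: t_def power_divide)
  moreover have "(1 - real d * ((x - y) / y)) / y ^ d = 1 / y ^ d - real d * (x - y) / y ^ Suc d"
    using assms by (simp add: field_simps)
  ultimately show ?thesis by simp
qed

lemma inverse_power_quadratic_bound:
  "\<exists>C\<ge>0. \<forall>t::real. \<bar>t\<bar> \<le> 1 / 2 \<longrightarrow> 1 / (1 + t) ^ d \<le> 1 - real d * t + C * t\<^sup>2"
proof (induction d)
  case (Suc d)
  then obtain C where C: "C \<ge> 0" "\<And>t::real. \<bar>t\<bar> \<le> 1 / 2 \<Longrightarrow> 1 / (1 + t) ^ d \<le> 1 - real d * t + C * t\<^sup>2" by auto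
  show ?case
  proof (intro exI[of _ "2 + 2 * real d + 2 * C"] conjI allI impI)
    fix t :: real assume t: "\<bar>t\<bar> \<le> 1 / 2"
    have t2: "0 \<le> t\<^sup>2" by simp
    have e1: "1 / (1 + t) \<le> 1 - t + 2 * t\<^sup>2"
    proof -
      have "0 \<le> t\<^sup>2 * (1 + 2 * t)" using t by (intro mult_nonneg_nonneg) (auto simp: abs_le_iff)
      then have "1 \<le> (1 - t + 2 * t\<^sup>2) * (1 + t)" by (simp add: algebra_simps power2_eq_square)
      then show ?thesis using t by (simp add: pos_divide_le_eq abs_le_iff)
    qed
    have "0 < 1 / (1 + t) ^ d" using t by (auto simp: abs_le_iff)
    then have pos: "0 \<le> 1 - real d * t + C * t\<^sup>2" using C(2)[OF t] by linarith
    have "1 / (1 + t) ^ Suc d = 1 / (1 + t) ^ d * (1 / (1 + t))" by simp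
    also have "\<dots> \<le> (1 - real d * t + C * t\<^sup>2) * (1 - t + 2 * t\<^sup>2)"
      using C(2)[OF t] e1 t pos by (intro mult_mono) (auto simp: abs_le_iff)
    also have "\<dots> = 1 - real (Suc d) * t + t\<^sup>2 * (2 + real d + C + (- (2 * real d + C)) * t + 2 * C * t\<^sup>2)"
      by (simp add: algebra_simps power2_eq_square)
    also have "\<dots> \<le> 1 - real (Suc d) * t + t\<^sup>2 * (2 + real d + C + (2 * real d + C) * (1 / 2) + 2 * C * (1 / 4))"
    proof -
      have "(2 * real d + C) * (- t) \<le> (2 * real d + C) * (1 / 2)"
        using t C by (intro mult_left_mono) (auto simp: abs_le_iff)
      moreover have "t\<^sup>2 \<le> 1 / 4" using t abs_le_square_iff[of t "1/2"] by (simp add: power2_eq_square)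
      then have "2 * C * t\<^sup>2 \<le> 2 * C * (1 / 4)" using C by (intro mult_left_mono) auto
      moreover have "(- (2 * real d + C)) * t = (2 * real d + C) * (- t)" by (simp add: algebra_simps)
      ultimately have "2 + real d + C + (- (2 * real d + C)) * t + 2 * C * t\<^sup>2
          \<le> 2 + real d + C + (2 * real d + C) * (1 / 2) + 2 * C * (1 / 4)" by linarith
      then show ?thesis by (intro add_left_mono mult_left_mono) auto
    qed
    also have "\<dots> = 1 - real (Suc d) * t + (2 + 2 * real d + 2 * C) * t\<^sup>2" by (simp add: algebra_simps)
    finally show "1 / (1 + t) ^ Suc d \<le> 1 - real (Suc d) * t + (2 + 2 * real d + 2 * C) * t\<^sup>2" .
  qed (use C in auto)
qed (auto intro: exI[of _ 0])

section \<open>A sharp inequality for functions that look like the profile\<close>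

text \<open>Shorter combinations are padded below with the product \<open>0 * 0\<close> to fit this pattern.\<close>
lemma integral_lincomb:
  fixes u v w :: "'a \<Rightarrow> real"
  assumes "integrable M u" "integrable M v" "integrable M w"
  shows "(\<integral>x. a * u x - b * v x + c * w x \<partial>M) = a * (\<integral>x. u x \<partial>M) - b * (\<integral>x. v x \<partial>M) + c * (\<integral>x. w x \<partial>M)"
    "integrable M (\<lambda>x. a * u x - b * v x + c * w x)"
  using assms by simp_all

text \<open>The argument \<open>T\<close> only records the dimension, on which constants such as the mass of the profile depend.\<close>
locale sharp_exponents =
  fixes p q :: real and d :: nat and T :: "'n::finite itself"
  assumes p_gt_1: "1 < p" and p_less_card: "p < real CARD('n)" and conjugate: "1 / p + 1 / q = 1" and d: "CARD('n) = Suc d"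
begin

lemma q_gt_1: "1 < q"
proof -
  have "1 / p < 1" "0 < 1 / p" using p_gt_1 by simp_all
  then have "0 < 1 / q" "1 / q < 1" using conjugate by linarith+
  then show ?thesis by (simp add: field_simps zero_less_divide_iff)
qed

lemma q_pos: "0 < q" using q_gt_1 by simp

lemma d_pos: "0 < d"
  using p_gt_1 p_less_card d by (cases d) auto

lemma q_eq: "q = p / (p - 1)"
  using conjugate p_gt_1 q_pos by (simp add: field_simps)

lemma qd: "real CARD('n) < q * real d"
proof -
  have "p < 1 + real d" using p_less_card d by simp
  then have "(1 + real d) * (p - 1) < p * real d" using p_gt_1 by (simp add: algebra_simps)
  then show ?thesis using p_gt_1 d unfolding q_eq by (simp add: field_simps)
qed

abbreviation g :: "real ^ 'n \<Rightarrow> real" where "g \<equiv> profile q"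

lemma g_pos [simp]: "0 < g x" and g_nonneg [simp]: "0 \<le> g x" and g_ge_1: "1 \<le> g x"
  using q_pos by (auto simp: profile_ge_1)

lemma g_measurable [measurable]: "g \<in> borel_measurable borel"
  by (rule borel_measurable_profile[OF q_gt_1])

lemma integrable_g: "d \<le> m \<Longrightarrow> integrable lborel (\<lambda>x. 1 / g x ^ m)"
  using qd q_pos by (intro integrable_inverse_profile_power[OF q_gt_1])
     (meson less_le_trans mult_left_mono of_nat_mono less_imp_le)

context
  fixes f :: "real ^ 'n \<Rightarrow> real" and Df
  assumes pl: "profile_like q f Df"
begin

lemma f_pos: "0 < f x" using pl by (simp add: profile_like_def)

lemma f_continuous: "continuous_on UNIV f"
  using pl by (intro GDERIV_imp_continuous_on[of f Df]) (simp add: profile_like_def)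

lemma f_measurable: "f \<in> borel_measurable borel"
  by (intro borel_measurable_continuous_onI f_continuous)

lemma Df_measurable: "Df \<in> borel_measurable borel"
  using pl by (intro borel_measurable_continuous_onI) (simp add: profile_like_def)

lemma integrable_f:
  assumes "d \<le> m" shows "integrable lborel (\<lambda>x. 1 / f x ^ m)"
proof -
  note f_measurable[measurable]
  obtain C where C: "0 < C" "\<And>x. g x \<le> C * f x"
    using profile_like_comparable[OF p_gt_1 q_gt_1 conjugate pl] by metis
  have le: "1 / f x ^ m \<le> C ^ m * (1 / g x ^ m)" for x
  proof -
    have "g x ^ m \<le> (C * f x) ^ m" using C by (intro power_mono) (auto simp: less_imp_le)
    then show ?thesis using f_pos[of x] by (simp add: field_simps power_mult_distrib)
  qed
  show ?thesis
  proof (rule Bochner_Integration.integrable_bound)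
    show "integrable lborel (\<lambda>x. C ^ m * (1 / g x ^ m))"
      by (intro integrable_mult_right integrable_g assms)
    show "AE x in lborel. norm (1 / f x ^ m) \<le> norm (C ^ m * (1 / g x ^ m))"
    proof (rule AE_I2)
      fix x
      have "norm (1 / f x ^ m) = 1 / f x ^ m" using f_pos[of x] by simp
      also note le
      also have "C ^ m * (1 / g x ^ m) \<le> norm (C ^ m * (1 / g x ^ m))" unfolding real_norm_def by (rule abs_ge_self)
      finally show "norm (1 / f x ^ m) \<le> norm (C ^ m * (1 / g x ^ m))" .
    qed
  qed measurable
qed

lemma integrable_Df: "integrable lborel (\<lambda>x. norm (Df x) powr p / f x ^ Suc d)"
proof -
  note f_measurable[measurable] Df_measurable[measurable]
  obtain C where C: "0 < C" "\<And>x. norm (Df x) powr p \<le> C * f x"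
    using profile_like_comparable[OF p_gt_1 q_gt_1 conjugate pl] by metis
  have le: "norm (Df x) powr p / f x ^ Suc d \<le> C * (1 / f x ^ d)" for x
    using C(2)[of x] f_pos[of x] by (simp add: field_simps)
  show ?thesis
  proof (rule Bochner_Integration.integrable_bound)
    show "integrable lborel (\<lambda>x. C * (1 / f x ^ d))"
      by (intro integrable_mult_right integrable_f order_refl)
    show "AE x in lborel. norm (norm (Df x) powr p / f x ^ Suc d) \<le> norm (C * (1 / f x ^ d))"
    proof (rule AE_I2)
      fix x
      have "norm (norm (Df x) powr p / f x ^ Suc d) = norm (Df x) powr p / f x ^ Suc d" using f_pos[of x] by simp
      also note le
      also have "C * (1 / f x ^ d) \<le> norm (C * (1 / f x ^ d))" unfolding real_norm_def by (rule abs_ge_self)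
      finally show "norm (norm (Df x) powr p / f x ^ Suc d) \<le> norm (C * (1 / f x ^ d))" .
    qed
  qed measurable
qed

text \<open>With \<open>k\<close> the rate from \<open>inf_convolution_lower_bound\<close>, the function \<open>f + s k\<close> may play the part of \<open>h\<close> in the
Brunn--Minkowski inequality for all small \<open>s\<close>. Since \<open>|k|\<close> is at most a multiple of \<open>f\<close>, its power \<open>-d\<close> has a
second-order expansion in \<open>s\<close> with a uniform remainder; the terms of order \<open>0\<close> cancel, and those of
order \<open>1\<close> give the claim.\<close>
lemma small_perturbation_inequality:
  fixes i :: 'n
  assumes sup: "(SUP t. section_integral i (\<lambda>x. ennreal (1 / f x ^ d)) t) = (SUP t. section_integral i (\<lambda>x. ennreal (1 / g x ^ d)) t)"
    and e: "0 < e" "e * q < 1"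
  shows "(\<integral>x. 1 / g x ^ d \<partial>lborel) \<le> real d *
     ((1 - e * q) powr (- p / q) / p * (\<integral>x. norm (Df x) powr p / f x ^ Suc d \<partial>lborel) - (1 - e) * (\<integral>x. 1 / f x ^ Suc d \<partial>lborel))"
proof -
  note [measurable] = f_measurable Df_measurable
  define c where "c = (1 - e * q) powr (- p / q) / p"
  define k where "k z = 1 - e - c * norm (Df z) powr p" for z
  have [measurable]: "k \<in> borel_measurable borel" unfolding k_def by measurable
  have c: "0 \<le> c" using p_gt_1 by (simp add: c_def)
  have e1: "e < 1" using e q_gt_1 by (smt (verit) mult_less_cancel_left2)
  obtain s0 where s0: "0 < s0" "\<And>s x y. 0 < s \<Longrightarrow> s < s0 \<Longrightarrow> f (x + s *\<^sub>R y) + s * k (x + s *\<^sub>R y) \<le> f x + s * g y"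
    using inf_convolution_lower_bound[OF p_gt_1 q_gt_1 conjugate pl e] unfolding k_def c_def by (auto simp: mult.commute)
  obtain C where C: "0 < C" "\<And>x. g x \<le> C * f x" "\<And>x. norm (Df x) powr p \<le> C * f x"
    using profile_like_comparable[OF p_gt_1 q_gt_1 conjugate pl] by metis
  define B where "B = C + c * C"
  have B: "0 < B" using C c by (simp add: B_def add_pos_nonneg)
  have kB: "\<bar>k x\<bar> \<le> B * f x" for x
  proof -
    have "1 \<le> C * f x" using C(2)[of x] g_ge_1[of x] by linarith
    moreover have "0 \<le> c * norm (Df x) powr p" using c by simp
    moreover have "c * norm (Df x) powr p \<le> c * (C * f x)" using c C(3)[of x] by (intro mult_left_mono) auto
    moreover have "B * f x = C * f x + c * (C * f x)" by (simp add: B_def algebra_simps)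
    moreover have "0 \<le> c * (C * f x)" using c C f_pos[of x] by simp
    ultimately show ?thesis using e e1 unfolding k_def by linarith
  qed
  obtain K where K: "K \<ge> 0" "\<And>t::real. \<bar>t\<bar> \<le> 1 / 2 \<Longrightarrow> 1 / (1 + t) ^ d \<le> 1 - real d * t + K * t\<^sup>2"
    using inverse_power_quadratic_bound by blast
  define s1 where "s1 = min s0 (1 / (2 * B))"
  have s1: "0 < s1" using s0 B by (simp add: s1_def)
  have keq: "k x / f x ^ Suc d = (1 - e) * (1 / f x ^ Suc d) - c * (norm (Df x) powr p / f x ^ Suc d) + 0 * 0" for x
    by (simp add: k_def diff_divide_distrib)
  have sd: "d \<le> Suc d" by simp
  have intk: "integrable lborel (\<lambda>x. k x / f x ^ Suc d)"
    unfolding keq by (rule integral_lincomb(2)[OF integrable_f[OF sd] integrable_Df integrable_zero])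
  have ik: "(\<integral>x. k x / f x ^ Suc d \<partial>lborel) = (1 - e) * (\<integral>x. 1 / f x ^ Suc d \<partial>lborel) - c * (\<integral>x. norm (Df x) powr p / f x ^ Suc d \<partial>lborel)"
    unfolding keq integral_lincomb(1)[OF integrable_f[OF sd] integrable_Df integrable_zero] by simp
  define If where "If = (\<integral>x. 1 / f x ^ d \<partial>lborel)"
  define A where "A = (\<integral>x. 1 / g x ^ d \<partial>lborel)"
  define Ik where "Ik = (\<integral>x. k x / f x ^ Suc d \<partial>lborel)"
  have main: "A \<le> - real d * Ik + s * (K * B\<^sup>2 * If)" if s: "0 < s" "s < s1" for s
  proof -
    have t: "\<bar>s * k x / f x\<bar> \<le> s * B" "s * B \<le> 1 / 2" for x
    proof -
      have "\<bar>k x\<bar> / f x \<le> B" using kB[of x] f_pos[of x] by (simp add: pos_divide_le_eq)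
      then have "s * (\<bar>k x\<bar> / f x) \<le> s * B" using s by (intro mult_left_mono) auto
      then show "\<bar>s * k x / f x\<bar> \<le> s * B" using s f_pos[of x] by (simp add: abs_mult abs_divide)
      have "s * B \<le> 1 / (2 * B) * B" using s B unfolding s1_def by (intro mult_right_mono) auto
      then show "s * B \<le> 1 / 2" using B by simp
    qed
    \<comment> \<open>The integrable function \<open>h\<close> below is the quadratic expansion of the power \<open>-d\<close> of \<open>w\<close>.\<close>
    define w where "w x = f x + s * k x" for x
    have weq: "w x = f x * (1 + s * k x / f x)" for x using f_pos[of x] by (simp add: w_def field_simps)
    have wp: "0 < w x" for x
    proof -
      have "0 < 1 + s * k x / f x" using t(1)[of x] t(2) by linarith
      then show ?thesis unfolding weq using f_pos[of x] by simp
    qed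
    have [measurable]: "w \<in> borel_measurable borel" unfolding w_def by measurable
    define h where "h x = 1 * (1 / f x ^ d) - real d * s * (k x / f x ^ Suc d) + K * (s * B)\<^sup>2 * (1 / f x ^ d)" for x
    have wh: "1 / w x ^ d \<le> h x" for x
    proof -
      have "(s * k x / f x)\<^sup>2 \<le> (s * B)\<^sup>2"
        using t(1)[of x] t(2) by (metis abs_ge_zero power2_abs power_mono)
      then have "K * (s * k x / f x)\<^sup>2 \<le> K * (s * B)\<^sup>2" using K by (intro mult_left_mono) auto
      moreover have "1 / (1 + s * k x / f x) ^ d \<le> 1 - real d * (s * k x / f x) + K * (s * k x / f x)\<^sup>2"
        using t(1)[of x] t(2) by (intro K(2)) linarith
      ultimately have "1 / (1 + s * k x / f x) ^ d \<le> 1 - real d * (s * k x / f x) + K * (s * B)\<^sup>2" by linarith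
      then have "1 / f x ^ d * (1 / (1 + s * k x / f x) ^ d) \<le> 1 / f x ^ d * (1 - real d * (s * k x / f x) + K * (s * B)\<^sup>2)"
        using f_pos[of x] by (intro mult_left_mono) auto
      also have "1 / f x ^ d * (1 - real d * (s * k x / f x) + K * (s * B)\<^sup>2) = h x"
        using f_pos[of x] unfolding h_def by (simp add: field_simps)
      also have "1 / f x ^ d * (1 / (1 + s * k x / f x) ^ d) = 1 / w x ^ d"
        unfolding weq power_mult_distrib by simp
      finally show ?thesis .
    qed
    have inth: "integrable lborel h" unfolding h_def
      by (rule integral_lincomb(2)[OF integrable_f[OF order_refl] intk integrable_f[OF order_refl]])
    have Ih: "(\<integral>x. h x \<partial>lborel) = If - real d * s * Ik + K * (s * B)\<^sup>2 * If"
      unfolding h_def If_def Ik_def integral_lincomb(1)[OF integrable_f[OF order_refl] intk integrable_f[OF order_refl]]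
      by simp
    have hp: "0 \<le> h x" for x using wh[of x] wp[of x] by (meson divide_nonneg_pos less_imp_le order.trans zero_le_one zero_less_power)
    have mono: "a \<ge> c" if "0 < a" "ennreal (1 / a ^ d) \<le> ennreal (1 / c ^ d)" for a c :: real
    proof (rule ccontr)
      assume "\<not> c \<le> a"
      then have "a ^ d < c ^ d" using that d_pos by (intro power_strict_mono) auto
      moreover have a: "0 < a ^ d" using that by simp
      ultimately have fa: "0 < c ^ d" by (rule order.strict_trans[rotated])
      then have "1 / c ^ d < 1 / a ^ d"
        using \<open>a ^ d < c ^ d\<close> a by (simp add: frac_less2)
      moreover have "0 \<le> 1 / c ^ d" using fa by simp
      ultimately show False using that by (simp add: ennreal_le_iff)
    qed
    have "pow_concave d s (\<lambda>x. ennreal (1 / f x ^ d)) (\<lambda>x. ennreal (1 / g x ^ d)) (\<lambda>x. ennreal (1 / w x ^ d))"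
      unfolding pow_concave_def
    proof (intro allI impI)
      fix x y :: "real ^ 'n" and a b :: real
      assume ab: "0 < a" "0 < b" "ennreal (1 / a ^ d) \<le> ennreal (1 / f x ^ d)" "ennreal (1 / b ^ d) \<le> ennreal (1 / g y ^ d)"
      have "w (x + s *\<^sub>R y) \<le> f x + s * g y" unfolding w_def using s s1_def by (intro s0(2)) auto
      also have "\<dots> \<le> a + s * b" using mono[OF ab(1) ab(3)] mono[OF ab(2) ab(4)] s by (intro add_mono mult_left_mono) auto
      finally have "w (x + s *\<^sub>R y) ^ d \<le> (a + s * b) ^ d" using wp by (intro power_mono) (auto simp: less_imp_le)
      then have "1 / (a + s * b) ^ d \<le> 1 / w (x + s *\<^sub>R y) ^ d"
        using wp[of "x + s *\<^sub>R y"] by (intro frac_le) auto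
      then show "ennreal (1 / (a + s * b) ^ d) \<le> ennreal (1 / w (x + s *\<^sub>R y) ^ d)" by (rule ennreal_leI)
    qed
    then have "(\<integral>\<^sup>+x. ennreal (1 / f x ^ d) \<partial>lborel) + ennreal s * (\<integral>\<^sup>+x. ennreal (1 / g x ^ d) \<partial>lborel) \<le> (\<integral>\<^sup>+x. ennreal (1 / w x ^ d) \<partial>lborel)"
      using s d d_pos sup by (intro brunn_minkowski_equal_sections[where i = i and d = d]) auto
    also have "\<dots> \<le> (\<integral>\<^sup>+x. ennreal (h x) \<partial>lborel)" using wh by (intro nn_integral_mono ennreal_leI)
    also have "\<dots> = ennreal (\<integral>x. h x \<partial>lborel)" using hp by (intro nn_integral_eq_integral inth) auto
    also have "(\<integral>\<^sup>+x. ennreal (1 / f x ^ d) \<partial>lborel) = ennreal If"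
      unfolding If_def using f_pos by (intro nn_integral_eq_integral integrable_f) (auto simp: less_imp_le)
    also have "(\<integral>\<^sup>+x. ennreal (1 / g x ^ d) \<partial>lborel) = ennreal A"
      unfolding A_def by (intro nn_integral_eq_integral integrable_g) auto
    finally have "ennreal If + ennreal s * ennreal A \<le> ennreal (\<integral>x. h x \<partial>lborel)" .
    moreover have "0 \<le> If" "0 \<le> A" "0 \<le> (\<integral>x. h x \<partial>lborel)"
      unfolding If_def A_def using f_pos hp by (auto intro!: Bochner_Integration.integral_nonneg simp: less_imp_le)
    ultimately have "If + s * A \<le> If - real d * s * Ik + K * (s * B)\<^sup>2 * If"
      using s unfolding Ih by (simp add: ennreal_mult[symmetric] ennreal_plus[symmetric] del: ennreal_plus)
    then have "s * A \<le> s * (- real d * Ik + s * (K * B\<^sup>2 * If))" by (simp add: algebra_simps power2_eq_square)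
    then show ?thesis using s by (simp only: mult_le_cancel_left_pos)
  qed
  have "A \<le> - real d * Ik"
  proof (rule tendsto_lowerbound)
    show "((\<lambda>s. - real d * Ik + s * (K * B\<^sup>2 * If)) \<longlongrightarrow> - real d * Ik) (at_right 0)"
      by (auto intro!: tendsto_eq_intros)
    show "\<forall>\<^sub>F s in at_right 0. A \<le> - real d * Ik + s * (K * B\<^sup>2 * If)"
      using eventually_at_right_less[of 0] s1 main by (auto simp: eventually_at_right intro!: exI[of _ s1])
  qed simp
  then show ?thesis unfolding Ik_def ik A_def c_def by (simp add: algebra_simps)
qed

lemma equal_sections_inequality:
  fixes i :: 'n
  assumes sup: "(SUP t. section_integral i (\<lambda>x. ennreal (1 / f x ^ d)) t) = (SUP t. section_integral i (\<lambda>x. ennreal (1 / g x ^ d)) t)"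
  shows "(\<integral>x. 1 / g x ^ d \<partial>lborel) \<le> real d *
     ((\<integral>x. norm (Df x) powr p / f x ^ Suc d \<partial>lborel) / p - (\<integral>x. 1 / f x ^ Suc d \<partial>lborel))"
proof (rule tendsto_lowerbound)
  define E where "E = (\<integral>x. norm (Df x) powr p / f x ^ Suc d \<partial>lborel)"
  define M where "M = (\<integral>x. 1 / f x ^ Suc d \<partial>lborel)"
  have "((\<lambda>e. real d * ((1 - e * q) powr (- p / q) / p * E - (1 - e) * M)) \<longlongrightarrow>
      real d * ((1 - 0 * q) powr (- p / q) / p * E - (1 - 0) * M)) (at_right 0)"
    using p_gt_1 by (intro tendsto_intros) auto
  then show "((\<lambda>e. real d * ((1 - e * q) powr (- p / q) / p * E - (1 - e) * M)) \<longlongrightarrow>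
      real d * (E / p - M)) (at_right 0)" by simp
  show "\<forall>\<^sub>F e in at_right 0. (\<integral>x. 1 / g x ^ d \<partial>lborel) \<le> real d * ((1 - e * q) powr (- p / q) / p * E - (1 - e) * M)"
    unfolding E_def M_def eventually_at_right_field
    using q_pos by (intro exI[of _ "1 / q"] conjI allI impI small_perturbation_inequality[OF sup]) (auto simp: field_simps)
qed simp

end

end

section \<open>The optimal scaling\<close>

lemma powr_tangent:
  fixes a b p :: real
  assumes p: "1 < p" and a: "0 \<le> a" and b: "0 \<le> b"
  shows "b powr p + p * b powr (p - 1) * (a - b) \<le> a powr p"
proof -
  define q where "q = p / (p - 1)"
  have q: "1 < q" "1 / p + 1 / q = 1" using p by (auto simp: q_def field_simps)
  have "a * b powr (p - 1) \<le> a powr p / p + (b powr (p - 1)) powr q / q"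
    using a b by (intro Youngs_inequality p q) auto
  also have "(b powr (p - 1)) powr q = b powr p" using p by (simp add: powr_powr q_def)
  also have "b powr p / q = b powr p - b powr p / p"
  proof -
    have "1 / q = 1 - 1 / p" using q by simp
    then have "b powr p * (1 / q) = b powr p * (1 - 1 / p)" by simp
    then show ?thesis by (simp add: right_diff_distrib)
  qed
  finally have "p * (a * b powr (p - 1)) \<le> p * (a powr p / p + (b powr p - b powr p / p))"
    using p by (intro mult_left_mono) auto
  also have "\<dots> = a powr p + p * b powr p - b powr p" using p by (simp add: field_simps)
  finally have 1: "p * (a * b powr (p - 1)) \<le> a powr p + p * b powr p - b powr p" .
  have "b powr (p - 1) * b = b powr p"
  proof (cases "b = 0")
    case False
    then have "b powr (p - 1) * b powr 1 = b powr p" by (subst powr_add[symmetric]) simp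
    then show ?thesis using b by simp
  qed simp
  then have "p * b powr (p - 1) * (a - b) = p * (a * b powr (p - 1)) - p * b powr p"
    by (simp add: algebra_simps)
  then show ?thesis using 1 by linarith
qed

text \<open>Convexity of the power at \<open>(1 - e) (a / (1 - e)) + e b\<close>. It takes the place of the triangle inequality
in \<open>L\<^sup>p\<close> when \<open>e b\<close> is a small perturbation of \<open>a\<close>.\<close>
lemma powr_add_le:
  fixes a b p e :: real
  assumes p: "1 < p" and ab: "0 \<le> a" "0 \<le> b" and e: "0 < e" "e < 1"
  shows "(a + e * b) powr p \<le> (1 - e) powr (1 - p) * a powr p + e * b powr p"
proof -
  define x where "x = a / (1 - e)"
  define t where "t = (1 - e) * x + e * b"
  have x: "0 \<le> x" using ab e by (simp add: x_def)
  have t: "0 \<le> t" "t = a + e * b" using x ab e by (auto simp: t_def x_def)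
  have "(1 - e) * (t powr p + p * t powr (p - 1) * (x - t)) \<le> (1 - e) * x powr p"
    using e x t by (intro mult_left_mono powr_tangent p) auto
  moreover have "e * (t powr p + p * t powr (p - 1) * (b - t)) \<le> e * b powr p"
    using e ab t by (intro mult_left_mono powr_tangent p) auto
  moreover have "(1 - e) * (t powr p + p * t powr (p - 1) * (x - t)) + e * (t powr p + p * t powr (p - 1) * (b - t))
     = t powr p + p * t powr (p - 1) * ((1 - e) * x + e * b - t)" by (simp add: algebra_simps)
  moreover have "(1 - e) * x + e * b - t = 0" by (simp add: t_def)
  ultimately have "t powr p \<le> (1 - e) * x powr p + e * b powr p" by simp
  moreover have "(1 - e) * x powr p = (1 - e) powr (1 - p) * a powr p"
    using ab e by (simp add: x_def powr_divide powr_diff)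
  ultimately show ?thesis unfolding t(2) by simp
qed

lemma integrable_continuous_zero_outside_ball:
  fixes h :: "'a::euclidean_space \<Rightarrow> real"
  assumes "continuous_on UNIV h" "\<And>x. R < norm x \<Longrightarrow> h x = 0"
  shows "integrable lborel h"
proof -
  have "integrable lborel (\<lambda>x. indicator (cball 0 R) x *\<^sub>R h x)"
    by (intro borel_integrable_compact continuous_on_subset[OF assms(1)]) auto
  moreover have "(\<lambda>x. indicator (cball 0 R) x *\<^sub>R h x) = h"
  proof
    fix x show "indicator (cball 0 R) x *\<^sub>R h x = h x"
      using assms(2)[of x] by (cases "norm x \<le> R") (auto simp: indicator_def)
  qed
  ultimately show ?thesis by simp
qed

lemma integral_lborel_pos:
  fixes f :: "'a::euclidean_space \<Rightarrow> real"
  assumes int: "integrable lborel f" and pos: "\<And>x. 0 < f x"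
  shows "0 < (\<integral>x. f x \<partial>lborel)"
proof -
  have "(\<integral>x. f x \<partial>lborel) \<noteq> 0"
  proof
    assume "(\<integral>x. f x \<partial>lborel) = 0"
    then have "AE x in lborel. f x = 0"
      using pos by (subst (asm) integral_nonneg_eq_0_iff_AE[OF int]) (auto simp: less_imp_le)
    then have "AE x in (lborel :: 'a measure). False"
      by eventually_elim (use pos in \<open>simp add: less_imp_neq[symmetric]\<close>)
    then show False by (simp add: AE_iff_null emeasure_lborel_UNIV null_sets_def)
  qed
  moreover have "0 \<le> (\<integral>x. f x \<partial>lborel)"
    by (intro Bochner_Integration.integral_nonneg less_imp_le pos)
  ultimately show ?thesis by simp
qed

definition profile_mass :: "'n::finite itself \<Rightarrow> real \<Rightarrow> real" where
  "profile_mass _ q = (\<integral>x. 1 / profile q (x :: real ^ 'n) ^ CARD('n) \<partial>lborel)"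

context sharp_exponents
begin

definition N :: real where "N = real (Suc d)"

lemma N_card: "real CARD('n) = N" using d by (simp add: N_def)

lemma N_eq: "N = 1 + real d" by (simp add: N_def)

lemma p_less_N: "0 < N - p" using p_less_card by (simp add: N_card)

lemma N_pos: "0 < N" by (simp add: N_def)

abbreviation Mg :: real where "Mg \<equiv> profile_mass T q"

lemma exponent_identity: "N / q - real d = 1 - N / p"
proof -
  have "1 / q = 1 - 1 / p" using conjugate by simp
  then have "N * (1 / q) = N * (1 - 1 / p)" by simp
  then have "N / q = N - N / p" by (simp add: right_diff_distrib)
  then show ?thesis using N_eq by linarith
qed

text \<open>The substitution that stretches \<open>x\<close> by \<open>l powr (1 / q)\<close> turns \<open>l + |x|\<^sup>q / q\<close> into \<open>l\<close> times the profile.\<close>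
lemma integral_shifted_profile:
  assumes l: "0 < l"
  shows "(\<integral>x. 1 / (l + norm x powr q / q) ^ d \<partial>(lborel :: (real ^ 'n) measure)) = l powr (1 - N / p) * (\<integral>x. 1 / g x ^ d \<partial>lborel)"
proof -
  define F where "F x = 1 / (l + norm x powr q / q) ^ d" for x :: "real ^ 'n"
  define c where "c = l powr (1 / q)"
  have c: "0 < c" using l by (simp add: c_def)
  have [measurable]: "F \<in> borel_measurable borel" unfolding F_def by measurable
  have cq: "c powr q = l" using l q_pos by (simp add: c_def powr_powr)
  have "F (c *\<^sub>R x) = 1 / l ^ d * (1 / g x ^ d)" for x
  proof -
    have "norm (c *\<^sub>R x) powr q = l * norm x powr q" using c by (simp add: powr_mult cq)
    then have "l + norm (c *\<^sub>R x) powr q / q = l * g x" by (simp add: profile_def algebra_simps)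
    then show ?thesis unfolding F_def by (simp add: power_mult_distrib)
  qed
  then have "(\<integral>x. F (c *\<^sub>R x) \<partial>lborel) = (\<integral>x. 1 / l ^ d * (1 / g x ^ d) \<partial>lborel)" by simp
  then have "1 / l ^ d * (\<integral>x. 1 / g x ^ d \<partial>lborel) = (\<integral>x. F x \<partial>lborel) / c ^ DIM(real ^ 'n)"
    unfolding integral_mult_right_zero by (simp add: integral_lborel_scaleR[OF _ c])
  then have "(\<integral>x. F x \<partial>lborel) = c ^ CARD('n) * (1 / l ^ d) * (\<integral>x. 1 / g x ^ d \<partial>lborel)"
    using c by (simp add: field_simps)
  also have "c ^ CARD('n) * (1 / l ^ d) = l powr (N / q) / l powr (real d)"
    using l c by (simp add: powr_realpow[symmetric] c_def powr_powr N_card)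
  also have "\<dots> = l powr (1 - N / p)"
    unfolding powr_diff[symmetric] exponent_identity ..
  finally show ?thesis unfolding F_def .
qed

text \<open>Both sides come from the derivative at \<open>l = 1\<close> of the integral in \<open>integral_shifted_profile\<close>: on the left
from its closed form, on the right by differentiating the integrand. The tangent inequality for the
power \<open>-d\<close> justifies the latter, since it says that the difference of the two expressions is least at \<open>l = 1\<close>.\<close>
lemma profile_mass_relation: "(N - p) * (\<integral>x. 1 / g x ^ d \<partial>lborel) = p * real d * Mg"
proof -
  define A where "A = (\<integral>x. 1 / g x ^ d \<partial>lborel)"
  define M where "M = (\<integral>x. 1 / g x ^ Suc d \<partial>lborel)"
  define h where "h l = l powr (1 - N / p) * A + real d * (l - 1) * M" for l :: real
  have h1: "h 1 = A" by (simp add: h_def)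
  have le: "A \<le> h l" if l: "0 < l" for l
  proof -
    have tangent: "1 * (1 / g x ^ d) - real d * (l - 1) * (1 / g x ^ Suc d) + 0 * 0 \<le> 1 / (l + norm x powr q / q) ^ d" for x
      using inverse_power_tangent[of "l + norm x powr q / q" "g x" d] l q_pos
      by (simp add: profile_def add_pos_nonneg)
    have int: "integrable lborel (\<lambda>x::real ^ 'n. 1 / (l + norm x powr q / q) ^ d)"
    proof (rule Bochner_Integration.integrable_bound)
      define c where "c = max 1 (1 / l)"
      show "integrable lborel (\<lambda>x. c ^ d * (1 / g x ^ d))"
        by (intro integrable_mult_right integrable_g) simp
      show "AE x in lborel. norm (1 / (l + norm (x :: real ^ 'n) powr q / q) ^ d) \<le> norm (c ^ d * (1 / g x ^ d))"
      proof (rule AE_I2)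
        fix x :: "real ^ 'n"
        define t where "t = norm x powr q / q"
        have t: "0 \<le> t" using q_pos by (simp add: t_def)
        have c: "1 \<le> c" "1 \<le> c * l" using l by (auto simp: c_def max_def field_simps)
        have "t \<le> c * t" using mult_right_mono[OF c(1) t] by simp
        then have "g x \<le> c * (l + t)" using c by (simp add: profile_def t_def[symmetric] distrib_left)
        then have "g x ^ d \<le> (c * (l + t)) ^ d" by (intro power_mono) auto
        then have "g x ^ d \<le> c ^ d * (l + t) ^ d" by (simp only: power_mult_distrib)
        moreover have "0 < (l + t) ^ d" "0 < g x ^ d" using l t by (auto simp: add_pos_nonneg)
        ultimately have "1 / (l + t) ^ d \<le> c ^ d * (1 / g x ^ d)" by (simp add: field_simps)
        moreover have "norm (1 / (l + t) ^ d) = 1 / (l + t) ^ d" using l t by (simp add: add_pos_nonneg)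
        moreover have "c ^ d * (1 / g x ^ d) \<le> norm (c ^ d * (1 / g x ^ d))" unfolding real_norm_def by (rule abs_ge_self)
        ultimately show "norm (1 / (l + norm x powr q / q) ^ d) \<le> norm (c ^ d * (1 / g x ^ d))"
          unfolding t_def by linarith
      qed
    qed measurable
    have "(\<integral>x. 1 * (1 / g x ^ d) - real d * (l - 1) * (1 / g x ^ Suc d) + 0 * 0 \<partial>lborel) \<le> (\<integral>x. 1 / (l + norm x powr q / q) ^ d \<partial>(lborel :: (real ^ 'n) measure))"
      by (intro integral_mono int tangent integral_lincomb(2) integrable_g integrable_zero) auto
    also have "(\<integral>x. 1 * (1 / g x ^ d) - real d * (l - 1) * (1 / g x ^ Suc d) + 0 * 0 \<partial>lborel) = A - real d * (l - 1) * M"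
      unfolding A_def M_def by (subst integral_lincomb(1)) (use integrable_g[of d] integrable_g[of "Suc d"] in simp_all)
    finally show ?thesis unfolding integral_shifted_profile[OF l] h_def A_def by simp
  qed
  have "DERIV h 1 :> ((1 - N / p) * 1 powr (1 - N / p - 1)) * A + real d * M"
    unfolding h_def by (auto intro!: derivative_eq_intros)
  then have "((1 - N / p) * 1 powr (1 - N / p - 1)) * A + real d * M = 0"
    by (rule DERIV_local_min[where d = 1]) (auto intro!: le simp: h1)
  then have "(1 - N / p) * A + real d * M = 0" by simp
  then have "p * ((1 - N / p) * A + real d * M) = 0" by simp
  then have "(N - p) * A = p * real d * M" using p_gt_1 by (simp add: algebra_simps)
  then show ?thesis using d by (simp add: A_def M_def profile_mass_def)
qed

lemma profile_mass_pos: "0 < Mg"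
  unfolding profile_mass_def by (intro integral_lborel_pos integrable_g) (use d in auto)

definition profile_energy_factor :: real where "profile_energy_factor = p * N / (N - p)"

lemma powr_norm_profile_grad: "norm (profile_grad q x) powr p = q * (g x - 1)"
proof -
  have "(q - 1) * p = q" using conjugate p_gt_1 q_pos by (simp add: field_simps)
  then show ?thesis using q_pos by (simp add: norm_profile_grad powr_powr profile_def)
qed

lemma profile_energy:
  "(\<integral>x. norm (profile_grad q (x :: real ^ 'n)) powr p / g x ^ CARD('n) \<partial>lborel) = profile_energy_factor * Mg"
  "integrable lborel (\<lambda>x::real ^ 'n. norm (profile_grad q x) powr p / g x ^ CARD('n))"
proof -
  have eq: "norm (profile_grad q x) powr p / g x ^ CARD('n) = q * (1 / g x ^ d) - q * (1 / g x ^ Suc d) + 0 * 0" for x :: "real ^ 'n"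
    unfolding powr_norm_profile_grad d using less_imp_neq[OF g_pos[of x]] by (simp add: field_simps)
  have int: "integrable lborel (\<lambda>x. 1 / g x ^ d)" "integrable lborel (\<lambda>x. 1 / g x ^ Suc d)" by (rule integrable_g, simp)+
  show "integrable lborel (\<lambda>x::real ^ 'n. norm (profile_grad q x) powr p / g x ^ CARD('n))"
    unfolding eq by (rule integral_lincomb(2)[OF int integrable_zero])
  have "(\<integral>x. norm (profile_grad q (x :: real ^ 'n)) powr p / g x ^ CARD('n) \<partial>lborel) = q * (\<integral>x. 1 / g x ^ d \<partial>lborel) - q * Mg"
    unfolding eq integral_lincomb(1)[OF int integrable_zero] by (simp add: profile_mass_def d)
  also have "(\<integral>x. 1 / g x ^ d \<partial>lborel) = p * real d * Mg / (N - p)"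
    using profile_mass_relation p_less_N by (simp add: field_simps)
  also have "q * (p * real d * Mg / (N - p)) - q * Mg = q * (p * real d / (N - p) - 1) * Mg"
    by (simp add: algebra_simps)
  also have "q * (p * real d / (N - p) - 1) = profile_energy_factor"
  proof -
    have "p * real d / (N - p) - 1 = (p * real d - (N - p)) / (N - p)" using p_less_N by (simp add: diff_divide_distrib)
    also have "p * real d - (N - p) = N * (p - 1)" using N_eq by (simp add: algebra_simps)
    finally show ?thesis using p_gt_1 by (simp add: q_eq profile_energy_factor_def)
  qed
  finally show "(\<integral>x. norm (profile_grad q (x :: real ^ 'n)) powr p / g x ^ CARD('n) \<partial>lborel) = profile_energy_factor * Mg" .
qed

text \<open>As the suprema are finite and positive, a suitable multiple of \<open>f\<close> has the same one as the profile.\<close>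
lemma section_SUP_finite_pos:
  fixes f :: "real ^ 'n \<Rightarrow> real" and i :: 'n
  assumes [measurable]: "f \<in> borel_measurable borel" and f: "\<And>x. 0 < f x" "\<And>x. g x \<le> C * f x" and C: "0 < C"
  shows "\<exists>m>0. (SUP t. section_integral i (\<lambda>x. ennreal (1 / f x ^ d)) t) = ennreal m"
proof -
  let ?m = "SUP t. section_integral i (\<lambda>x. ennreal (1 / f x ^ d)) t"
  have cd: "card (UNIV - {i}) = d" using d by simp
  then have ne: "UNIV - {i} \<noteq> {}" using d_pos by force
  have "real d < q * real d" using q_gt_1 d_pos by simp
  then obtain K where K: "K < \<infinity>" "\<And>x. partial_integral (UNIV - {i}) (\<lambda>z. ennreal (1 / g z ^ d)) x \<le> K"
    using partial_integral_profile_bounded[OF q_gt_1 ne, of d] cd by auto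
  have le: "ennreal (1 / f x ^ d) \<le> ennreal (C ^ d) * ennreal (1 / g x ^ d)" for x
  proof -
    have "g x ^ d \<le> (C * f x) ^ d" by (intro power_mono f) auto
    then have "1 / f x ^ d \<le> C ^ d * (1 / g x ^ d)" using f(1)[of x] by (simp add: field_simps power_mult_distrib)
    then show ?thesis using C by (metis ennreal_leI ennreal_mult' less_imp_le zero_le_power)
  qed
  have "?m \<le> ennreal (C ^ d) * K"
  proof (rule SUP_least)
    fix t
    have "section_integral i (\<lambda>x. ennreal (1 / f x ^ d)) t \<le> section_integral i (\<lambda>x. ennreal (C ^ d) * ennreal (1 / g x ^ d)) t"
      unfolding section_integral_def partial_integral_def by (intro nn_integral_mono le)
    also have "\<dots> = ennreal (C ^ d) * section_integral i (\<lambda>x. ennreal (1 / g x ^ d)) t"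
      by (rule section_integral_cmult) measurable
    also have "\<dots> \<le> ennreal (C ^ d) * K" unfolding section_integral_def by (intro mult_left_mono K) auto
    finally show "section_integral i (\<lambda>x. ennreal (1 / f x ^ d)) t \<le> ennreal (C ^ d) * K" .
  qed
  also have "\<dots> < \<infinity>" using K by (simp add: ennreal_mult_less_top)
  finally have fin: "?m < top" by simp
  have "?m \<noteq> 0"
  proof
    assume m0: "?m = 0"
    have "section_integral i (\<lambda>x. ennreal (1 / f x ^ d)) t = 0" for t
      using SUP_upper[of t UNIV "section_integral i (\<lambda>x. ennreal (1 / f x ^ d))"] m0 by simp
    then have "(\<integral>\<^sup>+x. ennreal (1 / f x ^ d) \<partial>lborel) = 0"
      using nn_integral_section_integral[of "\<lambda>x. ennreal (1 / f x ^ d)" i] by simp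
    then have "AE x in lborel. ennreal (1 / f x ^ d) = 0"
      by (subst (asm) nn_integral_0_iff_AE) auto
    moreover have "ennreal (1 / f x ^ d) \<noteq> 0" for x using f(1)[of x] by (simp add: ennreal_eq_0_iff not_le)
    ultimately have "AE x in (lborel :: (real ^ 'n) measure). False" by simp
    then show False by (simp add: AE_iff_null emeasure_lborel_UNIV null_sets_def)
  qed
  moreover obtain r where r: "?m = ennreal r" "0 \<le> r" using fin by (cases ?m) auto
  ultimately have "0 < r" by (auto simp: less_le)
  then show ?thesis using r(1) by blast
qed

lemma profile_like_scale:
  assumes "profile_like q f Df" and k: "0 < k"
  shows "profile_like q (\<lambda>x. k * f x) (\<lambda>x. k *\<^sub>R Df x)"
proof -
  obtain \<kappa> R where kr: "0 < \<kappa>" "\<And>x. R < norm x \<Longrightarrow> f x = \<kappa> * profile q x"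
    and f: "\<And>x. 0 < f x" "\<And>x. GDERIV f x :> Df x" "continuous_on UNIV Df"
    using assms unfolding profile_like_def by auto
  have "GDERIV (\<lambda>x. k * f x) x :> k *\<^sub>R Df x" for x
    using GDERIV_mult[OF GDERIV_const f(2), of k x] by simp
  moreover have "\<exists>\<kappa> R. 0 < \<kappa> \<and> (\<forall>x. R < norm x \<longrightarrow> k * f x = \<kappa> * profile q x)"
    using kr k by (intro exI[of _ "k * \<kappa>"] exI[of _ R]) simp
  moreover have "continuous_on UNIV (\<lambda>x. k *\<^sub>R Df x)" by (intro continuous_intros f)
  ultimately show ?thesis
    using f k unfolding profile_like_def by simp
qed

text \<open>Replacing \<open>f\<close> by \<open>k f\<close> multiplies the energy by \<open>k powr (p - N)\<close> and the mass by \<open>k powr (-N)\<close>. For the \<open>k\<close> that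
equalises the suprema over hyperplanes, \<open>equal_sections_inequality\<close> bounds the energy of \<open>f\<close> from below by a combination of \<open>k powr (N - p)\<close> and
\<open>k powr (-p)\<close> times the mass. The weighted inequality of the means removes \<open>k\<close>. By
\<open>profile_mass_relation\<close> the weights are such that \<open>k = 1\<close> is optimal for the profile, which is why
nothing is lost there.\<close>
theorem sharp_inequality_profile_like:
  fixes f :: "real ^ 'n \<Rightarrow> real"
  assumes pl: "profile_like q f Df"
  shows "profile_energy_factor * Mg powr (p / N) * (\<integral>x. 1 / f x ^ CARD('n) \<partial>lborel) powr ((N - p) / N)
     \<le> (\<integral>x. norm (Df x) powr p / f x ^ CARD('n) \<partial>lborel)"
proof -
  obtain i :: 'n where True by simp
  define E where "E = (\<integral>x. norm (Df x) powr p / f x ^ CARD('n) \<partial>lborel)"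
  define M where "M = (\<integral>x. 1 / f x ^ CARD('n) \<partial>lborel)"
  define A where "A = (\<integral>x. 1 / g x ^ d \<partial>lborel)"
  have fm[measurable]: "f \<in> borel_measurable borel" by (rule f_measurable[OF pl])
  note fp = f_pos[OF pl]
  obtain C where C: "0 < C" "\<And>x. g x \<le> C * f x"
    using profile_like_comparable[OF p_gt_1 q_gt_1 conjugate pl] by metis
  obtain mf where mf: "0 < mf" "(SUP t. section_integral i (\<lambda>x. ennreal (1 / f x ^ d)) t) = ennreal mf"
    using section_SUP_finite_pos[OF fm fp C(2) C(1)] by blast
  obtain mg where mg: "0 < mg" "(SUP t. section_integral i (\<lambda>x. ennreal (1 / g x ^ d)) t) = ennreal mg"
    using section_SUP_finite_pos[of g 1] by auto
  define k where "k = root d (mf / mg)"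
  have k: "0 < k" "k ^ d = mf / mg" using mf mg d_pos by (auto simp: k_def)
  have sup: "(SUP t. section_integral i (\<lambda>x. ennreal (1 / (k * f x) ^ d)) t) = (SUP t. section_integral i (\<lambda>x. ennreal (1 / g x ^ d)) t)"
  proof -
    have "ennreal (1 / (k * f x) ^ d) = ennreal (1 / k ^ d) * ennreal (1 / f x ^ d)" for x
      using k(1) fp[of x] by (simp add: power_mult_distrib ennreal_mult'[symmetric])
    then have "(SUP t. section_integral i (\<lambda>x. ennreal (1 / (k * f x) ^ d)) t)
       = (SUP t. ennreal (1 / k ^ d) * section_integral i (\<lambda>x. ennreal (1 / f x ^ d)) t)"
      by (simp add: section_integral_cmult)
    also have "\<dots> = ennreal (1 / k ^ d) * ennreal mf" by (simp add: SUP_mult_left_ennreal[symmetric] mf(2))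
    also have "\<dots> = ennreal mg" using mf mg by (simp add: k(2) ennreal_mult'[symmetric])
    finally show ?thesis using mg(2) by simp
  qed
  have M: "0 < M"
    unfolding M_def by (intro integral_lborel_pos integrable_f[OF pl]) (use d fp in auto)
  have "norm (k *\<^sub>R Df x) powr p / (k * f x) ^ Suc d = k powr p / k ^ Suc d * (norm (Df x) powr p / f x ^ Suc d)" for x
    using k(1) by (simp add: powr_mult power_mult_distrib)
  then have E': "(\<integral>x. norm (k *\<^sub>R Df x) powr p / (k * f x) ^ Suc d \<partial>lborel) = k powr p / k ^ Suc d * E"
    unfolding E_def d by (simp only: integral_mult_right_zero)
  have "1 / (k * f x) ^ Suc d = 1 / k ^ Suc d * (1 / f x ^ Suc d)" for x
    by (simp add: power_mult_distrib)
  then have M': "(\<integral>x. 1 / (k * f x) ^ Suc d \<partial>lborel) = 1 / k ^ Suc d * M"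
    unfolding M_def d by (simp only: integral_mult_right_zero)
  have A_le: "A \<le> real d * (k powr p / k ^ Suc d * E / p - 1 / k ^ Suc d * M)"
    using equal_sections_inequality[OF profile_like_scale[OF pl k(1)] sup] unfolding E' M' A_def .
  have kN: "k ^ Suc d = k powr N" using k unfolding N_def by (simp only: powr_realpow)
  have kp: "0 < k powr (N - p)" using k by simp
  have "k powr p / k ^ Suc d = 1 / k powr (N - p)" unfolding kN by (simp add: powr_diff)
  moreover have "1 / k ^ Suc d = k powr (- p) / k powr (N - p)"
    unfolding kN using k by (simp add: powr_diff powr_minus field_simps)
  ultimately have "A * k powr (N - p) \<le> real d * (1 / k powr (N - p) * E / p - k powr (- p) / k powr (N - p) * M) * k powr (N - p)"
    using A_le kp by (intro mult_right_mono) auto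
  also have "\<dots> = real d * (E / p - k powr (- p) * M)"
    using kp by (simp add: field_simps)
  finally have "(N - p) * A * k powr (N - p) \<le> (N - p) * (real d * (E / p - k powr (- p) * M))"
    using p_less_N by (simp add: mult.assoc)
  then have "p * real d * Mg * k powr (N - p) \<le> (N - p) * (real d * (E / p - k powr (- p) * M))"
    unfolding A_def profile_mass_relation .
  then have "real d * (p * Mg * k powr (N - p)) \<le> real d * ((N - p) * (E / p - k powr (- p) * M))"
    by (simp add: mult_ac)
  then have ineq: "p * Mg * k powr (N - p) \<le> (N - p) * (E / p - k powr (- p) * M)"
    using d_pos by simp
  define x y where "x = Mg * k powr (N - p)" and "y = M * k powr (- p)"
  have xy: "0 < x" "0 < y" using k M profile_mass_pos by (auto simp: x_def y_def)
  have "x powr (p / N) * y powr ((N - p) / N) \<le> p / N * x + (N - p) / N * y"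
    using p_gt_1 p_less_N N_pos xy by (intro Youngs_inequality_0) (auto simp: add_divide_distrib[symmetric])
  also have "x powr (p / N) * y powr ((N - p) / N) = Mg powr (p / N) * M powr ((N - p) / N)"
  proof -
    have "k powr ((N - p) * (p / N)) * k powr (- p * ((N - p) / N)) = 1"
      using k by (subst powr_add[symmetric]) (simp add: mult.commute)
    then show ?thesis unfolding x_def y_def using k M profile_mass_pos
      by (simp add: powr_mult powr_powr)
  qed
  finally have "profile_energy_factor * (Mg powr (p / N) * M powr ((N - p) / N)) \<le> profile_energy_factor * (p / N * x + (N - p) / N * y)"
    using p_gt_1 p_less_N by (intro mult_left_mono) (auto simp: profile_energy_factor_def N_def)
  also have "\<dots> = p / (N - p) * (p * x + (N - p) * y)"
    unfolding profile_energy_factor_def using p_less_N N_pos p_gt_1 by (simp add: field_simps)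
  also have "\<dots> \<le> p / (N - p) * ((N - p) * (E / p))"
    using ineq p_gt_1 p_less_N unfolding x_def y_def by (intro mult_left_mono) (auto simp: algebra_simps)
  also have "\<dots> = E" using p_gt_1 p_less_N by simp
  finally show ?thesis unfolding E_def M_def by (simp add: mult.assoc)
qed

end

section \<open>The sharp Sobolev inequality for compactly supported functions\<close>

context sharp_exponents
begin

definition \<theta> :: real where "\<theta> = (N - p) / p"

text \<open>The critical exponent \<open>p*\<close>.\<close>
definition ps :: real where "ps = N * p / (N - p)"

lemma theta_pos: "0 < \<theta>" using p_less_N p_gt_1 by (simp add: \<theta>_def)

lemma theta_ps: "\<theta> * ps = N" using p_less_N p_gt_1 by (simp add: \<theta>_def ps_def)

lemma theta_succ: "(\<theta> + 1) * p = N" using p_gt_1 by (simp add: \<theta>_def field_simps)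

lemma theta_p: "\<theta> * p = N - p" using p_gt_1 by (simp add: \<theta>_def)

lemma ps_gt: "p < ps"
proof -
  have "p * (N - p) < p * N" using p_gt_1 by (intro mult_strict_left_mono) auto
  then show ?thesis using p_less_N by (simp add: ps_def field_simps)
qed

text \<open>The Aubin--Talenti function.\<close>
definition U :: "real ^ 'n \<Rightarrow> real" where "U x = g x powr - \<theta>"

definition DU :: "real ^ 'n \<Rightarrow> real ^ 'n" where
  "DU x = (- \<theta> * g x powr (- \<theta> - 1)) *\<^sub>R profile_grad q x"

lemma U_pos: "0 < U x" using less_imp_neq[OF g_pos[of x]] by (simp add: U_def)

lemma GDERIV_U: "GDERIV U x :> DU x"
  unfolding U_def[abs_def] DU_def
  by (intro GDERIV_DERIV_compose GDERIV_profile q_gt_1 has_real_derivative_powr) simp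

lemma continuous_on_g: "continuous_on UNIV g" by (rule continuous_on_profile[OF q_gt_1])

lemma continuous_on_U: "continuous_on UNIV U"
  unfolding U_def[abs_def]
  by (intro continuous_on_powr continuous_on_g continuous_on_const) (use less_imp_neq[OF g_pos] in auto)

lemma continuous_on_DU: "continuous_on UNIV DU"
  unfolding DU_def[abs_def]
  by (intro continuous_intros continuous_on_powr continuous_on_g continuous_on_const continuous_on_profile_grad q_gt_1)
     (use less_imp_neq[OF g_pos] in auto)

lemma U_powr_ps: "\<bar>U x\<bar> powr ps = 1 / g x ^ CARD('n)"
proof -
  have "\<bar>U x\<bar> powr ps = g x powr - N"
    using U_pos[of x] theta_ps by (simp add: U_def powr_powr)
  then show ?thesis
    by (simp add: powr_minus powr_realpow N_card[symmetric] divide_inverse)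
qed

lemma norm_DU_powr: "norm (DU x) powr p = \<theta> powr p * (norm (profile_grad q x) powr p / g x ^ CARD('n))"
proof -
  have "(- \<theta> - 1) * p = - N" using theta_succ by (simp add: algebra_simps)
  then have "norm (DU x) powr p = \<theta> powr p * (g x powr - N * norm (profile_grad q x) powr p)"
    using theta_pos unfolding DU_def by (simp add: powr_mult powr_powr)
  then show ?thesis
    by (simp add: powr_minus powr_realpow N_card[symmetric] divide_inverse mult.commute)
qed

text \<open>The quotient of the energy of \<open>U\<close> by the \<open>p\<close>-th power of its norm.\<close>
definition sharp_constant :: real where
  "sharp_constant = \<theta> powr p * (profile_energy_factor * Mg powr (p / N))"

lemma integral_norm_DU_powr:
  "(\<integral>x. norm (DU x) powr p \<partial>lborel) = \<theta> powr p * (profile_energy_factor * Mg)"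
  "integrable lborel (\<lambda>x. norm (DU x) powr p)"
  unfolding norm_DU_powr integral_mult_right_zero profile_energy(1)
  by (rule refl, rule integrable_mult_right[OF profile_energy(2)])

lemma integral_U_powr_ps:
  "(\<integral>x. \<bar>U x\<bar> powr ps \<partial>lborel) = Mg" "integrable lborel (\<lambda>x. \<bar>U x\<bar> powr ps)"
  unfolding U_powr_ps using integrable_g[of "CARD('n)"] d by (simp_all add: profile_mass_def)

lemma U_attains: "(\<integral>x. norm (DU x) powr p \<partial>lborel) = sharp_constant * Mg powr ((N - p) / N)"
proof -
  have "Mg powr (p / N) * Mg powr ((N - p) / N) = Mg"
    using profile_mass_pos N_pos by (subst powr_add[symmetric]) (simp add: add_divide_distrib[symmetric])
  then show ?thesis by (simp add: integral_norm_DU_powr sharp_constant_def mult.assoc)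
qed

context
  fixes v :: "real ^ 'n \<Rightarrow> real" and Dv and R
  assumes v: "\<And>x. GDERIV v x :> Dv x" and cDv: "continuous_on UNIV Dv" and v0: "\<And>x. R < norm x \<Longrightarrow> v x = 0"
begin

lemma continuous_on_v: "continuous_on UNIV v"
  by (rule GDERIV_imp_continuous_on[OF v])

lemma Dv0: "R < norm x \<Longrightarrow> Dv x = 0"
  by (rule GDERIV_zero_outside_ball[OF v v0])

lemma integrable_v: "integrable lborel (\<lambda>x. \<bar>v x\<bar> powr ps)"
  by (rule integrable_continuous_zero_outside_ball[where R = R])
     (use continuous_on_v v0 ps_gt p_gt_1 in \<open>auto intro!: continuous_intros continuous_on_powr'\<close>)

lemma integrable_Dv: "integrable lborel (\<lambda>x. norm (Dv x) powr p)"
  by (rule integrable_continuous_zero_outside_ball[where R = R])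
     (use cDv Dv0 p_gt_1 in \<open>auto intro!: continuous_intros continuous_on_powr'\<close>)

text \<open>The function \<open>u = sqrt (v\<^sup>2 + e\<^sup>2 U\<^sup>2)\<close> is positive and differentiable whatever the sign of \<open>v\<close>, equals
\<open>e U\<close> outside the support of \<open>v\<close>, and satisfies \<open>|v| \<le> u\<close> and \<open>|Du| \<le> |Dv| + e |DU|\<close>. So the
inequality \<open>sharp_inequality_profile_like\<close> applies to \<open>f = u powr (-1 / \<theta>)\<close>.\<close>
lemma sharp_sobolev_C1_eps:
  assumes e: "0 < e" "e < 1"
  shows "sharp_constant * (\<integral>x. \<bar>v x\<bar> powr ps \<partial>lborel) powr ((N - p) / N)
    \<le> (1 - e) powr (1 - p) * (\<integral>x. norm (Dv x) powr p \<partial>lborel) + e * (\<integral>x. norm (DU x) powr p \<partial>lborel)"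
proof -
  \<comment> \<open>\<open>W\<close> is the square of \<open>u\<close>.\<close>
  define W where "W x = v x * v x + e\<^sup>2 * (U x * U x)" for x
  define DW where "DW x = 2 *\<^sub>R (v x *\<^sub>R Dv x + (e\<^sup>2 * U x) *\<^sub>R DU x)" for x
  define f where "f x = W x powr (- 1 / (2 * \<theta>))" for x
  define Df where "Df x = ((- 1 / (2 * \<theta>)) * W x powr (- 1 / (2 * \<theta>) - 1)) *\<^sub>R DW x" for x
  define Y where "Y x = norm (Dv x) + e * norm (DU x)" for x
  have Wp: "0 < W x" for x
    unfolding W_def using e U_pos[of x] by (intro add_nonneg_pos mult_pos_pos) auto
  have dW: "GDERIV W x :> DW x" for x
  proof -
    have "GDERIV W x :> (v x *\<^sub>R Dv x + v x *\<^sub>R Dv x) + (e\<^sup>2 *\<^sub>R (U x *\<^sub>R DU x + U x *\<^sub>R DU x) + (U x * U x) *\<^sub>R 0)"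
      unfolding W_def[abs_def] by (intro GDERIV_add GDERIV_mult GDERIV_const v GDERIV_U)
    then show ?thesis by (rule GDERIV_subst) (unfold DW_def scaleR_2, simp only: scaleR_add_right scaleR_scaleR scaleR_zero_right add_0_left add_0_right add_ac)
  qed
  have cW: "continuous_on UNIV W" unfolding W_def by (intro continuous_intros continuous_on_v continuous_on_U)
  have pl: "profile_like q f Df"
    unfolding profile_like_def
  proof (intro conjI allI)
    show "0 < f x" for x unfolding f_def using Wp[of x] by simp
    show "GDERIV f x :> Df x" for x
      unfolding f_def[abs_def] Df_def by (intro GDERIV_DERIV_compose dW has_real_derivative_powr Wp)
    show "continuous_on UNIV Df"
      unfolding Df_def[abs_def] DW_def
      by (intro continuous_intros continuous_on_powr cW continuous_on_v continuous_on_U continuous_on_DU cDv)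
         (use less_imp_neq[OF Wp] in auto)
    have "f x = e powr (- 1 / \<theta>) * g x" if "R < norm x" for x
    proof -
      have "W x = (e * U x) powr 2" using v0[OF that] e U_pos[of x] by (simp add: W_def power2_eq_square powr_numeral)
      then have "f x = (e * U x) powr (- 1 / \<theta>)" using theta_pos by (simp add: f_def powr_powr)
      also have "\<dots> = e powr (- 1 / \<theta>) * g x powr (- \<theta> * (- 1 / \<theta>))"
        using e U_pos[of x] by (simp only: powr_mult U_def powr_powr)
      also have "- \<theta> * (- 1 / \<theta>) = 1" using theta_pos by simp
      finally show ?thesis by simp
    qed
    then show "\<exists>\<kappa> R. 0 < \<kappa> \<and> (\<forall>x. R < norm x \<longrightarrow> f x = \<kappa> * g x)"
      using e by (intro exI[of _ "e powr (- 1 / \<theta>)"] exI[of _ R]) simp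
  qed
  have fN: "f x ^ CARD('n) = W x powr (- N / (2 * \<theta>))" for x
  proof -
    have "f x ^ CARD('n) = f x powr N" using f_pos[OF pl, of x] by (simp add: powr_realpow[symmetric] N_card)
    then show ?thesis by (simp add: f_def powr_powr)
  qed
  have int1: "integrable lborel (\<lambda>x. 1 / f x ^ CARD('n))" using d by (intro integrable_f[OF pl]) simp
  have int2: "integrable lborel (\<lambda>x. norm (Df x) powr p / f x ^ CARD('n))" unfolding d by (rule integrable_Df[OF pl])
  have le1: "\<bar>v x\<bar> powr ps \<le> 1 / f x ^ CARD('n)" for x
  proof -
    have e1: "N / (2 * \<theta>) = ps / 2" using theta_ps theta_pos by (simp add: field_simps)
    have "\<bar>v x\<bar> powr ps = (v x * v x) powr (ps / 2)"
    proof -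
      have "v x * v x = \<bar>v x\<bar> * \<bar>v x\<bar>" by simp
      then show ?thesis by (simp only: powr_mult powr_add[symmetric]) simp
    qed
    also have "\<dots> \<le> W x powr (ps / 2)"
      unfolding W_def using ps_gt p_gt_1 by (intro powr_mono2) auto
    also have "\<dots> = 1 / f x ^ CARD('n)"
    proof -
      have "f x ^ CARD('n) = inverse (W x powr (N / (2 * \<theta>)))" unfolding fN by (simp add: powr_minus)
      then show ?thesis unfolding e1 by (simp add: inverse_eq_divide)
    qed
    finally show ?thesis .
  qed
  have Y0: "0 \<le> Y x" for x unfolding Y_def using e by simp
  have le2: "norm (Df x) powr p / f x ^ CARD('n) \<le> \<theta> powr - p * Y x powr p" for x
  proof -
    have "\<bar>v x\<bar> \<le> sqrt (W x)" unfolding W_def by (intro real_le_rsqrt) (simp add: power2_eq_square)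
    moreover have "e * U x \<le> sqrt (W x)" unfolding W_def by (intro real_le_rsqrt) (simp add: power2_eq_square algebra_simps)
    ultimately have "\<bar>v x\<bar> * norm (Dv x) + (e * U x) * (e * norm (DU x)) \<le> sqrt (W x) * norm (Dv x) + sqrt (W x) * (e * norm (DU x))"
      using e by (intro add_mono mult_right_mono) auto
    also have "\<dots> = W x powr (1 / 2) * Y x" using Wp[of x] by (simp add: Y_def powr_half_sqrt algebra_simps)
    finally have 1: "\<bar>v x\<bar> * norm (Dv x) + (e * U x) * (e * norm (DU x)) \<le> W x powr (1 / 2) * Y x" .
    have "norm (v x *\<^sub>R Dv x + (e\<^sup>2 * U x) *\<^sub>R DU x) \<le> \<bar>v x\<bar> * norm (Dv x) + (e * U x) * (e * norm (DU x))"
      using U_pos[of x] by (intro order.trans[OF norm_triangle_ineq]) (simp add: power2_eq_square abs_mult)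
    then have "norm (DW x) \<le> 2 * (W x powr (1 / 2) * Y x)" unfolding DW_def using 1 by simp
    then have "(1 / (2 * \<theta>) * W x powr (- 1 / (2 * \<theta>) - 1)) * norm (DW x)
       \<le> (1 / (2 * \<theta>) * W x powr (- 1 / (2 * \<theta>) - 1)) * (2 * (W x powr (1 / 2) * Y x))"
      using theta_pos by (intro mult_left_mono) auto
    also have "\<dots> = 1 / \<theta> * (W x powr (- 1 / (2 * \<theta>) - 1) * W x powr (1 / 2)) * Y x"
      using theta_pos by (simp add: field_simps)
    also have "W x powr (- 1 / (2 * \<theta>) - 1) * W x powr (1 / 2) = W x powr (- 1 / (2 * \<theta>) - 1 / 2)"
      by (subst powr_add[symmetric]) (rule arg_cong[where f = "\<lambda>r. W x powr r"], simp)
    finally have "norm (Df x) \<le> 1 / \<theta> * W x powr (- 1 / (2 * \<theta>) - 1 / 2) * Y x"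
      using theta_pos by (simp add: Df_def)
    then have "norm (Df x) powr p \<le> (1 / \<theta> * W x powr (- 1 / (2 * \<theta>) - 1 / 2) * Y x) powr p"
      using p_gt_1 by (intro powr_mono2) auto
    also have "\<dots> = \<theta> powr - p * W x powr ((- 1 / (2 * \<theta>) - 1 / 2) * p) * Y x powr p"
      using theta_pos by (simp only: powr_mult powr_powr) (simp add: powr_divide powr_minus_divide)
    also have "(- 1 / (2 * \<theta>) - 1 / 2) * p = - N / (2 * \<theta>)"
    proof -
      have Nt: "N = \<theta> * p + p" using theta_p by simp
      show ?thesis unfolding Nt using theta_pos by (simp add: field_simps)
    qed
    finally have "norm (Df x) powr p \<le> \<theta> powr - p * Y x powr p * f x ^ CARD('n)"
      unfolding fN by (simp add: mult_ac)
    then show ?thesis using f_pos[OF pl, of x] by (simp add: divide_le_eq)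
  qed
  have le3: "Y x powr p \<le> (1 - e) powr (1 - p) * norm (Dv x) powr p + e * norm (DU x) powr p" for x
    unfolding Y_def using e by (intro powr_add_le p_gt_1) auto
  have "(\<integral>x. \<bar>v x\<bar> powr ps \<partial>lborel) \<le> (\<integral>x. 1 / f x ^ CARD('n) \<partial>lborel)"
    by (intro integral_mono integrable_v int1 le1)
  then have "(\<integral>x. \<bar>v x\<bar> powr ps \<partial>lborel) powr ((N - p) / N) \<le> (\<integral>x. 1 / f x ^ CARD('n) \<partial>lborel) powr ((N - p) / N)"
    using p_less_N N_pos by (intro powr_mono2) auto
  then have "sharp_constant * (\<integral>x. \<bar>v x\<bar> powr ps \<partial>lborel) powr ((N - p) / N)
      \<le> sharp_constant * (\<integral>x. 1 / f x ^ CARD('n) \<partial>lborel) powr ((N - p) / N)"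
    using p_less_N p_gt_1 N_pos by (intro mult_left_mono) (auto simp: sharp_constant_def profile_energy_factor_def)
  also have "\<dots> \<le> \<theta> powr p * (\<integral>x. norm (Df x) powr p / f x ^ CARD('n) \<partial>lborel)"
    unfolding sharp_constant_def mult.assoc
    using sharp_inequality_profile_like[OF pl] by (intro mult_left_mono) (auto simp: mult.assoc)
  also have "\<dots> \<le> \<theta> powr p * (\<integral>x. \<theta> powr - p * ((1 - e) powr (1 - p) * norm (Dv x) powr p + e * norm (DU x) powr p) \<partial>lborel)"
  proof (intro mult_left_mono integral_mono int2)
    show "integrable lborel (\<lambda>x. \<theta> powr - p * ((1 - e) powr (1 - p) * norm (Dv x) powr p + e * norm (DU x) powr p))"
      by (intro integrable_mult_right Bochner_Integration.integrable_add integrable_Dv integral_norm_DU_powr)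
    fix x
    show "norm (Df x) powr p / f x ^ CARD('n) \<le> \<theta> powr - p * ((1 - e) powr (1 - p) * norm (Dv x) powr p + e * norm (DU x) powr p)"
      using le2[of x] mult_left_mono[OF le3[of x], of "\<theta> powr - p"] by simp
  qed auto
  also have "\<dots> = (\<theta> powr p * \<theta> powr - p) * (\<integral>x. (1 - e) powr (1 - p) * norm (Dv x) powr p + e * norm (DU x) powr p \<partial>lborel)"
    unfolding integral_mult_right_zero by simp
  also have "\<theta> powr p * \<theta> powr - p = 1" using theta_pos by (simp add: powr_add[symmetric])
  also have "(\<integral>x. (1 - e) powr (1 - p) * norm (Dv x) powr p + e * norm (DU x) powr p \<partial>lborel)
      = (1 - e) powr (1 - p) * (\<integral>x. norm (Dv x) powr p \<partial>lborel) + e * (\<integral>x. norm (DU x) powr p \<partial>lborel)"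
    using integrable_Dv integral_norm_DU_powr(2) by simp
  finally show ?thesis by simp
qed

theorem sharp_sobolev_C1:
  "sharp_constant * (\<integral>x. \<bar>v x\<bar> powr ps \<partial>lborel) powr ((N - p) / N) \<le> (\<integral>x. norm (Dv x) powr p \<partial>lborel)"
proof (rule tendsto_lowerbound)
  define E where "E = (\<integral>x. norm (Dv x) powr p \<partial>lborel)"
  define EU where "EU = (\<integral>x. norm (DU x) powr p \<partial>lborel)"
  have "((\<lambda>e. (1 - e) powr (1 - p) * E + e * EU) \<longlongrightarrow> (1 - 0) powr (1 - p) * E + 0 * EU) (at_right 0)"
    by (intro tendsto_intros) auto
  then show "((\<lambda>e. (1 - e) powr (1 - p) * E + e * EU) \<longlongrightarrow> E) (at_right 0)" by simp
  show "\<forall>\<^sub>F e in at_right 0. sharp_constant * (\<integral>x. \<bar>v x\<bar> powr ps \<partial>lborel) powr ((N - p) / N) \<le> (1 - e) powr (1 - p) * E + e * EU"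
    unfolding E_def EU_def eventually_at_right_field
    by (intro exI[of _ 1] conjI allI impI sharp_sobolev_C1_eps) auto
qed simp

end

end

section \<open>Smooth bump functions\<close>

lemma partial_deriv_GDERIV:
  fixes f :: "real ^ 'n::finite \<Rightarrow> real"
  assumes "GDERIV f x :> D"
  shows "partial_deriv i f x = D $ i"
proof -
  have "frechet_derivative f (at x) = (\<lambda>h. h \<bullet> D)"
    using assms unfolding gderiv_def by (rule frechet_derivative_at[symmetric])
  then show ?thesis by (simp add: partial_deriv_def inner_axis')
qed

lemma GDERIV_partial_deriv:
  fixes f :: "real ^ 'n::finite \<Rightarrow> real"
  assumes "f differentiable (at x)"
  shows "GDERIV f x :> (\<chi> i. partial_deriv i f x)"
proof -
  let ?F = "frechet_derivative f (at x)"
  have F: "(f has_derivative ?F) (at x)" using assms by (rule frechet_derivative_works[THEN iffD1])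
  then have lin: "linear ?F" by (rule has_derivative_linear)
  have "?F h = h \<bullet> (\<chi> i. partial_deriv i f x)" for h
  proof -
    have "?F h = ?F (\<Sum>i\<in>UNIV. (h $ i) *\<^sub>R axis i 1)" by (simp add: basis_expansion scalar_mult_eq_scaleR[symmetric])
    also have "\<dots> = (\<Sum>i\<in>UNIV. (h $ i) *\<^sub>R ?F (axis i 1))"
      using lin by (simp add: linear_sum linear_scale)
    also have "\<dots> = h \<bullet> (\<chi> i. partial_deriv i f x)" by (simp add: inner_vec_def partial_deriv_def)
    finally show ?thesis .
  qed
  then have "?F = (\<lambda>h. h \<bullet> (\<chi> i. partial_deriv i f x))" ..
  then show ?thesis unfolding gderiv_def using F by simp
qed

lemma C_k_SucI:
  fixes f :: "real ^ 'n::finite \<Rightarrow> real"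
  assumes "\<And>x. GDERIV f x :> D x" "\<And>i. C_k k (\<lambda>x. D x $ i)"
  shows "C_k (Suc k) f"
proof -
  have "partial_deriv i f = (\<lambda>x. D x $ i)" for i using partial_deriv_GDERIV[OF assms(1)] by (simp add: fun_eq_iff)
  moreover have "f differentiable (at x)" for x using assms(1)[of x] unfolding gderiv_def differentiable_def by blast
  ultimately show ?thesis using assms(2) by simp
qed

lemma C_k_SucD:
  fixes f :: "real ^ 'n::finite \<Rightarrow> real"
  assumes "C_k (Suc k) f"
  shows "GDERIV f x :> (\<chi> i. partial_deriv i f x)" "C_k k (partial_deriv i f)"
  using assms by (auto intro: GDERIV_partial_deriv)

lemma C_k_const: "C_k k (\<lambda>x :: real ^ 'n::finite. c)"
proof (induction k arbitrary: c)
  case (Suc k)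
  show ?case by (rule C_k_SucI[where D = "\<lambda>x. 0"]) (auto intro: GDERIV_const Suc)
qed simp

lemma C_k_continuous: "C_k k f \<Longrightarrow> continuous_on UNIV (f :: real ^ 'n::finite \<Rightarrow> real)"
proof (cases k)
  case (Suc m)
  assume "C_k k f"
  then show ?thesis using Suc by (intro continuous_at_imp_continuous_on) (auto intro: differentiable_imp_continuous_within)
qed simp

lemma C_k_mono: "C_k (Suc k) f \<Longrightarrow> C_k k (f :: real ^ 'n::finite \<Rightarrow> real)"
proof (induction k arbitrary: f)
  case 0
  then show ?case using C_k_continuous[of "Suc 0" f] by simp
next
  case (Suc k)
  have "C_k (Suc k) (partial_deriv i f)" for i by (rule C_k_SucD(2)[OF Suc.prems])
  then show ?case
    using C_k_SucD(1)[OF Suc.prems] by (intro C_k_SucI[where D = "\<lambda>x. \<chi> i. partial_deriv i f x"]) (auto intro: Suc.IH)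
qed

lemma C_k_add: "C_k k f \<Longrightarrow> C_k k g \<Longrightarrow> C_k k (\<lambda>x :: real ^ 'n::finite. f x + g x)"
proof (induction k arbitrary: f g)
  case (Suc k)
  show ?case
    by (rule C_k_SucI[OF GDERIV_add[OF C_k_SucD(1)[OF Suc.prems(1)] C_k_SucD(1)[OF Suc.prems(2)]]])
       (auto intro!: Suc.IH C_k_SucD(2) Suc.prems)
qed (auto intro: continuous_intros)

lemma C_k_mult: "C_k k f \<Longrightarrow> C_k k g \<Longrightarrow> C_k k (\<lambda>x :: real ^ 'n::finite. f x * g x)"
proof (induction k arbitrary: f g)
  case (Suc k)
  show ?case
  proof (rule C_k_SucI[OF GDERIV_mult[OF C_k_SucD(1)[OF Suc.prems(1)] C_k_SucD(1)[OF Suc.prems(2)]]])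
    fix i
    have "C_k k (\<lambda>x. f x * partial_deriv i g x + g x * partial_deriv i f x)"
      using Suc.prems by (intro C_k_add Suc.IH C_k_SucD(2)) (auto intro: C_k_mono)
    then show "C_k k (\<lambda>x. (f x *\<^sub>R (\<chi> i. partial_deriv i g x) + g x *\<^sub>R (\<chi> i. partial_deriv i f x)) $ i)"
      by simp
  qed
qed (auto intro: continuous_intros)

lemma C_k_prod:
  assumes "finite I" "\<And>i. i \<in> I \<Longrightarrow> C_k k (f i)"
  shows "C_k k (\<lambda>x :: real ^ 'n::finite. \<Prod>i\<in>I. f i x)"
  using assms by (induction I rule: finite_induct) (auto intro: C_k_const C_k_mult)

text \<open>The sequence \<open>H\<close> lists the successive derivatives of a smooth function of one variable.\<close>
lemma C_k_coordinate:
  fixes H :: "nat \<Rightarrow> real \<Rightarrow> real"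
  assumes H: "\<And>m t. DERIV (H m) t :> H (Suc m) t"
  shows "C_k k (\<lambda>x :: real ^ 'n::finite. H m (c * x $ i + b))"
proof (induction k arbitrary: m)
  case 0
  have "isCont (H m) t" for t using H by (rule DERIV_isCont)
  then have "continuous_on UNIV (H m)" by (simp add: continuous_on_eq_continuous_at)
  then show ?case by (auto intro!: continuous_on_compose2[of UNIV "H m"] continuous_intros)
next
  case (Suc k)
  have d: "GDERIV (\<lambda>x :: real ^ 'n. c * x $ i + b) x :> c *\<^sub>R axis i 1" for x
    unfolding gderiv_def by (auto intro!: derivative_eq_intros bounded_linear.has_derivative[OF bounded_linear_vec_nth] simp: inner_axis)
  show ?case
  proof (rule C_k_SucI[OF GDERIV_DERIV_compose[OF d H]])
    fix j
    have "C_k k (\<lambda>x :: real ^ 'n. H (Suc m) (c * x $ i + b) * (c * axis i 1 $ j))"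
      by (intro C_k_mult C_k_const Suc.IH)
    then show "C_k k (\<lambda>x :: real ^ 'n. (H (Suc m) (c * x $ i + b) *\<^sub>R c *\<^sub>R axis i 1) $ j)" by (simp add: mult.assoc)
  qed
qed

text \<open>The functions \<open>P(1/t) exp (-1/t)\<close>, extended by zero, form a class that is closed under differentiation.\<close>
definition flat_exp :: "real poly \<Rightarrow> real \<Rightarrow> real" where
  "flat_exp P t = (if 0 < t then poly P (1 / t) * exp (- (1 / t)) else 0)"

definition flat_exp_step :: "real poly \<Rightarrow> real poly" where
  "flat_exp_step P = monom 1 2 * (P - pderiv P)"

lemma tendsto_poly_exp_at_top: "((\<lambda>y. poly P y * exp (- y)) \<longlongrightarrow> 0) at_top" for P :: "real poly"
proof -
  have "((\<lambda>y. \<Sum>i\<le>degree P. coeff P i * (y ^ i / exp y)) \<longlongrightarrow> (\<Sum>i\<le>degree P. coeff P i * 0)) at_top"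
    by (intro tendsto_intros tendsto_power_div_exp_0)
  then show ?thesis by (simp add: poly_altdef exp_minus sum_distrib_right divide_inverse mult.assoc)
qed

lemma tendsto_flat_exp_at_right: "((\<lambda>t. poly P (1 / t) * exp (- (1 / t))) \<longlongrightarrow> 0) (at_right 0)" for P :: "real poly"
  using filterlim_compose[OF tendsto_poly_exp_at_top filterlim_inverse_at_top_right, of P]
  by (simp add: inverse_eq_divide)

lemma DERIV_flat_exp: "DERIV (flat_exp P) t :> flat_exp (flat_exp_step P) t"
proof -
  consider "0 < t" | "t < 0" | "t = 0" by linarith
  then show ?thesis
  proof cases
    case 1
    have d: "DERIV (\<lambda>t. poly P (1 / t) * exp (- (1 / t))) t :>
       poly (pderiv P) (1 / t) * (- (1 / (t * t))) * exp (- (1 / t)) + exp (- (1 / t)) * (1 / (t * t)) * poly P (1 / t)"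
      using 1 by (auto intro!: derivative_eq_intros DERIV_chain2[OF poly_DERIV] simp: divide_inverse)
    have "DERIV (\<lambda>t. poly P (1 / t) * exp (- (1 / t))) t :> flat_exp (flat_exp_step P) t"
      using 1 by (intro DERIV_cong[OF d]) (simp add: flat_exp_def flat_exp_step_def poly_monom field_simps power2_eq_square)
    then show ?thesis
      using 1 by (subst DERIV_cong_ev[OF refl _ refl, where g = "\<lambda>t. poly P (1 / t) * exp (- (1 / t))"])
        (auto simp: flat_exp_def eventually_nhds intro!: exI[of _ "{0<..}"])
  next
    case 2
    have "DERIV (flat_exp P) t :> 0"
      using 2 by (subst DERIV_cong_ev[OF refl _ refl, where g = "\<lambda>t. 0"])
        (auto simp: flat_exp_def eventually_nhds intro!: exI[of _ "{..<0}"])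
    then show ?thesis using 2 by (simp add: flat_exp_def)
  next
    case 3
    have r: "((\<lambda>h. flat_exp P h / h) \<longlongrightarrow> 0) (at_right 0)"
    proof (rule Lim_transform_eventually[OF tendsto_flat_exp_at_right[of "monom 1 1 * P"]])
      show "\<forall>\<^sub>F t in at_right 0. poly (monom 1 1 * P) (1 / t) * exp (- (1 / t)) = flat_exp P t / t"
        using eventually_at_right_less[of "0::real"] by eventually_elim (simp add: flat_exp_def poly_monom)
    qed
    have l: "((\<lambda>h. flat_exp P h / h) \<longlongrightarrow> 0) (at_left 0)"
      by (rule Lim_transform_eventually[OF tendsto_const])
         (use eventually_at_left_real[of "-1" "0::real"] in \<open>auto simp: flat_exp_def elim: eventually_mono\<close>)
    have "((\<lambda>h. flat_exp P h / h) \<longlongrightarrow> 0) (at 0)"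
      using l r by (simp add: filterlim_split_at)
    then show ?thesis using 3 by (simp add: DERIV_def flat_exp_def)
  qed
qed

definition bump :: "real ^ 'n \<Rightarrow> real ^ 'n \<Rightarrow> real ^ 'n \<Rightarrow> real" where
  "bump a b x = (\<Prod>i\<in>UNIV. flat_exp 1 (x $ i - a $ i) * flat_exp 1 (b $ i - x $ i))"

lemma C_k_bump: "C_k k (bump a b :: real ^ 'n::finite \<Rightarrow> real)"
proof -
  have H: "DERIV (flat_exp ((flat_exp_step ^^ m) 1)) t :> flat_exp ((flat_exp_step ^^ Suc m) 1) t" for m t
    using DERIV_flat_exp by simp
  have "C_k k (\<lambda>x :: real ^ 'n. \<Prod>i\<in>UNIV. flat_exp ((flat_exp_step ^^ 0) 1) (1 * x $ i + - (a $ i)) * flat_exp ((flat_exp_step ^^ 0) 1) ((-1) * x $ i + b $ i))"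
    by (intro C_k_prod C_k_mult finite) (rule C_k_coordinate[of "\<lambda>m. flat_exp ((flat_exp_step ^^ m) 1)", OF H])+
  then show ?thesis by (simp add: bump_def[abs_def])
qed

lemma flat_exp_nonneg: "0 \<le> flat_exp 1 t" by (simp add: flat_exp_def)

lemma bump_nonneg: "0 \<le> bump a b x"
  unfolding bump_def by (intro prod_nonneg mult_nonneg_nonneg ballI flat_exp_nonneg)

lemma bump_pos: "x \<in> box a b \<Longrightarrow> 0 < bump a b x" for x :: "real ^ 'n::finite"
  unfolding bump_def mem_box_cart by (intro prod_pos) (auto simp: flat_exp_def)

lemma bump_zero: "x \<notin> box a b \<Longrightarrow> bump a b x = 0" for x :: "real ^ 'n::finite"
proof -
  assume "x \<notin> box a b"
  then obtain i where "\<not> (a $ i < x $ i \<and> x $ i < b $ i)" unfolding mem_box_cart by blast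
  then have "flat_exp 1 (x $ i - a $ i) * flat_exp 1 (b $ i - x $ i) = 0" by (auto simp: flat_exp_def)
  then show ?thesis unfolding bump_def by (intro prod_zero) auto
qed

lemma test_functionsI:
  assumes "\<And>k. C_k k \<phi>" "\<And>x. x \<notin> K \<Longrightarrow> \<phi> x = 0" "bounded K"
  shows "\<phi> \<in> test_functions"
proof -
  have "bounded {x. \<phi> x \<noteq> 0}" by (rule bounded_subset[OF assms(3)]) (use assms(2) in auto)
  then show ?thesis using assms(1) by (simp add: test_functions_def compact_closure)
qed

lemma bump_reflect:
  fixes x y :: "real ^ 'n::finite"
  shows "bump (- a) a (x - y) = bump (x - a) (x + a) y"
  unfolding bump_def by (intro prod.cong refl) (simp add: algebra_simps)

section \<open>Continuity of translations in the mean\<close>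

lemma eventually_norm_le_of_nat: "\<forall>\<^sub>F k in sequentially. norm x \<le> real k"
proof -
  obtain m :: nat where m: "norm x \<le> real m" using real_arch_simple by blast
  from eventually_ge_at_top[of m] show ?thesis
    by eventually_elim (use m in \<open>simp add: order.trans\<close>)
qed

lemma nn_integral_lborel_translate:
  fixes f :: "'a::euclidean_space \<Rightarrow> ennreal"
  assumes [measurable]: "f \<in> borel_measurable borel"
  shows "(\<integral>\<^sup>+x. f (x - z) \<partial>lborel) = (\<integral>\<^sup>+x. f x \<partial>lborel)"
proof -
  have "(\<integral>\<^sup>+x. f (- z + x) \<partial>lborel) = (\<integral>\<^sup>+x. f x \<partial>distr lborel borel ((+) (- z)))"
    by (subst nn_integral_distr) auto
  then show ?thesis by (simp add: lborel_distr_plus)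
qed

lemma nn_integral_lborel_reflect:
  fixes f :: "'a::euclidean_space \<Rightarrow> ennreal"
  assumes [measurable]: "f \<in> borel_measurable borel"
  shows "(\<integral>\<^sup>+x. f (z - x) \<partial>lborel) = (\<integral>\<^sup>+x. f x \<partial>lborel)"
proof -
  have "(\<integral>\<^sup>+x. f x \<partial>lborel) = (\<integral>\<^sup>+x. f x \<partial>density (distr lborel borel (\<lambda>x. z + (-1) *\<^sub>R x)) (\<lambda>_. ennreal (\<bar>-1\<bar> ^ DIM('a))))"
    by (subst lborel_affine[of "-1" z]) simp_all
  also have "\<dots> = (\<integral>\<^sup>+x. f (z + (-1) *\<^sub>R x) \<partial>lborel)"
    by (subst nn_integral_density) (auto simp: nn_integral_distr)
  finally show ?thesis by simp
qed

definition translation_defect :: "('a::euclidean_space \<Rightarrow> real) \<Rightarrow> 'a \<Rightarrow> ennreal" where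
  "translation_defect f z = (\<integral>\<^sup>+x. ennreal \<bar>f (x - z) - f x\<bar> \<partial>lborel)"

lemma translation_defect_le:
  fixes f h :: "'a::euclidean_space \<Rightarrow> real"
  assumes [measurable]: "f \<in> borel_measurable borel" "h \<in> borel_measurable borel"
  shows "translation_defect f z \<le> translation_defect h z + 2 * (\<integral>\<^sup>+x. ennreal \<bar>f x - h x\<bar> \<partial>lborel)"
proof -
  let ?D = "\<lambda>x. ennreal \<bar>f x - h x\<bar>"
  have "translation_defect f z \<le> (\<integral>\<^sup>+x. ennreal \<bar>h (x - z) - h x\<bar> + (?D (x - z) + ?D x) \<partial>lborel)"
    unfolding translation_defect_def
    by (intro nn_integral_mono) (simp add: ennreal_plus[symmetric] del: ennreal_plus)
  also have "\<dots> = translation_defect h z + ((\<integral>\<^sup>+x. ?D (x - z) \<partial>lborel) + (\<integral>\<^sup>+x. ?D x \<partial>lborel))"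
    unfolding translation_defect_def by (simp add: nn_integral_add)
  also have "(\<integral>\<^sup>+x. ?D (x - z) \<partial>lborel) = (\<integral>\<^sup>+x. ?D x \<partial>lborel)"
    by (rule nn_integral_lborel_translate) measurable
  finally show ?thesis by (simp add: mult_2)
qed

lemma ennreal_tendsto_0_approx:
  fixes a :: "nat \<Rightarrow> ennreal"
  assumes "\<And>e. 0 < e \<Longrightarrow> \<exists>b. b \<longlonglongrightarrow> 0 \<and> (\<forall>k. a k \<le> b k + ennreal e)"
  shows "a \<longlonglongrightarrow> 0"
proof (rule order_tendstoI)
  fix c :: ennreal assume "0 < c"
  then obtain e where e: "0 < e" "ennreal e < c" by (metis ennreal_less_zero_iff ennreal_cases dense not_gr_zero zero_less_iff_neq_zero order.strict_trans top.not_eq_extremum infinity_ennreal_def less_top)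
  obtain b where b: "b \<longlonglongrightarrow> 0" "\<And>k. a k \<le> b k + ennreal (e / 2)" using assms[of "e / 2"] e by auto
  have "\<forall>\<^sub>F k in sequentially. b k < ennreal (e / 2)" using b(1) e by (intro order_tendstoD) auto
  then show "\<forall>\<^sub>F k in sequentially. a k < c"
  proof eventually_elim
    case (elim k)
    have "a k \<le> ennreal (e / 2) + ennreal (e / 2)" using b(2)[of k] elim by (meson add_right_mono less_imp_le order.trans)
    also have "\<dots> = ennreal e" using e by (simp add: ennreal_plus[symmetric] del: ennreal_plus)
    finally show ?case using e by simp
  qed
qed simp

text \<open>A point of an open set stays in it under small translations, so \<open>A\<close> minus its translate shrinks to a
null set by dominated convergence; the translate minus \<open>A\<close> has the same measure.\<close>
lemma translation_defect_open:
  fixes A :: "'a::euclidean_space set"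
  assumes A: "open A" "emeasure lborel A < \<infinity>" and Z: "Z \<longlonglongrightarrow> 0"
  shows "(\<lambda>k. translation_defect (indicator A) (Z k)) \<longlonglongrightarrow> 0"
proof -
  have [measurable]: "A \<in> sets borel" using A by simp
  define B where "B k = {x. x - Z k \<in> A}" for k :: nat
  have [measurable]: "B k \<in> sets borel" for k unfolding B_def by measurable
  have eB: "emeasure lborel (B k) = emeasure lborel A" for k
  proof -
    have "emeasure lborel (B k) = (\<integral>\<^sup>+x. indicator A (x - Z k) \<partial>lborel)"
      by (simp add: nn_integral_indicator[symmetric] B_def indicator_def del: nn_integral_indicator)
    also have "\<dots> = emeasure lborel A" by (subst nn_integral_lborel_translate) auto
    finally show ?thesis .
  qed
  have dec: "emeasure lborel (B k - A) = emeasure lborel (A - B k)" for k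
  proof -
    have "emeasure lborel (A \<inter> B k) + emeasure lborel (B k - A) = emeasure lborel (A \<inter> B k \<union> (B k - A))"
      by (rule plus_emeasure) auto
    also have "A \<inter> B k \<union> (B k - A) = B k" by auto
    also have "emeasure lborel (B k) = emeasure lborel (A \<inter> B k \<union> (A - B k))"
      unfolding eB by (rule arg_cong[where f = "emeasure lborel"]) auto
    also have "\<dots> = emeasure lborel (A \<inter> B k) + emeasure lborel (A - B k)"
      by (rule plus_emeasure[symmetric]) auto
    finally have "emeasure lborel (A \<inter> B k) = \<infinity> \<or> emeasure lborel (B k - A) = emeasure lborel (A - B k)"
      by (simp add: ennreal_add_left_cancel)
    moreover have "emeasure lborel (A \<inter> B k) \<le> emeasure lborel A" by (rule emeasure_mono) auto
    ultimately show ?thesis using A(2) by auto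
  qed
  have "(\<lambda>k. \<integral>x. indicator (A - B k) x \<partial>lborel) \<longlonglongrightarrow> (\<integral>x. (0::real) \<partial>(lborel :: 'a measure))"
  proof (rule integral_dominated_convergence[where w = "indicator A"])
    show "integrable lborel (indicator A :: 'a \<Rightarrow> real)" using A by (simp add: integrable_indicator_iff)
    show "AE x in lborel. (\<lambda>k. indicator (A - B k) x :: real) \<longlonglongrightarrow> 0"
    proof (rule AE_I2)
      fix x
      have "\<forall>\<^sub>F k in sequentially. (indicator (A - B k) x :: real) = 0"
      proof (cases "x \<in> A")
        case True
        have "(\<lambda>k. x - Z k) \<longlonglongrightarrow> x - 0" by (intro tendsto_intros Z)
        then have "\<forall>\<^sub>F k in sequentially. x - Z k \<in> A" using A(1) True by (auto intro: topological_tendstoD)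
        then show ?thesis by eventually_elim (simp add: B_def)
      qed simp
      then show "(\<lambda>k. indicator (A - B k) x :: real) \<longlonglongrightarrow> 0" by (rule tendsto_eventually)
    qed
  qed (auto simp: indicator_def)
  then have "(\<lambda>k. measure lborel (A - B k)) \<longlonglongrightarrow> 0" by simp
  then have "(\<lambda>k. ennreal (measure lborel (A - B k))) \<longlonglongrightarrow> ennreal 0" by (rule tendsto_ennrealI)
  moreover have "emeasure lborel (A - B k) = ennreal (measure lborel (A - B k))" for k
    using A(2) by (intro emeasure_eq_ennreal_measure) (metis Diff_subset \<open>A \<in> sets borel\<close> emeasure_mono infinity_ennreal_def leD sets_lborel)
  ultimately have lim: "(\<lambda>k. emeasure lborel (A - B k)) \<longlonglongrightarrow> 0" by simp
  have "translation_defect (indicator A) (Z k) = emeasure lborel (A - B k) + emeasure lborel (A - B k)" for k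
  proof -
    have "translation_defect (indicator A) (Z k) = (\<integral>\<^sup>+x. indicator (A - B k) x + indicator (B k - A) x \<partial>lborel)"
      unfolding translation_defect_def by (intro nn_integral_cong) (auto simp: indicator_def B_def)
    also have "\<dots> = emeasure lborel (A - B k) + emeasure lborel (B k - A)"
      by (subst nn_integral_add) auto
    finally show ?thesis by (simp add: dec)
  qed
  then show ?thesis using tendsto_add[OF lim lim] by simp
qed

text \<open>Indicators of measurable sets are approximated by those of open sets, by outer regularity; sums and limits
follow from \<open>translation_defect_le\<close>.\<close>
lemma translation_defect_tendsto_0:
  fixes f :: "'a::euclidean_space \<Rightarrow> real"
  assumes "integrable lborel f" and Z: "Z \<longlonglongrightarrow> 0"
  shows "(\<lambda>k. translation_defect f (Z k)) \<longlonglongrightarrow> 0"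
  using assms(1)
proof (induction f rule: integrable_induct)
  case (base A c)
  then have [measurable]: "A \<in> sets borel" by simp
  show ?case
  proof (rule ennreal_tendsto_0_approx)
    fix e :: real assume e: "0 < e"
    define e' where "e' = e / (2 * (\<bar>c\<bar> + 1))"
    have e': "0 < e'" using e by (simp add: e'_def add_nonneg_pos)
    obtain O' where O: "open O'" "A \<subseteq> O'" "emeasure lborel (O' - A) < ennreal e'"
      using outer_regular_lborel[of A e'] e' base by auto
    have [measurable]: "O' \<in> sets borel" using O by simp
    have "emeasure lborel O' \<le> emeasure lborel (A \<union> (O' - A))" by (rule emeasure_mono) auto
    also have "\<dots> \<le> emeasure lborel A + emeasure lborel (O' - A)" by (rule emeasure_subadditive) auto
    also have "\<dots> < \<infinity>" using base O(3) by (auto intro: less_trans[of _ "ennreal e'"])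
    finally have fin: "emeasure lborel O' < \<infinity>" .
    have sc: "translation_defect (\<lambda>x. indicator O' x *\<^sub>R c) z = ennreal \<bar>c\<bar> * translation_defect (indicator O') z" for z
    proof -
      have "translation_defect (\<lambda>x. indicator O' x *\<^sub>R c) z = (\<integral>\<^sup>+x. ennreal \<bar>c\<bar> * ennreal \<bar>indicator O' (x - z) - indicator O' x\<bar> \<partial>lborel)"
        unfolding translation_defect_def
        by (intro nn_integral_cong) (simp add: ennreal_mult'[symmetric] abs_mult[symmetric] algebra_simps)
      then show ?thesis unfolding translation_defect_def by (simp add: nn_integral_cmult)
    qed
    have l: "(\<lambda>k. ennreal \<bar>c\<bar> * translation_defect (indicator O') (Z k)) \<longlonglongrightarrow> ennreal \<bar>c\<bar> * 0"
      by (intro ennreal_tendsto_cmult translation_defect_open O fin Z) simp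
    have diff: "(\<integral>\<^sup>+x. ennreal \<bar>indicator A x *\<^sub>R c - indicator O' x *\<^sub>R c\<bar> \<partial>lborel) = ennreal \<bar>c\<bar> * emeasure lborel (O' - A)"
    proof -
      have "(\<integral>\<^sup>+x. ennreal \<bar>indicator A x *\<^sub>R c - indicator O' x *\<^sub>R c\<bar> \<partial>lborel) = (\<integral>\<^sup>+x. ennreal \<bar>c\<bar> * indicator (O' - A) x \<partial>lborel)"
        using O(2) by (intro nn_integral_cong) (auto simp: indicator_def)
      then show ?thesis by (simp add: nn_integral_cmult)
    qed
    have "2 * (ennreal \<bar>c\<bar> * emeasure lborel (O' - A)) \<le> 2 * (ennreal \<bar>c\<bar> * ennreal e')"
      using O(3) by (intro mult_left_mono) auto
    also have "\<dots> = ennreal (2 * (\<bar>c\<bar> * e'))" using e' by (simp add: ennreal_mult)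
    also have "\<dots> \<le> ennreal e"
    proof (rule ennreal_leI)
      have "2 * (\<bar>c\<bar> * e') = e * (\<bar>c\<bar> / (\<bar>c\<bar> + 1))" unfolding e'_def by (simp add: field_simps)
      also have "\<dots> \<le> e * 1" using e by (intro mult_left_mono) auto
      finally show "2 * (\<bar>c\<bar> * e') \<le> e" by simp
    qed
    finally have small: "2 * (ennreal \<bar>c\<bar> * emeasure lborel (O' - A)) \<le> ennreal e" .
    show "\<exists>b. b \<longlonglongrightarrow> 0 \<and> (\<forall>k. translation_defect (\<lambda>x. indicator A x *\<^sub>R c) (Z k) \<le> b k + ennreal e)"
    proof (intro exI conjI allI)
      show "(\<lambda>k. ennreal \<bar>c\<bar> * translation_defect (indicator O') (Z k)) \<longlonglongrightarrow> 0" using l by simp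
      fix k
      have "translation_defect (\<lambda>x. indicator A x *\<^sub>R c) (Z k)
         \<le> translation_defect (\<lambda>x. indicator O' x *\<^sub>R c) (Z k) + 2 * (\<integral>\<^sup>+x. ennreal \<bar>indicator A x *\<^sub>R c - indicator O' x *\<^sub>R c\<bar> \<partial>lborel)"
        by (rule translation_defect_le) measurable
      also have "\<dots> \<le> ennreal \<bar>c\<bar> * translation_defect (indicator O') (Z k) + ennreal e"
        unfolding sc diff using small by (rule add_left_mono)
      finally show "translation_defect (\<lambda>x. indicator A x *\<^sub>R c) (Z k) \<le> ennreal \<bar>c\<bar> * translation_defect (indicator O') (Z k) + ennreal e" .
    qed
  qed
next
  case (add f g)
  then have [measurable]: "f \<in> borel_measurable borel" "g \<in> borel_measurable borel" by auto
  have le: "translation_defect (\<lambda>x. f x + g x) z \<le> translation_defect f z + translation_defect g z" for z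
  proof -
    have "translation_defect (\<lambda>x. f x + g x) z \<le> (\<integral>\<^sup>+x. ennreal \<bar>f (x - z) - f x\<bar> + ennreal \<bar>g (x - z) - g x\<bar> \<partial>lborel)"
      unfolding translation_defect_def
      by (intro nn_integral_mono) (simp add: ennreal_plus[symmetric] del: ennreal_plus)
    then show ?thesis unfolding translation_defect_def by (simp add: nn_integral_add)
  qed
  have "(\<lambda>k. translation_defect f (Z k) + translation_defect g (Z k)) \<longlonglongrightarrow> 0 + 0"
    using add by (intro tendsto_add) auto
  then have l: "(\<lambda>k. translation_defect f (Z k) + translation_defect g (Z k)) \<longlonglongrightarrow> 0" by simp
  show ?case
  proof (rule tendsto_sandwich[OF _ _ tendsto_const l])
    show "\<forall>\<^sub>F k in sequentially. 0 \<le> translation_defect (\<lambda>x. f x + g x) (Z k)" by simp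
    show "\<forall>\<^sub>F k in sequentially. translation_defect (\<lambda>x. f x + g x) (Z k) \<le> translation_defect f (Z k) + translation_defect g (Z k)"
      by (simp add: le)
  qed
next
  case (lim f s)
  then have [measurable]: "f \<in> borel_measurable borel" "\<And>i. s i \<in> borel_measurable borel" by auto
  have "(\<lambda>i. (\<integral>\<^sup>+x. ennreal (norm (f x - s i x)) \<partial>lborel)) \<longlonglongrightarrow> 0"
    by (rule nn_integral_dominated_convergence_norm[where w = "\<lambda>x. 2 * norm (f x)"])
       (use lim in \<open>auto simp: integrable_iff_bounded ennreal_mult nn_integral_cmult ennreal_mult_less_top\<close>)
  note conv = this
  show ?case
  proof (rule ennreal_tendsto_0_approx)
    fix e :: real assume e: "0 < e"
    have "\<forall>\<^sub>F i in sequentially. (\<integral>\<^sup>+x. ennreal (norm (f x - s i x)) \<partial>lborel) < ennreal (e / 2)"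
      using conv e by (intro order_tendstoD) auto
    then obtain i where i: "(\<integral>\<^sup>+x. ennreal (norm (f x - s i x)) \<partial>lborel) < ennreal (e / 2)"
      by (auto simp: eventually_sequentially)
    have "2 * (\<integral>\<^sup>+x. ennreal \<bar>f x - s i x\<bar> \<partial>lborel) \<le> 2 * ennreal (e / 2)"
      using i by (intro mult_left_mono) auto
    also have "2 * ennreal (e / 2) = ennreal (2 * (e / 2))" using e by (subst ennreal_mult) auto
    also have "2 * (e / 2) = e" by simp
    finally have small: "2 * (\<integral>\<^sup>+x. ennreal \<bar>f x - s i x\<bar> \<partial>lborel) \<le> ennreal e" .
    show "\<exists>b. b \<longlonglongrightarrow> 0 \<and> (\<forall>k. translation_defect f (Z k) \<le> b k + ennreal e)"
      using lim(5)[of i] translation_defect_le[of f "s i"] small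
      by (intro exI[of _ "\<lambda>k. translation_defect (s i) (Z k)"]) (auto intro: order.trans add_left_mono)
  qed
qed

lemma translation_defect_eps:
  fixes f :: "'a::euclidean_space \<Rightarrow> real"
  assumes f: "integrable lborel f" and e: "0 < e"
  shows "\<exists>d>0. \<forall>z. norm z < d \<longrightarrow> translation_defect f z \<le> e"
proof (rule ccontr)
  assume "\<not> ?thesis"
  then have "\<forall>k::nat. \<exists>z. norm z < 1 / real (Suc k) \<and> e < translation_defect f z"
    by (metis not_le of_nat_0_less_iff zero_less_Suc zero_less_divide_1_iff)
  then obtain Z where Z: "\<And>k. norm (Z k) < 1 / real (Suc k)" "\<And>k. e < translation_defect f (Z k)" by metis
  have "Z \<longlonglongrightarrow> 0"
    by (rule Lim_null_comparison[OF _ lim_1_over_n[THEN LIMSEQ_Suc]])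
       (intro always_eventually allI less_imp_le Z(1))
  from order_tendstoD(2)[OF translation_defect_tendsto_0[OF f this] e]
  obtain k where "translation_defect f (Z k) < e" by (auto simp: eventually_sequentially)
  then show False using Z(2)[of k] by simp
qed

section \<open>Mollification\<close>

definition loc_int :: "('a::euclidean_space \<Rightarrow> 'b::euclidean_space) \<Rightarrow> bool" where
  "loc_int w \<longleftrightarrow> w \<in> borel_measurable borel \<and> (\<forall>R. integrable lborel (\<lambda>x. indicator (cball 0 R) x *\<^sub>R w x))"

definition conv :: "('a::euclidean_space \<Rightarrow> 'b::euclidean_space) \<Rightarrow> ('a \<Rightarrow> real) \<Rightarrow> 'a \<Rightarrow> 'b" where
  "conv k w x = (\<integral>y. w y *\<^sub>R k (x - y) \<partial>lborel)"

lemma loc_int_measurable: "loc_int w \<Longrightarrow> w \<in> borel_measurable borel"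
  by (simp add: loc_int_def)

lemma loc_int_norm: "loc_int w \<Longrightarrow> loc_int (\<lambda>x. norm (w x))"
proof -
  assume w: "loc_int w"
  have "integrable lborel (\<lambda>x. norm (indicator (cball 0 R) x *\<^sub>R w x))" for R
    using w unfolding loc_int_def by (intro integrable_norm) auto
  moreover have "norm (indicator (cball 0 R) x *\<^sub>R w x) = indicator (cball 0 R) x *\<^sub>R norm (w x)" for R x
    by (simp add: indicator_def)
  moreover have "(\<lambda>x. norm (w x)) \<in> borel_measurable borel"
    using loc_int_measurable[OF w] by measurable
  ultimately show ?thesis by (simp add: loc_int_def)
qed

context
  fixes w :: "'a::euclidean_space \<Rightarrow> real" and k :: "'a \<Rightarrow> 'b::euclidean_space" and r :: real
  assumes w: "loc_int w" and k: "continuous_on UNIV k" and k0: "\<And>z. r < norm z \<Longrightarrow> k z = 0" and r: "0 \<le> r"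
begin

lemma integrable_convolution: "integrable lborel (\<lambda>y. w y *\<^sub>R k (x - y))"
proof -
  obtain M where M: "M > 0" "\<And>z. norm (k z) \<le> M" using continuous_zero_outside_ball(2)[OF k k0] by blast
  have [measurable]: "w \<in> borel_measurable borel" "k \<in> borel_measurable borel"
    using loc_int_measurable[OF w] k by (auto intro: borel_measurable_continuous_onI)
  show ?thesis
  proof (rule Bochner_Integration.integrable_bound)
    show "integrable lborel (\<lambda>y. M *\<^sub>R (indicator (cball 0 (norm x + r)) y *\<^sub>R w y))"
      using w unfolding loc_int_def by (intro integrable_scaleR_right) auto
    show "AE y in lborel. norm (w y *\<^sub>R k (x - y)) \<le> norm (M *\<^sub>R (indicator (cball 0 (norm x + r)) y *\<^sub>R w y))"
    proof (rule AE_I2)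
      fix y
      show "norm (w y *\<^sub>R k (x - y)) \<le> norm (M *\<^sub>R (indicator (cball 0 (norm x + r)) y *\<^sub>R w y))"
      proof (cases "norm y \<le> norm x + r")
        case True
        then show ?thesis using mult_left_mono[OF M(2)[of "x - y"], of "\<bar>w y\<bar>"] M(1) by (simp add: mult.commute)
      next
        case False
        then have "r < norm (x - y)" using norm_triangle_sub[of y x] by (simp add: norm_minus_commute)
        then show ?thesis using k0 by simp
      qed
    qed
  qed measurable
qed

text \<open>The common estimate behind continuity and differentiability of a convolution: a change of the kernel
by at most \<open>e\<close>, supported in a fixed ball, changes the value at most by \<open>e\<close> times a local norm of \<open>w\<close>.\<close>
lemma norm_convolution_error_le:
  fixes h :: "'a \<Rightarrow> 'c::euclidean_space" and x :: 'a
  assumes bd: "\<And>y. norm (h y) \<le> \<bar>w y\<bar> * e" "\<And>y. norm x + r + 1 < norm y \<Longrightarrow> h y = 0"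
    and int: "integrable lborel h"
  shows "norm (\<integral>y. h y \<partial>lborel) \<le> e * (\<integral>y. indicator (cball 0 (norm x + r + 1)) y *\<^sub>R \<bar>w y\<bar> \<partial>lborel)"
proof -
  have "norm (\<integral>y. h y \<partial>lborel) \<le> (\<integral>y. norm (h y) \<partial>lborel)" by (rule integral_norm_bound)
  also have "\<dots> \<le> (\<integral>y. e * (indicator (cball 0 (norm x + r + 1)) y *\<^sub>R \<bar>w y\<bar>) \<partial>lborel)"
  proof (rule integral_mono)
    show "integrable lborel (\<lambda>y. e * (indicator (cball 0 (norm x + r + 1)) y *\<^sub>R \<bar>w y\<bar>))"
      using loc_int_norm[OF w] unfolding loc_int_def by (intro integrable_mult_right) auto
    fix y
    show "norm (h y) \<le> e * (indicator (cball 0 (norm x + r + 1)) y *\<^sub>R \<bar>w y\<bar>)"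
      using bd(1)[of y] bd(2)[of y] by (cases "norm y \<le> norm x + r + 1") (auto simp: indicator_def mult.commute)
  qed (use int in auto)
  finally show ?thesis by simp
qed

lemma continuous_conv: "continuous_on UNIV (conv k w)"
proof (subst continuous_on_iff, intro ballI allI impI)
  fix x :: 'a and e :: real assume e: "0 < e"
  define L where "L = (\<integral>y. indicator (cball 0 (norm x + r + 1)) y *\<^sub>R \<bar>w y\<bar> \<partial>lborel)"
  have L: "0 \<le> L" unfolding L_def by (intro Bochner_Integration.integral_nonneg) (simp add: indicator_def)
  define e' where "e' = e / (L + 1)"
  have e': "0 < e'" using e L by (simp add: e'_def add_nonneg_pos)
  obtain d where d: "d > 0" "\<And>x y. dist y x < d \<Longrightarrow> dist (k y) (k x) < e'"
    using continuous_zero_outside_ball(1)[OF k k0] e' unfolding uniformly_continuous_on_def by (metis UNIV_I)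
  show "\<exists>d>0. \<forall>x'\<in>UNIV. dist x' x < d \<longrightarrow> dist (conv k w x') (conv k w x) < e"
  proof (intro exI[of _ "min d 1"] conjI ballI impI)
    fix x' :: 'a assume x': "dist x' x < min d 1"
    have eq: "conv k w x' - conv k w x = (\<integral>y. w y *\<^sub>R k (x' - y) - w y *\<^sub>R k (x - y) \<partial>lborel)"
      unfolding conv_def by (rule Bochner_Integration.integral_diff[symmetric]) (rule integrable_convolution)+
    have "norm (\<integral>y. w y *\<^sub>R k (x' - y) - w y *\<^sub>R k (x - y) \<partial>lborel) \<le> e' * L"
      unfolding L_def
    proof (rule norm_convolution_error_le)
      fix y
      have "norm (k (x' - y) - k (x - y)) \<le> e'"
        using d(2)[of "x' - y" "x - y"] x' by (simp add: dist_norm)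
      then show "norm (w y *\<^sub>R k (x' - y) - w y *\<^sub>R k (x - y)) \<le> \<bar>w y\<bar> * e'"
        by (simp add: scaleR_right_diff_distrib[symmetric] mult_left_mono)
      assume y: "norm x + r + 1 < norm y"
      have "r < norm (x - y)" using y norm_triangle_sub[of y x] by (simp add: norm_minus_commute)
      moreover have "norm y \<le> norm (x - y) + norm x" using norm_triangle_sub[of y x] by (simp add: norm_minus_commute)
      then have "r < norm (x' - y)"
        using y x' norm_triangle_ineq[of "x - x'" "x' - y"] by (simp add: dist_norm norm_minus_commute)
      ultimately show "w y *\<^sub>R k (x' - y) - w y *\<^sub>R k (x - y) = 0" using k0 by simp
    qed (use x' e' in \<open>auto simp: dist_norm intro!: Bochner_Integration.integrable_diff integrable_convolution\<close>)
    also have "\<dots> < e' * (L + 1)" using e' by simp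
    also have "\<dots> = e" using L by (simp add: e'_def)
    finally show "dist (conv k w x') (conv k w x) < e" by (simp add: dist_norm eq)
  qed (use d in auto)
qed

end

lemma GDERIV_conv:
  fixes w :: "'a::euclidean_space \<Rightarrow> real" and k :: "'a \<Rightarrow> real" and Dk :: "'a \<Rightarrow> 'a"
  assumes w: "loc_int w" and k: "\<And>z. GDERIV k z :> Dk z" and cDk: "continuous_on UNIV Dk"
    and k0: "\<And>z. r < norm z \<Longrightarrow> k z = 0" "\<And>z. r < norm z \<Longrightarrow> Dk z = 0" and r: "0 \<le> r"
  shows "GDERIV (conv k w) x :> conv Dk w x"
  unfolding gderiv_def has_derivative_at_alt
proof (intro conjI allI impI)
  show "bounded_linear (\<lambda>h. h \<bullet> conv Dk w x)" by (rule bounded_linear_inner_left)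
  have ck: "continuous_on UNIV k"
    by (rule GDERIV_imp_continuous_on[OF k])
  note ik = integrable_convolution[OF w ck k0(1) r]
  note iDk = integrable_convolution[OF w cDk k0(2) r]
  fix e :: real assume e: "0 < e"
  define L where "L = (\<integral>y. indicator (cball 0 (norm x + r + 1)) y *\<^sub>R \<bar>w y\<bar> \<partial>lborel)"
  have L: "0 \<le> L" unfolding L_def by (intro Bochner_Integration.integral_nonneg) (simp add: indicator_def)
  define e' where "e' = e / (L + 1)"
  have e': "0 < e'" using e L by (simp add: e'_def add_nonneg_pos)
  obtain d where d: "d > 0" "\<And>x y. dist y x < d \<Longrightarrow> dist (Dk y) (Dk x) < e'"
    using continuous_zero_outside_ball(1)[OF cDk k0(2)] e' unfolding uniformly_continuous_on_def by (metis UNIV_I)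
  show "\<exists>d>0. \<forall>x'. norm (x' - x) < d \<longrightarrow> norm (conv k w x' - conv k w x - (x' - x) \<bullet> conv Dk w x) \<le> e * norm (x' - x)"
  proof (intro exI[of _ "min d 1"] conjI allI impI)
    fix x' :: 'a assume x': "norm (x' - x) < min d 1"
    define h where "h y = w y *\<^sub>R k (x' - y) - w y *\<^sub>R k (x - y) - (x' - x) \<bullet> (w y *\<^sub>R Dk (x - y))" for y
    have inth: "integrable lborel h" unfolding h_def
      by (intro Bochner_Integration.integrable_diff ik integrable_inner_right iDk)
    have eq: "conv k w x' - conv k w x - (x' - x) \<bullet> conv Dk w x = (\<integral>y. h y \<partial>lborel)"
      unfolding conv_def h_def
      by (simp only: Bochner_Integration.integral_diff Bochner_Integration.integrable_diff ik iDk integrable_inner_right integral_inner_right)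
    have "norm (\<integral>y. h y \<partial>lborel) \<le> (e' * norm (x' - x)) * L"
      unfolding L_def
    proof (rule norm_convolution_error_le[OF w ck k0(1) r])
      fix y
      have "\<bar>k (x' - y) - k (x - y) - Dk (x - y) \<bullet> (x' - y - (x - y))\<bar> \<le> norm (x' - y - (x - y)) * e'"
      proof (rule GDERIV_linearization_bound[OF k])
        fix t :: real assume t: "0 \<le> t" "t \<le> 1"
        have "norm (t *\<^sub>R (x' - x)) \<le> norm (x' - x)" using t by (simp add: mult_left_le_one_le)
        then have "dist (x - y + t *\<^sub>R (x' - y - (x - y))) (x - y) < d" using x' by (simp add: dist_norm)
        from d(2)[OF this] show "norm (Dk (x - y + t *\<^sub>R (x' - y - (x - y))) - Dk (x - y)) \<le> e'" by (simp add: dist_norm)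
      qed
      then have "\<bar>w y\<bar> * \<bar>k (x' - y) - k (x - y) - Dk (x - y) \<bullet> (x' - x)\<bar> \<le> \<bar>w y\<bar> * (norm (x' - x) * e')"
        by (intro mult_left_mono) auto
      moreover have "h y = w y * (k (x' - y) - k (x - y) - Dk (x - y) \<bullet> (x' - x))"
        unfolding h_def by (simp add: algebra_simps inner_commute)
      ultimately show "norm (h y) \<le> \<bar>w y\<bar> * (e' * norm (x' - x))" by (simp add: abs_mult mult_ac)
      assume y: "norm x + r + 1 < norm y"
      have "r < norm (x - y)" using y norm_triangle_sub[of y x] by (simp add: norm_minus_commute)
      moreover have "norm y \<le> norm (x - y) + norm x" using norm_triangle_sub[of y x] by (simp add: norm_minus_commute)
      then have "r < norm (x' - y)"
        using y x' norm_triangle_ineq[of "x - x'" "x' - y"] by (simp add: norm_minus_commute)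
      ultimately show "h y = 0" using k0 by (simp add: h_def)
    qed (use x' e' inth in auto)
    also have "\<dots> \<le> (e' * norm (x' - x)) * (L + 1)" using e' L by (intro mult_left_mono) auto
    also have "\<dots> = e * norm (x' - x)" using L by (simp add: e'_def)
    finally show "norm (conv k w x' - conv k w x - (x' - x) \<bullet> conv Dk w x) \<le> e * norm (x' - x)" by (simp add: eq)
  qed (use d in auto)
qed

definition is_mollifier :: "real \<Rightarrow> ('a::euclidean_space \<Rightarrow> real) \<Rightarrow> bool" where
  "is_mollifier r k \<longleftrightarrow> 0 \<le> r \<and> continuous_on UNIV k \<and> (\<forall>z. 0 \<le> k z) \<and> (\<forall>z. r < norm z \<longrightarrow> k z = 0) \<and> (\<integral>\<^sup>+z. ennreal (k z) \<partial>lborel) = 1"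

lemma integral_mollifier:
  assumes "is_mollifier r k"
  shows "integrable lborel (\<lambda>y. k (x - y))" "(\<integral>y. k (x - y) \<partial>lborel) = 1"
proof -
  have [measurable]: "k \<in> borel_measurable borel" and k: "\<And>z. 0 \<le> k z" and 1: "(\<integral>\<^sup>+z. ennreal (k z) \<partial>lborel) = 1"
    using assms unfolding is_mollifier_def by (auto intro: borel_measurable_continuous_onI)
  have "(\<integral>\<^sup>+y. ennreal (k (x - y)) \<partial>lborel) = ennreal 1"
    using nn_integral_lborel_reflect[of "\<lambda>z. ennreal (k z)" x] 1 by simp
  then have "has_bochner_integral lborel (\<lambda>y. k (x - y)) 1"
    by (intro has_bochner_integral_nn_integral) (auto simp: k)
  then show "integrable lborel (\<lambda>y. k (x - y))" "(\<integral>y. k (x - y) \<partial>lborel) = 1"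
    by (auto simp: has_bochner_integral_iff)
qed

text \<open>Jensen's inequality for the probability density \<open>k (x - y)\<close>, obtained by integrating the tangent
inequality at the mean, followed by Tonelli's theorem.\<close>
lemma conv_powr_le:
  fixes w :: "'a::euclidean_space \<Rightarrow> real"
  assumes m: "is_mollifier r k" and w: "loc_int w" and w0: "\<And>y. 0 \<le> w y" and s: "1 < s"
  shows "(\<integral>\<^sup>+x. ennreal (conv k w x powr s) \<partial>lborel) \<le> (\<integral>\<^sup>+x. ennreal (w x powr s) \<partial>lborel)"
proof -
  have r: "0 \<le> r" and ck: "continuous_on UNIV k" and k: "\<And>z. 0 \<le> k z" and k0: "\<And>z. r < norm z \<Longrightarrow> k z = 0"
    and 1: "(\<integral>\<^sup>+z. ennreal (k z) \<partial>lborel) = 1"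
    using m unfolding is_mollifier_def by auto
  have [measurable]: "k \<in> borel_measurable borel" "w \<in> borel_measurable borel"
    using ck loc_int_measurable[OF w] by (auto intro: borel_measurable_continuous_onI)
  have "ennreal (conv k w x powr s) \<le> (\<integral>\<^sup>+y. ennreal (k (x - y)) * ennreal (w y powr s) \<partial>lborel)" for x
  proof (cases "\<integral>\<^sup>+y. ennreal (k (x - y)) * ennreal (w y powr s) \<partial>lborel")
    case (real c)
    have bi: "has_bochner_integral lborel (\<lambda>y. k (x - y) * w y powr s) c"
      using real k by (intro has_bochner_integral_nn_integral) (auto simp: ennreal_mult)
    define b where "b = conv k w x"
    have b: "0 \<le> b" unfolding b_def conv_def by (intro Bochner_Integration.integral_nonneg) (simp add: k w0)
    have ic: "integrable lborel (\<lambda>y. w y * k (x - y))"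
      using integrable_convolution[OF w ck k0 r, of x] by simp
    have bc: "(\<integral>y. w y * k (x - y) \<partial>lborel) = b" by (simp add: b_def conv_def)
    have "(\<integral>y. b powr s * k (x - y) - (s * b powr (s - 1) * b) * k (x - y) + (s * b powr (s - 1)) * (w y * k (x - y)) \<partial>lborel) \<le> (\<integral>y. k (x - y) * w y powr s \<partial>lborel)"
    proof (rule integral_mono)
      fix y
      have "k (x - y) * (b powr s + s * b powr (s - 1) * (w y - b)) \<le> k (x - y) * w y powr s"
        by (intro mult_left_mono powr_tangent s w0 b k)
      then show "b powr s * k (x - y) - (s * b powr (s - 1) * b) * k (x - y) + (s * b powr (s - 1)) * (w y * k (x - y)) \<le> k (x - y) * w y powr s"
        by (simp add: algebra_simps)
    qed (use bi ic integral_mollifier[OF m, of x] in \<open>auto simp: has_bochner_integral_iff intro!: integral_lincomb(2)\<close>)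
    also have "\<dots> = c" using bi by (simp add: has_bochner_integral_iff)
    also have "(\<integral>y. b powr s * k (x - y) - (s * b powr (s - 1) * b) * k (x - y) + (s * b powr (s - 1)) * (w y * k (x - y)) \<partial>lborel) = b powr s"
      unfolding integral_lincomb(1)[OF integral_mollifier(1)[OF m] integral_mollifier(1)[OF m] ic] integral_mollifier(2)[OF m] bc by simp
    finally show ?thesis using real by (simp add: b_def)
  qed simp
  then have "(\<integral>\<^sup>+x. ennreal (conv k w x powr s) \<partial>lborel) \<le> (\<integral>\<^sup>+x. \<integral>\<^sup>+y. ennreal (k (x - y)) * ennreal (w y powr s) \<partial>lborel \<partial>lborel)"
    by (intro nn_integral_mono)
  also have "\<dots> = (\<integral>\<^sup>+y. \<integral>\<^sup>+x. ennreal (k (x - y)) * ennreal (w y powr s) \<partial>lborel \<partial>lborel)"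
    by (rule lborel_pair.Fubini'[symmetric]) measurable
  also have "\<dots> = (\<integral>\<^sup>+y. ennreal (w y powr s) \<partial>lborel)"
  proof (rule nn_integral_cong)
    fix y
    have "(\<integral>\<^sup>+x. ennreal (k (x - y)) * ennreal (w y powr s) \<partial>lborel) = (\<integral>\<^sup>+x. ennreal (k (x - y)) \<partial>lborel) * ennreal (w y powr s)"
      by (rule nn_integral_multc) measurable
    also have "(\<integral>\<^sup>+x. ennreal (k (x - y)) \<partial>lborel) = 1"
      using nn_integral_lborel_translate[of "\<lambda>z. ennreal (k z)" y] 1 by simp
    finally show "(\<integral>\<^sup>+x. ennreal (k (x - y)) * ennreal (w y powr s) \<partial>lborel) = ennreal (w y powr s)" by simp
  qed
  finally show ?thesis .
qed

text \<open>The mollification error is an average of translation defects.\<close>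
lemma conv_L1_error:
  fixes h :: "'a::euclidean_space \<Rightarrow> real"
  assumes m: "is_mollifier r k" and h: "integrable lborel h"
    and e: "\<And>z. norm z \<le> r \<Longrightarrow> translation_defect h z \<le> e"
  shows "(\<integral>\<^sup>+x. ennreal \<bar>conv k h x - h x\<bar> \<partial>lborel) \<le> e"
proof -
  have r: "0 \<le> r" and ck: "continuous_on UNIV k" and k: "\<And>z. 0 \<le> k z" and k0: "\<And>z. r < norm z \<Longrightarrow> k z = 0"
    and 1: "(\<integral>\<^sup>+z. ennreal (k z) \<partial>lborel) = 1"
    using m unfolding is_mollifier_def by auto
  have [measurable]: "k \<in> borel_measurable borel" "h \<in> borel_measurable borel"
    using ck h by (auto intro: borel_measurable_continuous_onI)
  have li: "loc_int h" unfolding loc_int_def by (intro conjI allI integrable_mult_indicator h) auto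
  have "ennreal \<bar>conv k h x - h x\<bar> \<le> (\<integral>\<^sup>+z. ennreal \<bar>h (x - z) - h x\<bar> * ennreal (k z) \<partial>lborel)" for x
  proof -
    have ic: "integrable lborel (\<lambda>y. h y * k (x - y))"
      using integrable_convolution[OF li ck k0 r, of x] by simp
    have int: "integrable lborel (\<lambda>y. h y * k (x - y) - h x * k (x - y))"
      using ic integral_mollifier(1)[OF m, of x] by (intro Bochner_Integration.integrable_diff integrable_mult_right)
    have "conv k h x - h x = (\<integral>y. h y * k (x - y) - h x * k (x - y) \<partial>lborel)"
      using ic integral_mollifier[OF m, of x] by (subst Bochner_Integration.integral_diff) (auto simp: conv_def)
    then have "ennreal \<bar>conv k h x - h x\<bar> \<le> (\<integral>\<^sup>+y. ennreal (norm (h y * k (x - y) - h x * k (x - y))) \<partial>lborel)"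
      using integral_norm_bound_ennreal[OF int] by simp
    also have "\<dots> = (\<integral>\<^sup>+y. (\<lambda>z. ennreal \<bar>h (x - z) - h x\<bar> * ennreal (k z)) (x - y) \<partial>lborel)"
      by (intro nn_integral_cong) (simp add: ennreal_mult[symmetric] k abs_mult left_diff_distrib[symmetric])
    also have "\<dots> = (\<integral>\<^sup>+z. ennreal \<bar>h (x - z) - h x\<bar> * ennreal (k z) \<partial>lborel)"
      by (rule nn_integral_lborel_reflect) measurable
    finally show ?thesis .
  qed
  then have "(\<integral>\<^sup>+x. ennreal \<bar>conv k h x - h x\<bar> \<partial>lborel) \<le> (\<integral>\<^sup>+x. \<integral>\<^sup>+z. ennreal \<bar>h (x - z) - h x\<bar> * ennreal (k z) \<partial>lborel \<partial>lborel)"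
    by (intro nn_integral_mono)
  also have "\<dots> = (\<integral>\<^sup>+z. \<integral>\<^sup>+x. ennreal \<bar>h (x - z) - h x\<bar> * ennreal (k z) \<partial>lborel \<partial>lborel)"
    by (rule lborel_pair.Fubini'[symmetric]) measurable
  also have "\<dots> \<le> (\<integral>\<^sup>+z. e * ennreal (k z) \<partial>lborel)"
  proof (rule nn_integral_mono)
    fix z
    have "(\<integral>\<^sup>+x. ennreal \<bar>h (x - z) - h x\<bar> * ennreal (k z) \<partial>lborel) = translation_defect h z * ennreal (k z)"
      unfolding translation_defect_def by (rule nn_integral_multc) measurable
    also have "\<dots> \<le> e * ennreal (k z)"
      using e[of z] k0[of z] by (cases "norm z \<le> r") (auto intro: mult_right_mono)
    finally show "(\<integral>\<^sup>+x. ennreal \<bar>h (x - z) - h x\<bar> * ennreal (k z) \<partial>lborel) \<le> e * ennreal (k z)" .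
  qed
  also have "\<dots> = e" by (simp add: nn_integral_cmult 1)
  finally show ?thesis .
qed

text \<open>On a ball of radius \<open>R\<close> and for kernels of radius below \<open>1\<close> only the values of \<open>w\<close> on the ball of radius
\<open>R + 1\<close> matter, and there \<open>w\<close> is integrable.\<close>
lemma conv_local_L1_error:
  fixes w :: "'a::euclidean_space \<Rightarrow> real"
  assumes w: "loc_int w" and e: "0 < e"
  shows "\<exists>d>0. \<forall>r k. r < d \<longrightarrow> is_mollifier r k \<longrightarrow> (\<integral>\<^sup>+x. ennreal \<bar>indicator (cball 0 R) x * (conv k w x - w x)\<bar> \<partial>lborel) \<le> e"
proof -
  define h where "h x = indicator (cball 0 (R + 1)) x * w x" for x
  have h: "integrable lborel h" using w unfolding loc_int_def h_def by simp
  obtain d where d: "d > 0" "\<And>z. norm z < d \<Longrightarrow> translation_defect h z \<le> e"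
    using translation_defect_eps[OF h e] by blast
  show ?thesis
  proof (intro exI[of _ "min d 1"] conjI allI impI)
    fix r and k :: "'a \<Rightarrow> real" assume r: "r < min d 1" and m: "is_mollifier r k"
    then have k0: "\<And>z. r < norm z \<Longrightarrow> k z = 0" unfolding is_mollifier_def by auto
    have eq: "conv k h x = conv k w x" if "norm x \<le> R" for x
      unfolding conv_def
    proof (rule Bochner_Integration.integral_cong[OF refl])
      fix y
      show "h y *\<^sub>R k (x - y) = w y *\<^sub>R k (x - y)"
      proof (cases "norm y \<le> R + 1")
        case False
        then have "r < norm (x - y)" using that r norm_triangle_sub[of y x] by (simp add: norm_minus_commute)
        then show ?thesis using k0 by simp
      qed (simp add: h_def)
    qed
    have "(\<integral>\<^sup>+x. ennreal \<bar>indicator (cball 0 R) x * (conv k w x - w x)\<bar> \<partial>lborel) \<le> (\<integral>\<^sup>+x. ennreal \<bar>conv k h x - h x\<bar> \<partial>lborel)"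
    proof (rule nn_integral_mono)
      fix x show "ennreal \<bar>indicator (cball 0 R) x * (conv k w x - w x)\<bar> \<le> ennreal \<bar>conv k h x - h x\<bar>"
        using eq[of x] by (cases "norm x \<le> R") (auto simp: h_def indicator_def)
    qed
    also have "\<dots> \<le> e" using d(2) r by (intro conv_L1_error[OF m h]) auto
    finally show "(\<integral>\<^sup>+x. ennreal \<bar>indicator (cball 0 R) x * (conv k w x - w x)\<bar> \<partial>lborel) \<le> e" .
  qed (use d in auto)
qed

section \<open>Weak gradients\<close>

definition cube_bump :: "real \<Rightarrow> real ^ 'n::finite \<Rightarrow> real" where
  "cube_bump d = bump (- (\<chi> i. d)) (\<chi> i. d)"

definition std_moll :: "real \<Rightarrow> real ^ 'n::finite \<Rightarrow> real" where
  "std_moll d z = cube_bump d z * (1 / (\<integral>x. cube_bump d (x :: real ^ 'n) \<partial>lborel))"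

lemma cube_bump_zero:
  fixes z :: "real ^ 'n::finite"
  assumes "real CARD('n) * d < norm z" shows "cube_bump d z = 0"
  unfolding cube_bump_def
proof (rule bump_zero, rule notI)
  assume z: "z \<in> box (- (\<chi> i. d)) (\<chi> i. d)"
  have "norm z \<le> (\<Sum>i\<in>UNIV. \<bar>z $ i\<bar>)" by (rule norm_le_l1_cart)
  also have "\<dots> \<le> (\<Sum>i\<in>(UNIV::'n set). d)"
    using z unfolding mem_box_cart by (intro sum_mono) (auto simp: abs_le_iff less_imp_le minus_le_iff)
  finally show False using assms by simp
qed

lemma cube_bump_nonneg: "0 \<le> cube_bump d z" unfolding cube_bump_def by (rule bump_nonneg)

lemma C_k_cube_bump: "C_k k (cube_bump d)" unfolding cube_bump_def by (rule C_k_bump)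

lemma continuous_on_cube_bump: "continuous_on UNIV (cube_bump d)"
  using C_k_continuous[OF C_k_cube_bump[of 0]] .

lemma integrable_cube_bump: "integrable lborel (cube_bump d :: real ^ 'n::finite \<Rightarrow> real)"
  by (rule integrable_continuous_zero_outside_ball[OF continuous_on_cube_bump cube_bump_zero])

lemma integral_cube_bump_pos:
  assumes d: "0 < d"
  shows "0 < (\<integral>x. cube_bump d (x :: real ^ 'n::finite) \<partial>lborel)"
proof -
  have "(\<integral>x. cube_bump d (x :: real ^ 'n) \<partial>lborel) \<noteq> 0"
  proof
    assume "(\<integral>x. cube_bump d (x :: real ^ 'n) \<partial>lborel) = 0"
    then have "AE x in lborel. cube_bump d (x :: real ^ 'n) = 0"
      by (subst (asm) integral_nonneg_eq_0_iff_AE[OF integrable_cube_bump]) (auto simp: cube_bump_nonneg)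
    then have "AE x in lebesgue. x \<in> {x. cube_bump d (x :: real ^ 'n) = 0}" by (auto intro: AE_completion)
    moreover have "closed {x. cube_bump d (x :: real ^ 'n) = 0}"
      by (intro closed_Collect_eq continuous_on_cube_bump continuous_on_const)
    ultimately have "0 \<in> {x. cube_bump d (x :: real ^ 'n) = 0}" by (rule mem_closed_if_AE_lebesgue[rotated])
    moreover have "0 < cube_bump d (0 :: real ^ 'n)"
      unfolding cube_bump_def by (rule bump_pos) (use d in \<open>simp add: mem_box_cart\<close>)
    ultimately show False by simp
  qed
  moreover have "0 \<le> (\<integral>x. cube_bump d (x :: real ^ 'n) \<partial>lborel)"
    by (intro Bochner_Integration.integral_nonneg cube_bump_nonneg)
  ultimately show ?thesis by simp
qed

lemma C_k_std_moll: "C_k k (std_moll d)"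
  unfolding std_moll_def[abs_def] by (intro C_k_mult C_k_cube_bump C_k_const)

lemma std_moll_zero: "real CARD('n) * d < norm z \<Longrightarrow> std_moll d (z :: real ^ 'n::finite) = 0"
  by (simp add: std_moll_def cube_bump_zero)

lemma is_mollifier_std_moll:
  assumes d: "0 < d"
  shows "is_mollifier (real CARD('n) * d) (std_moll d :: real ^ 'n::finite \<Rightarrow> real)"
  unfolding is_mollifier_def
proof (intro conjI allI impI)
  let ?c = "\<integral>x. cube_bump d (x :: real ^ 'n) \<partial>lborel"
  have c: "0 < ?c" by (rule integral_cube_bump_pos[OF d])
  show "0 \<le> std_moll d z" for z :: "real ^ 'n" unfolding std_moll_def using c by (simp add: cube_bump_nonneg)
  have "(\<integral>\<^sup>+z. ennreal (std_moll d z) \<partial>(lborel :: (real ^ 'n) measure)) = ennreal (\<integral>z. std_moll d z \<partial>(lborel :: (real ^ 'n) measure))"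
    using c unfolding std_moll_def
    by (intro nn_integral_eq_integral integrable_mult_left integrable_cube_bump) (auto simp: cube_bump_nonneg)
  also have "(\<integral>z. std_moll d z \<partial>(lborel :: (real ^ 'n) measure)) = 1"
    using c unfolding std_moll_def integral_mult_left_zero by simp
  finally show "(\<integral>\<^sup>+z. ennreal (std_moll d z) \<partial>(lborel :: (real ^ 'n) measure)) = 1" by simp
  show "continuous_on UNIV (std_moll d :: real ^ 'n \<Rightarrow> real)" using C_k_continuous[OF C_k_std_moll[of 0]] .
qed (use d std_moll_zero in auto)

lemma std_moll_test_function: "(\<lambda>y. std_moll d (x - y)) \<in> test_functions" for x :: "real ^ 'n::finite"
proof (rule test_functionsI)
  have eq: "(\<lambda>y. std_moll d (x - y)) = (\<lambda>y. bump (x - (\<chi> i. d)) (x + (\<chi> i. d)) y * (1 / (\<integral>x. cube_bump d (x :: real ^ 'n) \<partial>lborel)))"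
    by (simp add: std_moll_def cube_bump_def bump_reflect)
  show "C_k k (\<lambda>y. std_moll d (x - y))" for k
    unfolding eq by (intro C_k_mult C_k_bump C_k_const)
  show "bounded (cball x (real CARD('n) * d))" by simp
  show "std_moll d (x - y) = 0" if "y \<notin> cball x (real CARD('n) * d)" for y
    using that by (intro std_moll_zero) (simp add: dist_norm)
qed

lemma test_function_facts:
  assumes "\<phi> \<in> test_functions"
  shows "\<And>x. GDERIV \<phi> x :> (\<chi> i. partial_deriv i \<phi> x)"
    "continuous_on UNIV (\<lambda>x. \<chi> i. partial_deriv i \<phi> (x :: real ^ 'n::finite))" "continuous_on UNIV \<phi>"
    "\<exists>r\<ge>0. \<forall>x. r < norm x \<longrightarrow> \<phi> x = 0"
proof -
  have C: "C_k k \<phi>" for k using assms by (simp add: test_functions_def)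
  show "GDERIV \<phi> x :> (\<chi> i. partial_deriv i \<phi> x)" for x using C_k_SucD(1)[OF C[of "Suc 0"]] .
  have "continuous_on UNIV (partial_deriv i \<phi>)" for i using C[of "Suc 0"] by simp
  then show "continuous_on UNIV (\<lambda>x. \<chi> i. partial_deriv i \<phi> x)" by (intro continuous_on_vec_lambda)
  show "continuous_on UNIV \<phi>" using C[of 0] by simp
  have "bounded (closure {x. \<phi> x \<noteq> 0})" using assms by (auto simp: test_functions_def compact_imp_bounded)
  then obtain r where "r > 0" "\<And>x. x \<in> closure {x. \<phi> x \<noteq> 0} \<Longrightarrow> norm x \<le> r" unfolding bounded_pos by blast
  moreover have "{x. \<phi> x \<noteq> 0} \<subseteq> closure {x. \<phi> x \<noteq> 0}" by (rule closure_subset)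
  ultimately show "\<exists>r\<ge>0. \<forall>x. r < norm x \<longrightarrow> \<phi> x = 0" by (intro exI[of _ r]) force
qed

lemma loc_int_component: "loc_int G \<Longrightarrow> loc_int (\<lambda>x. G x $ i)" for G :: "'a::euclidean_space \<Rightarrow> real ^ 'n::finite"
proof -
  assume G: "loc_int G"
  have [measurable]: "G \<in> borel_measurable borel" by (rule loc_int_measurable[OF G])
  have [measurable]: "(\<lambda>x::real^'n. x $ i) \<in> borel_measurable borel"
    by (intro borel_measurable_continuous_onI continuous_intros)
  have "integrable lborel (\<lambda>x. (indicator (cball 0 R) x *\<^sub>R G x) \<bullet> axis i 1)" for R
    using G unfolding loc_int_def by (intro integrable_inner_left) auto
  then show ?thesis by (simp add: loc_int_def inner_axis)
qed

lemma integrable_times_test_function: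
  fixes w :: "'a::euclidean_space \<Rightarrow> real"
  assumes w: "loc_int w" and c: "continuous_on UNIV \<phi>" and z: "\<And>x. r < norm x \<Longrightarrow> \<phi> x = 0" and r: "0 \<le> r"
  shows "integrable lborel (\<lambda>y. w y * \<phi> y)"
proof -
  have "continuous_on UNIV (\<lambda>z. \<phi> (- z))"
    by (rule continuous_on_compose2[OF c]) (auto intro: continuous_intros)
  from integrable_convolution[OF w this _ r, of 0] show ?thesis using z by simp
qed

text \<open>The fundamental lemma of the calculus of variations: translates of the mollifying kernel are test
functions, so the mollified function vanishes identically, while it converges to \<open>w\<close> locally in \<open>L\<^sup>1\<close>.\<close>
lemma AE_zero_if_test_integrals_zero:
  fixes w :: "real ^ 'n::finite \<Rightarrow> real"
  assumes w: "loc_int w" and z: "\<And>\<phi>. \<phi> \<in> test_functions \<Longrightarrow> (\<integral>y. w y * \<phi> y \<partial>lborel) = 0"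
  shows "AE x in lborel. w x = 0"
proof -
  have [measurable]: "w \<in> borel_measurable borel" by (rule loc_int_measurable[OF w])
  have "AE x in lborel. indicator (cball 0 R) x * w x = 0" for R
  proof -
    have bd: "(\<integral>\<^sup>+x. ennreal \<bar>indicator (cball 0 R) x * w x\<bar> \<partial>lborel) \<le> 0 + ennreal e" if e: "0 < e" for e
    proof -
      obtain d where d: "d > 0" "\<And>r k. r < d \<Longrightarrow> is_mollifier r k \<Longrightarrow> (\<integral>\<^sup>+x. ennreal \<bar>indicator (cball 0 R) x * (conv k w x - w x)\<bar> \<partial>lborel) \<le> ennreal e"
        using conv_local_L1_error[OF w, of "ennreal e" R] e by auto
      define t where "t = d / (2 * real CARD('n))"
      have n0: "0 < real CARD('n)" by simp
      have t: "0 < t" using d n0 by (simp add: t_def)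
      have "real CARD('n) * t = d / 2" using n0 by (simp add: t_def)
      then have "(\<integral>\<^sup>+x. ennreal \<bar>indicator (cball 0 R) x * (conv (std_moll t) w x - w x)\<bar> \<partial>lborel) \<le> ennreal e"
        using d(1) is_mollifier_std_moll[OF t, where ?'n = 'n] by (intro d(2)) auto
      moreover have "conv (std_moll t) w x = 0" for x
        unfolding conv_def using z[OF std_moll_test_function[of t x]] by simp
      ultimately show ?thesis by (simp add: abs_mult)
    qed
    have "(\<integral>\<^sup>+x. ennreal \<bar>indicator (cball 0 R) x * w x\<bar> \<partial>lborel) \<le> 0"
      by (rule ennreal_le_epsilon) (rule bd)
    then have "(\<integral>\<^sup>+x. ennreal \<bar>indicator (cball 0 R) x * w x\<bar> \<partial>lborel) = 0" by simp
    moreover have m: "(\<lambda>x. ennreal \<bar>indicator (cball 0 R) x * w x\<bar>) \<in> borel_measurable lborel"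
    proof -
      have [measurable]: "cball (0 :: real ^ 'n) R \<in> sets borel" by (simp add: borel_closed)
      show ?thesis by measurable
    qed
    ultimately have "AE x in lborel. ennreal \<bar>indicator (cball 0 R) x * w x\<bar> = 0"
      using nn_integral_0_iff_AE[OF m] by simp
    then show ?thesis by eventually_elim (simp add: ennreal_eq_0_iff)
  qed
  then have "AE x in lborel. \<forall>m::nat. indicator (cball 0 (real m)) x * w x = 0"
    by (subst AE_all_countable) blast
  then show ?thesis
  proof eventually_elim
    case (elim x)
    obtain m :: nat where "norm x \<le> real m" using real_arch_simple by blast
    then show ?case using elim[rule_format, of m] by simp
  qed
qed

text \<open>The same notion for Borel functions and Lebesgue--Borel measure, where Tonelli's theorem and
substitutions are available.\<close>
definition borel_weak_gradient :: "(real ^ 'n::finite \<Rightarrow> real) \<Rightarrow> (real ^ 'n \<Rightarrow> real ^ 'n) \<Rightarrow> bool" where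
  "borel_weak_gradient u G \<longleftrightarrow> loc_int u \<and> loc_int G \<and>
     (\<forall>\<phi>\<in>test_functions. \<forall>i. (\<integral>x. u x * partial_deriv i \<phi> x \<partial>lborel) = - (\<integral>x. G x $ i * \<phi> x \<partial>lborel))"

lemma locally_integrable_measurable:
  assumes "locally_integrable (f :: real ^ 'n::finite \<Rightarrow> 'b::euclidean_space)"
  shows "f \<in> borel_measurable lebesgue"
proof (rule borel_measurable_LIMSEQ_metric)
  show "(\<lambda>x. indicator (cball 0 (real k)) x *\<^sub>R f x) \<in> borel_measurable lebesgue" for k
    using assms unfolding locally_integrable_def set_integrable_def by (intro borel_measurable_integrable) auto
  fix x :: "real ^ 'n"
  have "\<forall>\<^sub>F k in sequentially. indicator (cball 0 (real k)) x *\<^sub>R f x = f x"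
    using eventually_norm_le_of_nat[of x] by eventually_elim simp
  then show "(\<lambda>k. indicator (cball 0 (real k)) x *\<^sub>R f x) \<longlonglongrightarrow> f x" by (rule tendsto_eventually)
qed

lemma exists_borel_vec_representative:
  fixes g :: "real ^ 'n::finite \<Rightarrow> real ^ 'n"
  assumes "g \<in> borel_measurable lebesgue"
  shows "\<exists>G\<in>borel_measurable borel. AE x in lborel. g x = G x"
proof -
  have "(\<lambda>x. g x \<bullet> axis i 1) \<in> borel_measurable lebesgue" for i
    using assms by (intro borel_measurable_inner) auto
  then have "\<exists>h\<in>borel_measurable lborel. AE x in lborel. g x \<bullet> axis i 1 = h x" for i
    by (rule completion_ex_borel_measurable_real)
  then obtain H where H: "\<And>i. H i \<in> borel_measurable lborel" "\<And>i. AE x in lborel. g x \<bullet> axis i 1 = H i x" by metis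
  have "(\<lambda>x. \<chi> i. H i x) \<in> borel_measurable borel" using H(1) by (intro borel_measurable_vec_lambda) simp
  moreover have "AE x in lborel. \<forall>i\<in>UNIV. g x \<bullet> axis i 1 = H i x" using H(2) by (intro AE_finite_allI) auto
  then have "AE x in lborel. g x = (\<chi> i. H i x)" by eventually_elim (simp add: vec_eq_iff inner_axis)
  ultimately show ?thesis by (intro bexI[of _ "\<lambda>x. \<chi> i. H i x"])
qed

lemma loc_int_if_locally_integrable:
  fixes f F :: "real ^ 'n::finite \<Rightarrow> 'b::euclidean_space"
  assumes f: "locally_integrable f" and [measurable]: "F \<in> borel_measurable borel" and ae: "AE x in lborel. f x = F x"
  shows "loc_int F"
  unfolding loc_int_def
proof (intro conjI allI)
  fix R
  have ae': "AE x in lebesgue. f x = F x" using ae by (rule AE_completion)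
  have i: "integrable lebesgue (\<lambda>x. indicator (cball 0 R) x *\<^sub>R f x)"
    using f unfolding locally_integrable_def set_integrable_def by auto
  have m: "(\<lambda>x. indicator (cball 0 R) x *\<^sub>R F x) \<in> borel_measurable lborel"
    by (intro borel_measurable_scaleR borel_measurable_indicator) (use assms(2) in auto)
  have "integrable lebesgue (\<lambda>x. indicator (cball 0 R) x *\<^sub>R F x)"
    by (rule integrable_cong_AE_imp[OF i measurable_completion[OF m]]) (use ae' in \<open>auto elim: eventually_mono\<close>)
  then show "integrable lborel (\<lambda>x. indicator (cball 0 R) x *\<^sub>R F x)"
    using integrable_completion[OF m] by simp
qed measurable

lemma integral_lebesgue_eq_lborel_AE:
  fixes f F :: "'a::euclidean_space \<Rightarrow> real"
  assumes "f \<in> borel_measurable lebesgue" "F \<in> borel_measurable borel" "AE x in lborel. f x = F x"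
  shows "(\<integral>x. f x \<partial>lebesgue) = (\<integral>x. F x \<partial>lborel)" "integrable lebesgue f \<longleftrightarrow> integrable lborel F"
proof -
  have F: "F \<in> borel_measurable lborel" using assms(2) by simp
  have ae: "AE x in lebesgue. f x = F x" using assms(3) by (rule AE_completion)
  have "(\<integral>x. f x \<partial>lebesgue) = (\<integral>x. F x \<partial>lebesgue)"
    by (rule integral_cong_AE[OF assms(1) measurable_completion[OF F] ae])
  then show "(\<integral>x. f x \<partial>lebesgue) = (\<integral>x. F x \<partial>lborel)" using integral_completion[OF F] by simp
  have "integrable lebesgue f \<longleftrightarrow> integrable lebesgue F"
    by (rule integrable_cong_AE[OF assms(1) measurable_completion[OF F] ae])
  then show "integrable lebesgue f \<longleftrightarrow> integrable lborel F" using integrable_completion[OF F] by simp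
qed

lemma borel_measurable_vec_nth [measurable]: "(\<lambda>x::real^'n::finite. x $ i) \<in> borel_measurable borel"
  by (intro borel_measurable_continuous_onI continuous_intros)

lemma exists_borel_weak_gradient:
  fixes u :: "real ^ 'n::finite \<Rightarrow> real"
  assumes wg: "has_weak_gradient u g"
  obtains u' G where "borel_weak_gradient u' G" "AE x in lborel. u x = u' x" "AE x in lborel. g x = G x"
proof -
  have lu: "locally_integrable u" and lg: "locally_integrable g"
    and id: "\<And>\<phi> i. \<phi> \<in> test_functions \<Longrightarrow> (\<integral>x. u x * partial_deriv i \<phi> x \<partial>lebesgue) = - (\<integral>x. g x $ i * \<phi> x \<partial>lebesgue)"
    using wg unfolding has_weak_gradient_def by auto
  have um: "u \<in> borel_measurable lebesgue" and gm: "g \<in> borel_measurable lebesgue"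
    by (rule locally_integrable_measurable[OF lu], rule locally_integrable_measurable[OF lg])
  obtain u' where u': "u' \<in> borel_measurable borel" "AE x in lborel. u x = u' x"
    using completion_ex_borel_measurable_real[OF um] by auto
  obtain G where G: "G \<in> borel_measurable borel" "AE x in lborel. g x = G x"
    using exists_borel_vec_representative[OF gm] by auto
  note [measurable] = u'(1) G(1)
  have "(\<integral>x. u' x * partial_deriv i \<phi> x \<partial>lborel) = - (\<integral>x. G x $ i * \<phi> x \<partial>lborel)" if \<phi>: "\<phi> \<in> test_functions" for \<phi> i
  proof -
    have "continuous_on UNIV (\<lambda>x. (\<chi> i. partial_deriv i \<phi> x) $ i)"
      by (intro continuous_on_component test_function_facts(2)[OF \<phi>])
    then have p[measurable]: "partial_deriv i \<phi> \<in> borel_measurable borel"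
      by (intro borel_measurable_continuous_onI) simp
    have f[measurable]: "\<phi> \<in> borel_measurable borel"
      by (intro borel_measurable_continuous_onI test_function_facts(3)[OF \<phi>])
    have pl: "partial_deriv i \<phi> \<in> borel_measurable lebesgue" "\<phi> \<in> borel_measurable lebesgue"
      using p f by (auto intro: measurable_completion)
    have gi: "(\<lambda>x. g x $ i) \<in> borel_measurable lebesgue"
      by (rule measurable_compose[OF gm borel_measurable_vec_nth])
    have "(\<integral>x. u x * partial_deriv i \<phi> x \<partial>lebesgue) = (\<integral>x. u' x * partial_deriv i \<phi> x \<partial>lborel)"
      by (rule integral_lebesgue_eq_lborel_AE(1)) (use um pl u'(2) in \<open>auto intro!: borel_measurable_times elim: eventually_mono\<close>)
    moreover have "(\<integral>x. g x $ i * \<phi> x \<partial>lebesgue) = (\<integral>x. G x $ i * \<phi> x \<partial>lborel)"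
      by (rule integral_lebesgue_eq_lborel_AE(1)) (use gi pl G(2) in \<open>auto intro!: borel_measurable_times elim: eventually_mono\<close>)
    ultimately show ?thesis using id[OF \<phi>, of i] by simp
  qed
  moreover have "loc_int u'" by (rule loc_int_if_locally_integrable[OF lu u'])
  moreover have "loc_int G" by (rule loc_int_if_locally_integrable[OF lg G])
  ultimately have "borel_weak_gradient u' G" unfolding borel_weak_gradient_def by blast
  then show ?thesis using u'(2) G(2) by (rule that)
qed

lemma weak_gradient_unique:
  fixes u :: "real ^ 'n::finite \<Rightarrow> real"
  assumes "has_weak_gradient u g" "has_weak_gradient u h"
  shows "AE x in lebesgue. g x = h x"
proof -
  obtain u1 G where G: "borel_weak_gradient u1 G" "AE x in lborel. u x = u1 x" "AE x in lborel. g x = G x"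
    using exists_borel_weak_gradient[OF assms(1)] by blast
  obtain u2 H where H: "borel_weak_gradient u2 H" "AE x in lborel. u x = u2 x" "AE x in lborel. h x = H x"
    using exists_borel_weak_gradient[OF assms(2)] by blast
  have lG: "loc_int (\<lambda>x. G x $ i)" and lH: "loc_int (\<lambda>x. H x $ i)" for i
    using G(1) H(1) unfolding borel_weak_gradient_def by (auto intro: loc_int_component)
  have [measurable]: "u1 \<in> borel_measurable borel" "u2 \<in> borel_measurable borel"
    using G(1) H(1) unfolding borel_weak_gradient_def loc_int_def by auto
  have "AE x in lborel. G x $ i - H x $ i = 0" for i
  proof (rule AE_zero_if_test_integrals_zero)
    have "integrable lborel (\<lambda>x. indicator (cball 0 R) x *\<^sub>R (G x $ i) - indicator (cball 0 R) x *\<^sub>R (H x $ i))" for R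
      using lG[of i] lH[of i] unfolding loc_int_def by (intro Bochner_Integration.integrable_diff) auto
    then show "loc_int (\<lambda>x. G x $ i - H x $ i)"
      using lG[of i] lH[of i] unfolding loc_int_def by (auto simp: scaleR_right_diff_distrib[symmetric] simp del: real_scaleR_def)
    fix \<phi> :: "real ^ 'n \<Rightarrow> real" assume \<phi>: "\<phi> \<in> test_functions"
    obtain r where r: "0 \<le> r" "\<And>x. r < norm x \<Longrightarrow> \<phi> x = 0" using test_function_facts(4)[OF \<phi>] by blast
    have [measurable]: "partial_deriv i \<phi> \<in> borel_measurable borel"
      using continuous_on_component[OF test_function_facts(2)[OF \<phi>], of i] by (intro borel_measurable_continuous_onI) simp
    have "AE x in lborel. u1 x = u2 x" using G(2) H(2) by eventually_elim simp
    then have "(\<integral>x. u1 x * partial_deriv i \<phi> x \<partial>lborel) = (\<integral>x. u2 x * partial_deriv i \<phi> x \<partial>lborel)"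
      by (intro integral_cong_AE) (auto elim: eventually_mono)
    then have "(\<integral>x. G x $ i * \<phi> x \<partial>lborel) = (\<integral>x. H x $ i * \<phi> x \<partial>lborel)"
      using G(1) H(1) \<phi> unfolding borel_weak_gradient_def by force
    moreover note int = integrable_times_test_function[OF lG test_function_facts(3)[OF \<phi>] r(2) r(1), of i]
      integrable_times_test_function[OF lH test_function_facts(3)[OF \<phi>] r(2) r(1), of i]
    ultimately show "(\<integral>x. (G x $ i - H x $ i) * \<phi> x \<partial>lborel) = 0"
      by (simp add: left_diff_distrib)
  qed
  then have "AE x in lborel. \<forall>i\<in>UNIV. G x $ i - H x $ i = 0" by (intro AE_finite_allI) auto
  then have "AE x in lborel. G x = H x" by eventually_elim (simp add: vec_eq_iff)
  then have "AE x in lborel. g x = h x" using G(3) H(3) by eventually_elim simp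
  then show ?thesis by (rule AE_completion)
qed

text \<open>The difference quotients of \<open>\<psi>\<close> have integral zero by translation invariance, and they converge
uniformly to the partial derivative within a fixed ball.\<close>
lemma integral_partial_derivative_zero:
  fixes \<psi> :: "real ^ 'n::finite \<Rightarrow> real"
  assumes \<psi>: "\<And>x. GDERIV \<psi> x :> D x" and c: "continuous_on UNIV D" and z: "\<And>x. R < norm x \<Longrightarrow> \<psi> x = 0"
  shows "(\<integral>x. D x $ i \<partial>lborel) = 0"
proof -
  have D0: "R < norm x \<Longrightarrow> D x = 0" for x by (rule GDERIV_zero_outside_ball[OF \<psi> z])
  have c\<psi>: "continuous_on UNIV \<psi>"
    by (rule GDERIV_imp_continuous_on[OF \<psi>])
  define L where "L = measure lborel (cball (0 :: real ^ 'n) (R + 1))"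
  define I where "I = (\<integral>x. D x $ i \<partial>lborel)"
  have int\<psi>: "integrable lborel \<psi>" by (rule integrable_continuous_zero_outside_ball[OF c\<psi> z])
  have intD: "integrable lborel (\<lambda>x. D x $ i)"
    by (rule integrable_continuous_zero_outside_ball[where R = R]) (use c D0 in \<open>auto intro!: continuous_intros\<close>)
  have "\<bar>I\<bar> \<le> 0 + e" if e: "0 < e" for e
  proof -
    define e' where "e' = e / (L + 1)"
    have L: "0 \<le> L" by (simp add: L_def)
    have e': "0 < e'" using e L by (simp add: e'_def add_nonneg_pos)
    obtain d where d: "d > 0" "\<And>x y. dist y x < d \<Longrightarrow> dist (D y) (D x) < e'"
      using continuous_zero_outside_ball(1)[OF c D0] e' unfolding uniformly_continuous_on_def by (metis UNIV_I)
    define t where "t = min (d / 2) 1"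
    have t: "0 < t" "t < d" "t \<le> 1" using d by (auto simp: t_def min_def)
    define h where "h x = \<psi> (x + t *\<^sub>R axis i 1) - \<psi> x - t * (D x $ i)" for x
    have int1: "integrable lborel (\<lambda>x. \<psi> (x + t *\<^sub>R axis i 1))" and eq1: "(\<integral>x. \<psi> (x + t *\<^sub>R axis i 1) \<partial>lborel) = (\<integral>x. \<psi> x \<partial>lborel)"
    proof -
      have b: "\<psi> \<in> borel_measurable borel" by (intro borel_measurable_continuous_onI c\<psi>)
      have "integrable (distr lborel borel ((+) (t *\<^sub>R axis i 1))) \<psi>" using int\<psi> by (simp add: lborel_distr_plus)
      then show "integrable lborel (\<lambda>x. \<psi> (x + t *\<^sub>R axis i 1))"
        using b by (subst (asm) integrable_distr_eq) (auto simp: add.commute)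
      have "(\<integral>x. \<psi> x \<partial>distr lborel borel ((+) (t *\<^sub>R axis i 1))) = (\<integral>x. \<psi> (t *\<^sub>R axis i 1 + x) \<partial>lborel)"
        using b by (intro integral_distr) auto
      then show "(\<integral>x. \<psi> (x + t *\<^sub>R axis i 1) \<partial>lborel) = (\<integral>x. \<psi> x \<partial>lborel)" by (simp add: lborel_distr_plus add.commute)
    qed
    have inth: "integrable lborel h" unfolding h_def
      by (intro Bochner_Integration.integrable_diff int1 int\<psi> integrable_mult_right intD)
    have Ih: "(\<integral>x. h x \<partial>lborel) = - (t * I)"
      unfolding h_def I_def using int1 int\<psi> intD eq1 by simp
    have hb: "norm (h x) \<le> (t * e') * indicator (cball 0 (R + 1)) x" for x
    proof (cases "norm x \<le> R + 1")
      case True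
      have "\<bar>\<psi> (x + t *\<^sub>R axis i 1) - \<psi> x - D x \<bullet> (x + t *\<^sub>R axis i 1 - x)\<bar> \<le> norm (x + t *\<^sub>R axis i 1 - x) * e'"
      proof (rule GDERIV_linearization_bound[OF \<psi>])
        fix s :: real assume s: "0 \<le> s" "s \<le> 1"
        have "s * t \<le> 1 * t" using s t by (intro mult_right_mono) auto
        then have "s * t < d" using t by linarith
        then have "dist (x + s *\<^sub>R (x + t *\<^sub>R axis i 1 - x)) x < d" using s t by (simp add: dist_norm abs_mult)
        from d(2)[OF this] show "norm (D (x + s *\<^sub>R (x + t *\<^sub>R axis i 1 - x)) - D x) \<le> e'" by (simp add: dist_norm)
      qed
      then show ?thesis using True t by (simp add: h_def inner_axis)
    next
      case False
      have "norm x \<le> norm (x + t *\<^sub>R axis i 1) + t" using norm_triangle_ineq4[of "x + t *\<^sub>R axis i 1" "t *\<^sub>R axis i 1"] t by simp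
      then have "R < norm (x + t *\<^sub>R axis i 1)" using False t by simp
      then show ?thesis using False z D0[of x] by (simp add: h_def)
    qed
    have "t * \<bar>I\<bar> = norm (\<integral>x. h x \<partial>lborel)" unfolding Ih using t by (simp add: abs_mult)
    also have "\<dots> \<le> (\<integral>x. norm (h x) \<partial>lborel)" by (rule integral_norm_bound)
    also have "\<dots> \<le> (\<integral>x. (t * e') * indicator (cball (0 :: real ^ 'n) (R + 1)) x \<partial>lborel)"
    proof (rule integral_mono)
      show "integrable lborel (\<lambda>x. norm (h x))" by (rule integrable_norm[OF inth])
      show "norm (h x) \<le> (t * e') * indicator (cball 0 (R + 1)) x" for x by (rule hb)
      show "integrable lborel (\<lambda>x. (t * e') * indicator (cball (0 :: real ^ 'n) (R + 1)) x)"
        using emeasure_lborel_cball_finite[of "0 :: real ^ 'n" "R + 1"]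
        by (intro integrable_mult_right) (simp add: integrable_indicator_iff)
    qed
    also have "\<dots> = t * (e' * L)" by (simp add: L_def)
    also have "\<dots> \<le> t * e"
    proof -
      have "e' * L \<le> e' * (L + 1)" using e' by simp
      also have "\<dots> = e" using L by (simp add: e'_def)
      finally show ?thesis using t by simp
    qed
    finally show ?thesis using t by simp
  qed
  then have "\<bar>I\<bar> \<le> 0" by (rule field_le_epsilon)
  then show ?thesis by (simp add: I_def)
qed

lemma continuous_locally_integrable:
  fixes f :: "real ^ 'n::finite \<Rightarrow> 'b::euclidean_space"
  assumes f: "continuous_on UNIV f"
  shows "locally_integrable f"
  unfolding locally_integrable_def set_integrable_def
proof (intro allI impI)
  fix K :: "(real ^ 'n) set" assume K: "compact K"
  have i: "integrable lborel (\<lambda>x. indicator K x *\<^sub>R f x)"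
    by (rule borel_integrable_compact[OF K continuous_on_subset[OF f]]) simp
  show "integrable lebesgue (\<lambda>x. indicator K x *\<^sub>R f x)"
    using integrable_completion[OF borel_measurable_integrable[OF i]] i by simp
qed

lemma has_weak_gradient_C1:
  fixes v :: "real ^ 'n::finite \<Rightarrow> real"
  assumes v: "\<And>x. GDERIV v x :> Dv x" and c: "continuous_on UNIV Dv"
  shows "has_weak_gradient v Dv"
  unfolding has_weak_gradient_def
proof (intro conjI ballI allI)
  have cv: "continuous_on UNIV v"
    by (rule GDERIV_imp_continuous_on[OF v])
  show "locally_integrable v" "locally_integrable Dv" by (intro continuous_locally_integrable cv c)+
  fix \<phi> :: "real ^ 'n \<Rightarrow> real" and i assume \<phi>: "\<phi> \<in> test_functions"
  note facts = test_function_facts[OF \<phi>]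
  obtain r where r: "0 \<le> r" "\<And>x. r < norm x \<Longrightarrow> \<phi> x = 0" using facts(4) by blast
  define P where "P x = (\<chi> i. partial_deriv i \<phi> x)" for x
  have P0: "r < norm x \<Longrightarrow> P x = 0" for x
    unfolding P_def by (rule GDERIV_zero_outside_ball[OF facts(1) r(2)])
  have cP: "continuous_on UNIV P" unfolding P_def by (rule facts(2))
  have d: "GDERIV (\<lambda>x. v x * \<phi> x) x :> v x *\<^sub>R P x + \<phi> x *\<^sub>R Dv x" for x
    unfolding P_def by (intro GDERIV_mult v facts(1))
  have "(\<integral>x. (v x *\<^sub>R P x + \<phi> x *\<^sub>R Dv x) $ i \<partial>lborel) = 0"
    by (rule integral_partial_derivative_zero[OF d, where R = r])
       (use cv cP c facts(3) r in \<open>auto intro!: continuous_intros\<close>)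
  moreover have i1: "integrable lborel (\<lambda>x. v x * P x $ i)"
    by (rule integrable_continuous_zero_outside_ball[where R = r]) (use cv cP P0 in \<open>auto intro!: continuous_intros\<close>)
  moreover have i2: "integrable lborel (\<lambda>x. Dv x $ i * \<phi> x)"
    by (rule integrable_continuous_zero_outside_ball[where R = r]) (use c facts(3) r in \<open>auto intro!: continuous_intros\<close>)
  ultimately have "(\<integral>x. v x * P x $ i \<partial>lborel) = - (\<integral>x. Dv x $ i * \<phi> x \<partial>lborel)"
    by (simp add: mult.commute)
  moreover have "(\<integral>x. v x * P x $ i \<partial>lebesgue) = (\<integral>x. v x * P x $ i \<partial>lborel)"
    by (rule integral_completion[OF borel_measurable_integrable[OF i1]])
  moreover have "(\<integral>x. Dv x $ i * \<phi> x \<partial>lebesgue) = (\<integral>x. Dv x $ i * \<phi> x \<partial>lborel)"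
    by (rule integral_completion[OF borel_measurable_integrable[OF i2]])
  ultimately show "(\<integral>x. v x * partial_deriv i \<phi> x \<partial>lebesgue) = - (\<integral>x. Dv x $ i * \<phi> x \<partial>lebesgue)"
    by (simp add: P_def)
qed

section \<open>Mollifying a function with a weak gradient\<close>

lemma GDERIV_reflect:
  fixes k :: "'a::real_inner \<Rightarrow> real"
  assumes "GDERIV k (x - y) :> D"
  shows "GDERIV (\<lambda>y. k (x - y)) y :> - D"
proof -
  have "((\<lambda>y. x - y) has_derivative (\<lambda>h. - h)) (at y)" by (auto intro!: derivative_eq_intros)
  from has_derivative_compose[OF this, of k "\<lambda>h. h \<bullet> D"] assms show ?thesis by (simp add: gderiv_def)
qed

lemma integral_vec_nth:
  fixes f :: "'a \<Rightarrow> real ^ 'n::finite"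
  assumes "integrable M f"
  shows "(\<integral>x. f x \<partial>M) $ i = (\<integral>x. f x $ i \<partial>M)"
  using integral_inner_left[of "axis i 1" M f] assms by (simp add: inner_axis)

context
  fixes u :: "real ^ 'n::finite \<Rightarrow> real" and G :: "real ^ 'n \<Rightarrow> real ^ 'n" and d :: real
  assumes wg: "borel_weak_gradient u G" and d: "0 < d"
begin

definition Dmoll :: "real ^ 'n \<Rightarrow> real ^ 'n" where "Dmoll z = (\<chi> i. partial_deriv i (std_moll d) z)"

lemma std_moll_derivative:
  "GDERIV (std_moll d) z :> Dmoll z" "continuous_on UNIV Dmoll" "real CARD('n) * d < norm z \<Longrightarrow> Dmoll z = 0"
proof -
  have C: "C_k (Suc 0) (std_moll d :: real ^ 'n \<Rightarrow> real)" by (rule C_k_std_moll)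
  show D: "GDERIV (std_moll d) z :> Dmoll z" for z unfolding Dmoll_def by (rule C_k_SucD(1)[OF C])
  have "continuous_on UNIV (partial_deriv i (std_moll d))" for i :: 'n
    using C_k_SucD(2)[OF C, of i] by simp
  then show "continuous_on UNIV Dmoll" unfolding Dmoll_def[abs_def] by (intro continuous_on_vec_lambda)
  show "real CARD('n) * d < norm z \<Longrightarrow> Dmoll z = 0"
    by (rule GDERIV_zero_outside_ball[OF D std_moll_zero])
qed

lemma mollifier: "is_mollifier (real CARD('n) * d) (std_moll d :: real ^ 'n \<Rightarrow> real)"
  by (rule is_mollifier_std_moll[OF d])

lemma support_radius_nonneg: "0 \<le> real CARD('n) * d" using d by simp

lemma loc_int_function: "loc_int u" and loc_int_gradient: "loc_int G" using wg by (auto simp: borel_weak_gradient_def)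

lemma moll_nonneg: "0 \<le> std_moll d (z :: real ^ 'n)" and moll_cont: "continuous_on UNIV (std_moll d :: real ^ 'n \<Rightarrow> real)"
  using mollifier by (auto simp: is_mollifier_def)

lemma GDERIV_mollified: "GDERIV (conv (std_moll d) u) x :> conv Dmoll u x"
  by (rule GDERIV_conv[OF loc_int_function std_moll_derivative(1,2) std_moll_zero std_moll_derivative(3) support_radius_nonneg])

lemma continuous_mollified: "continuous_on UNIV (conv Dmoll u)"
  by (rule continuous_conv[OF loc_int_function std_moll_derivative(2,3) support_radius_nonneg])

text \<open>As a function of \<open>y\<close> the kernel at \<open>x - y\<close> is a test function, so the derivative passes from the kernel to
the weak gradient of \<open>u\<close>.\<close>
lemma norm_mollified_gradient_le: "norm (conv Dmoll u x) \<le> conv (std_moll d) (\<lambda>y. norm (G y)) x"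
proof -
  have [measurable]: "G \<in> borel_measurable borel" "(std_moll d :: real ^ 'n \<Rightarrow> real) \<in> borel_measurable borel"
    by (rule loc_int_measurable[OF loc_int_gradient], rule borel_measurable_continuous_onI[OF moll_cont])
  have iN: "integrable lborel (\<lambda>y. norm (G y) *\<^sub>R std_moll d (x - y))"
    by (rule integrable_convolution[OF loc_int_norm[OF loc_int_gradient] moll_cont std_moll_zero support_radius_nonneg])
  have iV: "integrable lborel (\<lambda>y. std_moll d (x - y) *\<^sub>R G y)"
    by (rule Bochner_Integration.integrable_bound[OF iN]) (auto simp: moll_nonneg mult.commute)
  have iD: "integrable lborel (\<lambda>y. u y *\<^sub>R Dmoll (x - y))"
    by (rule integrable_convolution[OF loc_int_function std_moll_derivative(2,3) support_radius_nonneg])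
  have "conv Dmoll u x = (\<integral>y. std_moll d (x - y) *\<^sub>R G y \<partial>lborel)"
    unfolding vec_eq_iff
  proof
    fix i
    have pd: "partial_deriv i (\<lambda>y. std_moll d (x - y)) y = - (Dmoll (x - y) $ i)" for y
      using partial_deriv_GDERIV[OF GDERIV_reflect[OF std_moll_derivative(1)]] by simp
    have "conv Dmoll u x $ i = (\<integral>y. u y * Dmoll (x - y) $ i \<partial>lborel)"
      unfolding conv_def integral_vec_nth[OF iD] by simp
    also have "\<dots> = (\<integral>y. G y $ i * std_moll d (x - y) \<partial>lborel)"
    proof -
      have "(\<integral>y. u y * partial_deriv i (\<lambda>y. std_moll d (x - y)) y \<partial>lborel) = - (\<integral>y. G y $ i * std_moll d (x - y) \<partial>lborel)"
        using wg std_moll_test_function[of d x] unfolding borel_weak_gradient_def by blast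
      then show ?thesis unfolding pd by simp
    qed
    also have "\<dots> = (\<integral>y. std_moll d (x - y) *\<^sub>R G y \<partial>lborel) $ i"
      unfolding integral_vec_nth[OF iV] by (simp add: mult.commute)
    finally show "conv Dmoll u x $ i = (\<integral>y. std_moll d (x - y) *\<^sub>R G y \<partial>lborel) $ i" .
  qed
  then have "norm (conv Dmoll u x) \<le> (\<integral>y. norm (std_moll d (x - y) *\<^sub>R G y) \<partial>lborel)"
    by (simp only: integral_norm_bound)
  also have "\<dots> = conv (std_moll d) (\<lambda>y. norm (G y)) x"
    unfolding conv_def by (intro Bochner_Integration.integral_cong) (auto simp: moll_nonneg mult.commute)
  finally show ?thesis .
qed

lemma abs_mollified_le: "\<bar>conv (std_moll d) u x\<bar> \<le> conv (std_moll d) (\<lambda>y. \<bar>u y\<bar>) x"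
proof -
  have "norm (conv (std_moll d) u x) \<le> (\<integral>y. norm (u y *\<^sub>R std_moll d (x - y)) \<partial>lborel)"
    unfolding conv_def by (rule integral_norm_bound)
  also have "\<dots> = conv (std_moll d) (\<lambda>y. \<bar>u y\<bar>) x"
    unfolding conv_def by (intro Bochner_Integration.integral_cong) (auto simp: moll_nonneg abs_mult)
  finally show ?thesis by simp
qed

lemma nn_integral_mollified_le:
  assumes s: "1 < s"
  shows "(\<integral>\<^sup>+x. ennreal (\<bar>conv (std_moll d) u x\<bar> powr s) \<partial>lborel) \<le> (\<integral>\<^sup>+x. ennreal (\<bar>u x\<bar> powr s) \<partial>lborel)"
    "(\<integral>\<^sup>+x. ennreal (norm (conv Dmoll u x) powr s) \<partial>lborel) \<le> (\<integral>\<^sup>+x. ennreal (norm (G x) powr s) \<partial>lborel)"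
proof -
  have "(\<integral>\<^sup>+x. ennreal (\<bar>conv (std_moll d) u x\<bar> powr s) \<partial>lborel) \<le> (\<integral>\<^sup>+x. ennreal (conv (std_moll d) (\<lambda>y. \<bar>u y\<bar>) x powr s) \<partial>lborel)"
    using s by (intro nn_integral_mono ennreal_leI powr_mono2 abs_mollified_le) auto
  also have "\<dots> \<le> (\<integral>\<^sup>+x. ennreal (\<bar>u x\<bar> powr s) \<partial>lborel)"
    using loc_int_norm[OF loc_int_function] by (intro conv_powr_le[OF mollifier _ _ s]) auto
  finally show "(\<integral>\<^sup>+x. ennreal (\<bar>conv (std_moll d) u x\<bar> powr s) \<partial>lborel) \<le> (\<integral>\<^sup>+x. ennreal (\<bar>u x\<bar> powr s) \<partial>lborel)" .
  have "(\<integral>\<^sup>+x. ennreal (norm (conv Dmoll u x) powr s) \<partial>lborel) \<le> (\<integral>\<^sup>+x. ennreal (conv (std_moll d) (\<lambda>y. norm (G y)) x powr s) \<partial>lborel)"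
    using s by (intro nn_integral_mono ennreal_leI powr_mono2 norm_mollified_gradient_le) auto
  also have "\<dots> \<le> (\<integral>\<^sup>+x. ennreal (norm (G x) powr s) \<partial>lborel)"
    by (intro conv_powr_le[OF mollifier loc_int_norm[OF loc_int_gradient] _ s]) auto
  finally show "(\<integral>\<^sup>+x. ennreal (norm (conv Dmoll u x) powr s) \<partial>lborel) \<le> (\<integral>\<^sup>+x. ennreal (norm (G x) powr s) \<partial>lborel)" .
qed

end

lemma nn_integral_le_of_AE_tendsto:
  fixes F :: "nat \<Rightarrow> 'a \<Rightarrow> ennreal"
  assumes [measurable]: "\<And>j. F j \<in> borel_measurable M" and lim: "AE x in M. (\<lambda>j. F j x) \<longlonglongrightarrow> f x"
    and le: "\<And>j. (\<integral>\<^sup>+x. F j x \<partial>M) \<le> Q"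
  shows "(\<integral>\<^sup>+x. f x \<partial>M) \<le> Q"
proof -
  have "(\<integral>\<^sup>+x. f x \<partial>M) = (\<integral>\<^sup>+x. liminf (\<lambda>j. F j x) \<partial>M)"
    using lim by (intro nn_integral_cong_AE) (auto elim!: eventually_mono simp: lim_imp_Liminf)
  also have "\<dots> \<le> liminf (\<lambda>j. \<integral>\<^sup>+x. F j x \<partial>M)" by (rule nn_integral_liminf) measurable
  also have "\<dots> \<le> liminf (\<lambda>j. Q)" by (intro Liminf_mono always_eventually allI le)
  also have "\<dots> = Q" by (simp add: Liminf_const)
  finally show ?thesis .
qed

text \<open>On every ball a sequence of mollifications converges almost everywhere after passing to a
subsequence, and Fatou's lemma transfers the bound; a second application lets the ball grow.\<close>
lemma powr_bound_of_mollified_bound: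
  fixes u :: "real ^ 'n::finite \<Rightarrow> real"
  assumes u: "loc_int u" and s: "1 < s"
    and le: "\<And>d. 0 < d \<Longrightarrow> (\<integral>\<^sup>+x. ennreal (\<bar>conv (std_moll d) u x\<bar> powr s) \<partial>lborel) \<le> Q"
  shows "(\<integral>\<^sup>+x. ennreal (\<bar>u x\<bar> powr s) \<partial>lborel) \<le> Q"
proof -
  have [measurable]: "u \<in> borel_measurable borel" by (rule loc_int_measurable[OF u])
  have ball: "(\<integral>\<^sup>+x. indicator (cball 0 R) x * ennreal (\<bar>u x\<bar> powr s) \<partial>lborel) \<le> Q" for R
  proof -
    have [measurable]: "cball (0 :: real ^ 'n) R \<in> sets borel" by (simp add: borel_closed)
    have ex: "\<exists>d>0. (\<integral>\<^sup>+x. ennreal \<bar>indicator (cball 0 R) x * (conv (std_moll d) u x - u x)\<bar> \<partial>lborel) \<le> ennreal (1 / real (Suc j))" for j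
    proof -
      obtain d where d: "d > 0" "\<And>r k. r < d \<Longrightarrow> is_mollifier r k \<Longrightarrow> (\<integral>\<^sup>+x. ennreal \<bar>indicator (cball 0 R) x * (conv k u x - u x)\<bar> \<partial>lborel) \<le> ennreal (1 / real (Suc j))"
        using conv_local_L1_error[OF u, of "ennreal (1 / real (Suc j))" R] by auto
      define t where "t = d / (2 * real CARD('n))"
      have n0: "0 < real CARD('n)" by simp
      have t: "0 < t" using d n0 by (simp add: t_def)
      have "real CARD('n) * t = d / 2" using n0 by (simp add: t_def)
      then show ?thesis
        using d t is_mollifier_std_moll[OF t, where ?'n = 'n] by (intro exI[of _ t] conjI d(2)) auto
    qed
    have "\<exists>D. \<forall>j. 0 < D j \<and> (\<integral>\<^sup>+x. ennreal \<bar>indicator (cball 0 R) x * (conv (std_moll (D j)) u x - u x)\<bar> \<partial>lborel) \<le> ennreal (1 / real (Suc j))"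
      by (intro choice allI ex)
    then obtain D where D: "\<And>j::nat. 0 < D j" "\<And>j. (\<integral>\<^sup>+x. ennreal \<bar>indicator (cball 0 R) x * (conv (std_moll (D j)) u x - u x)\<bar> \<partial>lborel) \<le> ennreal (1 / real (Suc j))"
      by blast
    define h where "h j x = indicator (cball 0 R) x * (conv (std_moll (D j)) u x - u x)" for j x
    have [measurable]: "conv (std_moll (D j)) u \<in> borel_measurable borel" for j
    proof (rule borel_measurable_continuous_onI)
      have "is_mollifier (real CARD('n) * D j) (std_moll (D j) :: real ^ 'n \<Rightarrow> real)" by (rule is_mollifier_std_moll[OF D(1)])
      then show "continuous_on UNIV (conv (std_moll (D j)) u)"
        unfolding is_mollifier_def by (intro continuous_conv[OF u]) auto
    qed
    have hm[measurable]: "h j \<in> borel_measurable borel" for j unfolding h_def by measurable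
    have inth: "integrable lborel (h j)" for j
      using D(2)[of j] by (intro integrableI_bounded) (auto simp: h_def intro: le_less_trans)
    have "(\<integral>x. norm (h j x) \<partial>lborel) \<le> 1 / real (Suc j)" for j
      using D(2)[of j] nn_integral_eq_integral[OF integrable_norm[OF inth[of j]]] by (simp add: h_def)
    then have L1: "(\<lambda>j. \<integral>x. norm (h j x) \<partial>lborel) \<longlonglongrightarrow> 0"
      by (intro Lim_null_comparison[OF _ lim_1_over_n[THEN LIMSEQ_Suc]] always_eventually allI) simp
    obtain r :: "nat \<Rightarrow> nat" where r: "AE x in lborel. (\<lambda>j. h (r j) x) \<longlonglongrightarrow> 0"
      using tendsto_L1_AE_subseq[of lborel h, OF inth L1] by blast
    show ?thesis
    proof (rule nn_integral_le_of_AE_tendsto)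
      show "(\<lambda>x. indicator (cball 0 R) x * ennreal (\<bar>conv (std_moll (D (r j))) u x\<bar> powr s)) \<in> borel_measurable lborel" for j
        by measurable
      show "AE x in lborel. (\<lambda>j. indicator (cball 0 R) x * ennreal (\<bar>conv (std_moll (D (r j))) u x\<bar> powr s)) \<longlonglongrightarrow> indicator (cball 0 R) x * ennreal (\<bar>u x\<bar> powr s)"
        using r
      proof eventually_elim
        case (elim x)
        show ?case
        proof (cases "norm x \<le> R")
          case True
          then have "(\<lambda>j. conv (std_moll (D (r j))) u x - u x) \<longlonglongrightarrow> 0" using elim by (simp add: h_def)
          then have "(\<lambda>j. conv (std_moll (D (r j))) u x) \<longlonglongrightarrow> u x" by (simp add: LIM_zero_iff)
          then have "(\<lambda>j. \<bar>conv (std_moll (D (r j))) u x\<bar> powr s) \<longlonglongrightarrow> \<bar>u x\<bar> powr s"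
            using s by (intro tendsto_powr' tendsto_rabs tendsto_const) auto
          then show ?thesis using True by (simp add: tendsto_ennrealI)
        qed simp
      qed
      fix j
      have "(\<integral>\<^sup>+x. indicator (cball 0 R) x * ennreal (\<bar>conv (std_moll (D (r j))) u x\<bar> powr s) \<partial>lborel) \<le> (\<integral>\<^sup>+x. ennreal (\<bar>conv (std_moll (D (r j))) u x\<bar> powr s) \<partial>lborel)"
        by (intro nn_integral_mono) (auto simp: indicator_def)
      also have "\<dots> \<le> Q" by (rule le[OF D(1)])
      finally show "(\<integral>\<^sup>+x. indicator (cball 0 R) x * ennreal (\<bar>conv (std_moll (D (r j))) u x\<bar> powr s) \<partial>lborel) \<le> Q" .
    qed
  qed
  show ?thesis
  proof (rule nn_integral_le_of_AE_tendsto[OF _ _ ball])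
    fix j :: nat
    have [measurable]: "cball (0 :: real ^ 'n) (real j) \<in> sets borel" by (simp add: borel_closed)
    show "(\<lambda>x. indicator (cball 0 (real j)) x * ennreal (\<bar>u x\<bar> powr s)) \<in> borel_measurable lborel" by measurable
  next
    show "AE x in lborel. (\<lambda>j. indicator (cball 0 (real j)) x * ennreal (\<bar>u x\<bar> powr s)) \<longlonglongrightarrow> ennreal (\<bar>u x\<bar> powr s)"
    proof (intro AE_I2 tendsto_eventually)
      fix x :: "real ^ 'n"
      show "\<forall>\<^sub>F j in sequentially. indicator (cball 0 (real j)) x * ennreal (\<bar>u x\<bar> powr s) = ennreal (\<bar>u x\<bar> powr s)"
        using eventually_norm_le_of_nat[of x] by eventually_elim simp
    qed
  qed
qed

section \<open>Cutting off at infinity\<close>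

text \<open>A continuously differentiable function that vanishes on the negative half-line.\<close>
definition pos_square :: "real \<Rightarrow> real" where "pos_square t = (max 0 t)\<^sup>2"

lemma DERIV_pos_square: "DERIV pos_square t :> 2 * max 0 t"
proof -
  consider "0 < t" | "t < 0" | "t = 0" by linarith
  then show ?thesis
  proof cases
    case 1
    have "DERIV (\<lambda>t. t\<^sup>2) t :> 2 * t" by (auto intro!: derivative_eq_intros)
    then show ?thesis using 1
      by (subst DERIV_cong_ev[OF refl _ refl, where g = "\<lambda>t. t\<^sup>2"])
         (auto simp: pos_square_def max_def eventually_nhds intro!: exI[of _ "{0<..}"])
  next
    case 2
    then show ?thesis
      by (subst DERIV_cong_ev[OF refl _ refl, where g = "\<lambda>t. 0"])
         (auto simp: pos_square_def max_def eventually_nhds intro!: exI[of _ "{..<0}"])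
  next
    case 3
    have lim: "((\<lambda>h::real. \<bar>h\<bar>) \<longlongrightarrow> 0) (at 0)" by (rule tendsto_rabs_zero[OF tendsto_ident_at])
    have le: "norm (pos_square h / h) \<le> \<bar>h\<bar>" for h :: real
      by (cases "0 < h") (simp_all add: pos_square_def power2_eq_square)
    have "((\<lambda>h::real. pos_square h / h) \<longlongrightarrow> 0) (at 0)"
      by (rule Lim_null_comparison[OF _ lim]) (intro always_eventually allI le)
    moreover have "pos_square 0 = 0" by (simp add: pos_square_def)
    ultimately show ?thesis using 3 by (simp add: DERIV_def)
  qed
qed

definition cutoff_arg :: "real \<Rightarrow> 'a::real_inner \<Rightarrow> real" where
  "cutoff_arg R x = (x \<bullet> x / R\<^sup>2 - 1) / 3"

text \<open>For \<open>R > 0\<close>, equal to \<open>1\<close> for \<open>|x| \<le> R\<close> and to \<open>0\<close> for \<open>|x| \<ge> 2 R\<close>.\<close>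
definition cutoff :: "real \<Rightarrow> 'a::real_inner \<Rightarrow> real" where
  "cutoff R x = pos_square (1 - pos_square (cutoff_arg R x))"

definition cutoff_grad :: "real \<Rightarrow> 'a::real_inner \<Rightarrow> 'a" where
  "cutoff_grad R x = (2 * max 0 (1 - pos_square (cutoff_arg R x)) * (- (2 * max 0 (cutoff_arg R x)))) *\<^sub>R ((2 / (3 * R\<^sup>2)) *\<^sub>R x)"

lemma GDERIV_cutoff:
  fixes x :: "'a::real_inner"
  shows "GDERIV (cutoff R) x :> cutoff_grad R x"
proof -
  have "GDERIV (cutoff_arg R) x :> (2 / (3 * R\<^sup>2)) *\<^sub>R x"
  proof -
    have "((\<lambda>x. c * (x \<bullet> x) - 1 / 3) has_derivative (\<lambda>h. h \<bullet> ((2 * c) *\<^sub>R x))) (at x)" for c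
      by (auto intro!: derivative_eq_intros simp: inner_commute)
    note d = this[of "1 / (3 * R\<^sup>2)"]
    have "cutoff_arg R = (\<lambda>x::'a. 1 / (3 * R\<^sup>2) * (x \<bullet> x) - 1 / 3)"
      by (simp add: fun_eq_iff cutoff_arg_def diff_divide_distrib mult.commute)
    moreover have "2 * (1 / (3 * R\<^sup>2)) = 2 / (3 * R\<^sup>2)" by simp
    ultimately show ?thesis using d unfolding gderiv_def by (simp only:)
  qed
  moreover have "DERIV (\<lambda>t. pos_square (1 - pos_square t)) t :> 2 * max 0 (1 - pos_square t) * (- (2 * max 0 t))" for t
    by (rule DERIV_chain2[OF DERIV_pos_square]) (auto intro!: derivative_eq_intros DERIV_pos_square)
  ultimately show ?thesis unfolding cutoff_def cutoff_grad_def by (rule GDERIV_DERIV_compose)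
qed

lemma continuous_on_cutoff_grad: "continuous_on UNIV (cutoff_grad R :: 'a::real_inner \<Rightarrow> 'a)"
proof -
  have "continuous_on UNIV pos_square" unfolding pos_square_def[abs_def] by (intro continuous_intros)
  then show ?thesis
    unfolding cutoff_grad_def[abs_def] cutoff_arg_def
    by (cases "R = 0") (auto intro!: continuous_intros continuous_on_compose2[of UNIV pos_square])
qed

lemma cutoff_bounds: "0 \<le> cutoff R x" "cutoff R x \<le> 1"
proof -
  show "0 \<le> cutoff R x" by (simp add: cutoff_def pos_square_def)
  have "0 \<le> pos_square (cutoff_arg R x)" by (simp add: pos_square_def)
  then show "cutoff R x \<le> 1" unfolding cutoff_def pos_square_def[of "1 - _"] by (intro power_le_one) auto
qed

lemma cutoff_arg_cases:
  fixes x :: "'a::real_inner"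
  assumes R: "0 < R"
  shows "norm x \<le> R \<Longrightarrow> cutoff_arg R x \<le> 0" "2 * R \<le> norm x \<Longrightarrow> 1 \<le> cutoff_arg R x"
proof -
  have eq: "cutoff_arg R x = ((norm x / R)\<^sup>2 - 1) / 3" by (simp add: cutoff_arg_def power2_norm_eq_inner[symmetric] power_divide)
  show "norm x \<le> R \<Longrightarrow> cutoff_arg R x \<le> 0" using R unfolding eq by (simp add: power_le_one)
  assume "2 * R \<le> norm x"
  then have "2 \<le> norm x / R" using R by (simp add: field_simps)
  then have "2\<^sup>2 \<le> (norm x / R)\<^sup>2" by (intro power_mono) auto
  then show "1 \<le> cutoff_arg R x" unfolding eq by simp
qed

lemma cutoff_inside: "0 < R \<Longrightarrow> norm x \<le> R \<Longrightarrow> cutoff R x = 1 \<and> cutoff_grad R x = 0"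
  using cutoff_arg_cases(1)[of R x] by (simp add: cutoff_def cutoff_grad_def pos_square_def)

lemma cutoff_outside: "0 < R \<Longrightarrow> 2 * R \<le> norm x \<Longrightarrow> cutoff R x = 0 \<and> cutoff_grad R x = 0"
proof -
  assume "0 < R" "2 * R \<le> norm x"
  then have "1 \<le> cutoff_arg R x" by (rule cutoff_arg_cases(2))
  then have "1 \<le> pos_square (cutoff_arg R x)" by (simp add: pos_square_def one_le_power)
  then have "max 0 (1 - pos_square (cutoff_arg R x)) = 0" by simp
  then show ?thesis by (simp add: cutoff_def cutoff_grad_def pos_square_def[of "1 - _"])
qed

lemma norm_cutoff_grad:
  fixes x :: "'a::real_inner"
  assumes R: "0 < R"
  shows "norm (cutoff_grad R x) \<le> 6 / R"
proof (cases "2 * R \<le> norm x")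
  case True
  then show ?thesis using cutoff_outside[OF R True] R by simp
next
  case False
  define t where "t = cutoff_arg R x"
  have "max 0 (1 - pos_square t) * max 0 t \<le> 1"
  proof (cases "t \<le> 1")
    case True
    have "0 \<le> pos_square t" by (simp add: pos_square_def)
    then have "max 0 (1 - pos_square t) * max 0 t \<le> 1 * 1" using True by (intro mult_mono) auto
    then show ?thesis by simp
  next
    case False
    then have "1 \<le> pos_square t" by (simp add: pos_square_def one_le_power)
    then show ?thesis by simp
  qed
  then have "4 * (max 0 (1 - pos_square t) * max 0 t) * (2 / (3 * R\<^sup>2) * norm x) \<le> (4 * 1) * (2 / (3 * R\<^sup>2) * (2 * R))"
    using False R by (intro mult_mono) auto
  also have "\<dots> \<le> 6 / R" using R by (simp add: field_simps power2_eq_square)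
  finally have "4 * (max 0 (1 - pos_square t) * max 0 t) * (2 / (3 * R\<^sup>2) * norm x) \<le> 6 / R" .
  moreover have "norm (cutoff_grad R x) = 4 * (max 0 (1 - pos_square t) * max 0 t) * (2 / (3 * R\<^sup>2) * norm x)"
    unfolding cutoff_grad_def t_def[symmetric] by (simp add: abs_mult)
  ultimately show ?thesis by simp
qed

section \<open>The sharp Sobolev inequality for weakly differentiable functions\<close>

context sharp_exponents
begin

lemma sharp_constant_pos: "0 < sharp_constant"
  using theta_pos p_gt_1 p_less_N N_pos profile_mass_pos by (simp add: sharp_constant_def profile_energy_factor_def)

text \<open>The gradient of the cut-off lives on the annulus \<open>k \<le> |x| \<le> 2 k\<close> and is at most \<open>6 / k\<close> there. Young's
inequality with exponents \<open>N / (N - p)\<close> and \<open>N / p\<close> splits \<open>|v|\<^sup>p / k\<^sup>p\<close> into a multiple of \<open>|v|\<close> to the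
power \<open>p*\<close>, whose integral outside the ball of radius \<open>k\<close> tends to \<open>0\<close>, and \<open>c\<close> times a multiple of \<open>k powr (-N)\<close>,
whose integral over the ball of radius \<open>2 k\<close> does not depend on \<open>k\<close>. The weight \<open>c\<close> is chosen small.\<close>
lemma cutoff_gradient_energy_small:
  fixes v :: "real ^ 'n \<Rightarrow> real"
  assumes cv: "continuous_on UNIV v" and iv: "integrable lborel (\<lambda>x. \<bar>v x\<bar> powr ps)" and \<delta>: "0 < \<delta>"
  shows "\<forall>\<^sub>F k in sequentially. integrable lborel (\<lambda>x. (\<bar>v x\<bar> * norm (cutoff_grad (real k) x)) powr p)
     \<and> (\<integral>x. (\<bar>v x\<bar> * norm (cutoff_grad (real k) x)) powr p \<partial>lborel) \<le> \<delta>"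
proof -
  define r r' where "r = N / (N - p)" and "r' = N / p"
  have r: "1 < r" "1 < r'" "1 / r + 1 / r' = 1"
    using p_less_N p_gt_1 N_pos by (auto simp: r_def r'_def field_simps)
  define B where "B = unit_ball_vol N * 2 ^ CARD('n)"
  have B: "0 \<le> B" unfolding B_def using N_pos by (intro mult_nonneg_nonneg unit_ball_vol_nonneg) auto
  \<comment> \<open>With this weight the second part contributes at most \<open>\<delta> / 2\<close>.\<close>
  define c where "c = \<delta> * r' / (2 * 6 powr p * (B + 1))"
  have c: "0 < c" unfolding c_def using \<delta> r B by (intro divide_pos_pos mult_pos_pos) auto
  define Kc where "Kc = c powr (- r / r') / r"
  define tail where "tail k = (\<integral>x. indicator (- cball 0 (real k)) x * \<bar>v x\<bar> powr ps \<partial>lborel)" for k :: nat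
  have [measurable]: "v \<in> borel_measurable borel" by (intro borel_measurable_continuous_onI cv)
  have [measurable]: "cball (0 :: real ^ 'n) R \<in> sets borel" for R by (simp add: borel_closed)
  have [measurable]: "cutoff_grad R \<in> borel_measurable (borel :: (real ^ 'n) measure)" for R
    by (intro borel_measurable_continuous_onI continuous_on_cutoff_grad)
  have itail: "integrable lborel (\<lambda>x. indicator (- cball 0 (real k)) x * \<bar>v x\<bar> powr ps)" for k :: nat
    by (rule Bochner_Integration.integrable_bound[OF iv]) (auto simp: indicator_def)
  have "tail \<longlonglongrightarrow> (\<integral>x. 0 \<partial>(lborel :: (real ^ 'n) measure))"
    unfolding tail_def[abs_def]
  proof (rule integral_dominated_convergence[OF _ _ iv])
    show "AE x in lborel. (\<lambda>k. indicator (- cball 0 (real k)) x * \<bar>v x\<bar> powr ps) \<longlonglongrightarrow> 0"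
    proof (intro AE_I2 tendsto_eventually)
      fix x :: "real ^ 'n"
      show "\<forall>\<^sub>F k in sequentially. indicator (- cball 0 (real k)) x * \<bar>v x\<bar> powr ps = 0"
        using eventually_norm_le_of_nat[of x] by eventually_elim simp
    qed
    show "AE x in lborel. norm (indicator (- cball 0 (real k)) x * \<bar>v x\<bar> powr ps) \<le> \<bar>v x\<bar> powr ps" for k :: nat
      by (intro AE_I2) (auto simp: indicator_def)
  qed auto
  then have "(\<lambda>k. 6 powr p * (Kc * tail k)) \<longlonglongrightarrow> 6 powr p * (Kc * 0)" by (intro tendsto_intros) simp
  from order_tendstoD(2)[OF this, of "\<delta> / 2"]
  have "\<forall>\<^sub>F k in sequentially. 6 powr p * (Kc * tail k) < \<delta> / 2" using \<delta> by simp
  then show ?thesis using eventually_ge_at_top[of 1]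
  proof eventually_elim
    case (elim k)
    define F where "F x = (\<bar>v x\<bar> * norm (cutoff_grad (real k) x)) powr p" for x
    define H where "H x = 6 powr p * (Kc * (indicator (- cball 0 (real k)) x * \<bar>v x\<bar> powr ps) + (c / r' * real k powr - N) * indicator (cball 0 (2 * real k)) x)" for x
    have k: "0 < real k" using elim by simp
    have Kc: "0 \<le> Kc" using r by (simp add: Kc_def)
    have c': "0 \<le> c / r' * real k powr - N" using c r by simp
    have FH: "F x \<le> H x" for x
    proof (cases "norm x \<le> real k \<or> 2 * real k \<le> norm x")
      case True
      then have "cutoff_grad (real k) x = 0" using cutoff_inside[OF k, of x] cutoff_outside[OF k, of x] by blast
      then have "F x = 0" by (simp add: F_def)
      moreover have "0 \<le> Kc * (indicator (- cball 0 (real k)) x * \<bar>v x\<bar> powr ps)"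
        "0 \<le> (c / r' * real k powr - N) * indicator (cball 0 (2 * real k)) x"
        using Kc c' by (auto simp: indicator_def)
      then have "0 \<le> H x" unfolding H_def by (intro mult_nonneg_nonneg[of "6 powr p"] add_nonneg_nonneg) simp_all
      ultimately show ?thesis by simp
    next
      case False
      have "F x \<le> (\<bar>v x\<bar> * (6 / real k)) powr p"
        unfolding F_def using p_gt_1 norm_cutoff_grad[OF k, of x] by (intro powr_mono2 mult_left_mono) auto
      also have "\<dots> = 6 powr p * (\<bar>v x\<bar> powr p * (1 / real k) powr p)"
      proof -
        have "\<bar>v x\<bar> * (6 / real k) = 6 * (\<bar>v x\<bar> * (1 / real k))" by simp
        then show ?thesis by (simp only: powr_mult)
      qed
      also have "\<bar>v x\<bar> powr p * (1 / real k) powr p \<le> c powr (- r / r') * ((\<bar>v x\<bar> powr p) powr r / r) + c * (((1 / real k) powr p) powr r' / r')"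
        by (intro Youngs_inequality_weighted r c) auto
      also have "(\<bar>v x\<bar> powr p) powr r = \<bar>v x\<bar> powr ps"
        using p_less_N by (simp add: powr_powr r_def ps_def mult.commute)
      also have "((1 / real k) powr p) powr r' = real k powr - N"
      proof -
        have "p * r' = N" using p_gt_1 by (simp add: r'_def)
        then show ?thesis using k by (simp add: powr_powr powr_divide powr_minus_divide)
      qed
      also have "6 powr p * (c powr (- r / r') * (\<bar>v x\<bar> powr ps / r) + c * (real k powr - N / r')) = H x"
        using False by (simp add: H_def Kc_def)
      finally show ?thesis by simp
    qed
    have ib: "integrable lborel (\<lambda>x :: real ^ 'n. indicator (cball 0 (2 * real k)) x :: real)"
      using emeasure_lborel_cball_finite[of "0 :: real ^ 'n" "2 * real k"] by (simp add: integrable_indicator_iff)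
    have iH: "integrable lborel H" unfolding H_def
      by (intro integrable_mult_right Bochner_Integration.integrable_add itail ib)
    have [measurable]: "F \<in> borel_measurable borel" unfolding F_def by measurable
    have F0: "0 \<le> F x" for x by (simp add: F_def)
    have iF: "integrable lborel F"
      by (rule Bochner_Integration.integrable_bound[OF iH]) (use FH F0 in \<open>auto intro!: AE_I2 intro: order.trans[OF _ abs_ge_self]\<close>)
    have "(\<integral>x. F x \<partial>lborel) \<le> (\<integral>x. H x \<partial>lborel)" by (intro integral_mono iF iH FH)
    also have "\<dots> = 6 powr p * (Kc * tail k + (c / r' * real k powr - N) * measure lborel (cball (0 :: real ^ 'n) (2 * real k)))"
      unfolding H_def tail_def integral_mult_right_zero
      by (subst Bochner_Integration.integral_add) (use itail[of k] ib in auto)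
    also have "measure lborel (cball (0 :: real ^ 'n) (2 * real k)) = unit_ball_vol N * (2 * real k) ^ CARD('n)"
      using k content_ball[of "2 * real k" "0 :: real ^ 'n"] by (simp add: content_cball_conv_ball N_card)
    also have "(c / r' * real k powr - N) * (unit_ball_vol N * (2 * real k) ^ CARD('n)) = c / r' * B"
    proof -
      have "real k powr - N = 1 / real k ^ CARD('n)" using k by (simp add: powr_minus_divide powr_realpow N_card[symmetric])
      then show ?thesis using k by (simp add: B_def power_mult_distrib)
    qed
    also have "6 powr p * (Kc * tail k + c / r' * B) = 6 powr p * (Kc * tail k) + 6 powr p * (c / r' * B)"
      by (rule distrib_left)
    also have "6 powr p * (c / r' * B) \<le> \<delta> / 2"
    proof -
      have "6 powr p * (c / r' * B) = \<delta> / 2 * (B / (B + 1))" using r B by (simp add: c_def)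
      also have "\<dots> \<le> \<delta> / 2 * 1" using \<delta> B by (intro mult_left_mono) auto
      finally show ?thesis by simp
    qed
    finally have "(\<integral>x. F x \<partial>lborel) \<le> \<delta>" using elim by simp
    then show ?case using iF unfolding F_def by simp
  qed
qed

text \<open>Apply the inequality to \<open>cutoff k * v\<close>. By \<open>powr_add_le\<close> its energy exceeds \<open>(1 - e) powr (1 - p)\<close> times that of \<open>v\<close> by at
most \<open>e\<close> for large \<open>k\<close>; then let \<open>e\<close> tend to zero.\<close>
theorem sharp_sobolev_C1_global:
  fixes v :: "real ^ 'n \<Rightarrow> real"
  assumes v: "\<And>x. GDERIV v x :> Dv x" and cDv: "continuous_on UNIV Dv"
    and iv: "integrable lborel (\<lambda>x. \<bar>v x\<bar> powr ps)" and iDv: "integrable lborel (\<lambda>x. norm (Dv x) powr p)"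
  shows "sharp_constant * (\<integral>x. \<bar>v x\<bar> powr ps \<partial>lborel) powr ((N - p) / N) \<le> (\<integral>x. norm (Dv x) powr p \<partial>lborel)"
proof -
  define E where "E = (\<integral>x. norm (Dv x) powr p \<partial>lborel)"
  define P where "P = (\<integral>x. \<bar>v x\<bar> powr ps \<partial>lborel)"
  have cv: "continuous_on UNIV v"
    by (rule GDERIV_imp_continuous_on[OF v])
  have [measurable]: "v \<in> borel_measurable borel" by (intro borel_measurable_continuous_onI cv)
  have ccut: "continuous_on UNIV (cutoff R :: real ^ 'n \<Rightarrow> real)" for R
    by (rule GDERIV_imp_continuous_on[OF GDERIV_cutoff])
  have [measurable]: "cutoff R \<in> borel_measurable (borel :: (real ^ 'n) measure)" for R
    by (intro borel_measurable_continuous_onI ccut)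
  have lim: "(\<lambda>k. \<integral>x. \<bar>cutoff (real k) x * v x\<bar> powr ps \<partial>lborel) \<longlonglongrightarrow> P"
    unfolding P_def
  proof (rule integral_dominated_convergence[OF _ _ iv])
    show "AE x in lborel. (\<lambda>k. \<bar>cutoff (real k) x * v x\<bar> powr ps) \<longlonglongrightarrow> \<bar>v x\<bar> powr ps"
    proof (intro AE_I2 tendsto_eventually)
      fix x :: "real ^ 'n"
      show "\<forall>\<^sub>F k in sequentially. \<bar>cutoff (real k) x * v x\<bar> powr ps = \<bar>v x\<bar> powr ps"
        using eventually_norm_le_of_nat[of x] eventually_gt_at_top[of 0]
        by eventually_elim (use cutoff_inside[of _ x] in simp)
    qed
    show "AE x in lborel. norm (\<bar>cutoff (real k) x * v x\<bar> powr ps) \<le> \<bar>v x\<bar> powr ps" for k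
    proof (rule AE_I2)
      fix x :: "real ^ 'n"
      have "\<bar>cutoff (real k) x * v x\<bar> \<le> 1 * \<bar>v x\<bar>"
        unfolding abs_mult using cutoff_bounds[of "real k" x] by (intro mult_right_mono) auto
      then show "norm (\<bar>cutoff (real k) x * v x\<bar> powr ps) \<le> \<bar>v x\<bar> powr ps"
        using ps_gt p_gt_1 by (simp add: powr_mono2)
    qed
  qed auto
  have "0 \<le> (\<integral>x. \<bar>cutoff (real k) x * v x\<bar> powr ps \<partial>lborel)" for k
    by (intro Bochner_Integration.integral_nonneg) simp
  then have lim': "(\<lambda>k. sharp_constant * (\<integral>x. \<bar>cutoff (real k) x * v x\<bar> powr ps \<partial>lborel) powr ((N - p) / N)) \<longlonglongrightarrow> sharp_constant * P powr ((N - p) / N)"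
    using p_less_N N_pos by (intro tendsto_mult tendsto_const tendsto_powr' lim) auto
  have main: "sharp_constant * P powr ((N - p) / N) \<le> (1 - e) powr (1 - p) * E + e" if e: "0 < e" "e < 1" for e
  proof (rule tendsto_upperbound[OF lim'])
    have epos: "0 < e powr p" using e by simp
    show "\<forall>\<^sub>F k in sequentially. sharp_constant * (\<integral>x. \<bar>cutoff (real k) x * v x\<bar> powr ps \<partial>lborel) powr ((N - p) / N) \<le> (1 - e) powr (1 - p) * E + e"
      using cutoff_gradient_energy_small[OF cv iv epos] eventually_ge_at_top[of "1::nat"]
    proof eventually_elim
      case (elim k)
      then have k: "0 < real k" by simp
      define T where "T x = (\<bar>v x\<bar> * norm (cutoff_grad (real k) x)) powr p" for x
      have T: "integrable lborel T" "(\<integral>x. T x \<partial>lborel) \<le> e powr p"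
        using elim e unfolding T_def by auto
      define Dw where "Dw x = cutoff (real k) x *\<^sub>R Dv x + v x *\<^sub>R cutoff_grad (real k) x" for x
      have dw: "GDERIV (\<lambda>x. cutoff (real k) x * v x) x :> Dw x" for x
        unfolding Dw_def by (intro GDERIV_mult GDERIV_cutoff v)
      have cDw: "continuous_on UNIV Dw"
        unfolding Dw_def by (intro continuous_intros ccut cDv cv continuous_on_cutoff_grad)
      have w0: "cutoff (real k) x * v x = 0" if "2 * real k < norm x" for x
        using cutoff_outside[OF k, of x] that by simp
      have le: "norm (Dw x) powr p \<le> (1 - e) powr (1 - p) * norm (Dv x) powr p + e * (e powr - p * T x)" for x
      proof -
        have "norm (Dw x) \<le> norm (cutoff (real k) x *\<^sub>R Dv x) + norm (v x *\<^sub>R cutoff_grad (real k) x)"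
          unfolding Dw_def by (rule norm_triangle_ineq)
        also have "\<dots> \<le> norm (Dv x) + e * (\<bar>v x\<bar> * norm (cutoff_grad (real k) x) / e)"
          using cutoff_bounds[of "real k" x] e mult_right_mono[of "cutoff (real k) x" 1 "norm (Dv x)"] by simp
        finally have "norm (Dw x) powr p \<le> (norm (Dv x) + e * (\<bar>v x\<bar> * norm (cutoff_grad (real k) x) / e)) powr p"
          using p_gt_1 by (intro powr_mono2) auto
        also have "\<dots> \<le> (1 - e) powr (1 - p) * norm (Dv x) powr p + e * (\<bar>v x\<bar> * norm (cutoff_grad (real k) x) / e) powr p"
          using e by (intro powr_add_le p_gt_1) auto
        also have "(\<bar>v x\<bar> * norm (cutoff_grad (real k) x) / e) powr p = e powr - p * T x"
          using e unfolding T_def by (simp add: powr_divide powr_minus_divide)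
        finally show ?thesis .
      qed
      have "sharp_constant * (\<integral>x. \<bar>cutoff (real k) x * v x\<bar> powr ps \<partial>lborel) powr ((N - p) / N) \<le> (\<integral>x. norm (Dw x) powr p \<partial>lborel)"
        by (rule sharp_sobolev_C1[OF dw cDw w0])
      also have "\<dots> \<le> (\<integral>x. (1 - e) powr (1 - p) * norm (Dv x) powr p + e * (e powr - p * T x) \<partial>lborel)"
        by (intro integral_mono integrable_Dv[OF dw cDw w0] le Bochner_Integration.integrable_add integrable_mult_right iDv T(1))
      also have "\<dots> = (1 - e) powr (1 - p) * E + e * (e powr - p * (\<integral>x. T x \<partial>lborel))"
        using iDv T(1) by (simp add: E_def)
      also have "\<dots> \<le> (1 - e) powr (1 - p) * E + e * (e powr - p * e powr p)"
        using T(2) e by (intro add_left_mono mult_left_mono) auto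
      also have "e powr - p * e powr p = 1" using e by (simp add: powr_add[symmetric])
      finally show ?case by simp
    qed
  qed simp
  have "sharp_constant * P powr ((N - p) / N) \<le> E"
  proof (rule tendsto_lowerbound)
    have "((\<lambda>e. (1 - e) powr (1 - p) * E + e) \<longlongrightarrow> (1 - 0) powr (1 - p) * E + 0) (at_right 0)"
      by (intro tendsto_intros) auto
    then show "((\<lambda>e. (1 - e) powr (1 - p) * E + e) \<longlongrightarrow> E) (at_right 0)" by simp
    show "\<forall>\<^sub>F e in at_right 0. sharp_constant * P powr ((N - p) / N) \<le> (1 - e) powr (1 - p) * E + e"
      unfolding eventually_at_right_field by (intro exI[of _ 1] conjI allI impI main) auto
  qed simp
  then show ?thesis by (simp add: E_def P_def)
qed

text \<open>Every mollification of \<open>u\<close> has energy at most that of \<open>u\<close>, so the inequality for differentiable functions bounds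
the integral of its \<open>p*\<close>-th power by a constant \<open>Q\<close>; this bound passes to \<open>u\<close>.\<close>
theorem sharp_sobolev_weak:
  fixes u :: "real ^ 'n \<Rightarrow> real"
  assumes wg: "borel_weak_gradient u G"
    and iu: "integrable lborel (\<lambda>x. \<bar>u x\<bar> powr ps)" and iG: "integrable lborel (\<lambda>x. norm (G x) powr p)"
  shows "sharp_constant * (\<integral>x. \<bar>u x\<bar> powr ps \<partial>lborel) powr ((N - p) / N) \<le> (\<integral>x. norm (G x) powr p \<partial>lborel)"
proof -
  define E where "E = (\<integral>x. norm (G x) powr p \<partial>lborel)"
  define P where "P = (\<integral>x. \<bar>u x\<bar> powr ps \<partial>lborel)"
  define \<beta> where "\<beta> = (N - p) / N"
  have \<beta>: "0 < \<beta>" using p_less_N N_pos by (simp add: \<beta>_def)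
  have E0: "0 \<le> E" and P0: "0 \<le> P" unfolding E_def P_def by (auto intro!: Bochner_Integration.integral_nonneg)
  define Q where "Q = (E / sharp_constant) powr (1 / \<beta>)"
  have ps1: "1 < ps" using ps_gt p_gt_1 by simp
  have nnE: "(\<integral>\<^sup>+x. ennreal (norm (G x) powr p) \<partial>lborel) = ennreal E"
    unfolding E_def by (intro nn_integral_eq_integral iG) auto
  have nnP: "(\<integral>\<^sup>+x. ennreal (\<bar>u x\<bar> powr ps) \<partial>lborel) = ennreal P"
    unfolding P_def by (intro nn_integral_eq_integral iu) auto
  have "(\<integral>\<^sup>+x. ennreal (\<bar>u x\<bar> powr ps) \<partial>lborel) \<le> ennreal Q"
  proof (rule powr_bound_of_mollified_bound[OF _ ps1])
    show "loc_int u" using wg by (simp add: borel_weak_gradient_def)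
    fix t :: real assume t: "0 < t"
    let ?v = "conv (std_moll t) u" and ?Dv = "conv (Dmoll t) u"
    note dv = GDERIV_mollified[OF wg t] and cDv = continuous_mollified[OF wg t]
    have cv: "continuous_on UNIV ?v"
      by (rule GDERIV_imp_continuous_on[OF dv])
    have [measurable]: "?v \<in> borel_measurable borel" "?Dv \<in> borel_measurable borel"
      by (intro borel_measurable_continuous_onI cv cDv)+
    have le1: "(\<integral>\<^sup>+x. ennreal (\<bar>?v x\<bar> powr ps) \<partial>lborel) \<le> ennreal P"
      using nn_integral_mollified_le(1)[OF wg t ps1] unfolding nnP .
    have le2: "(\<integral>\<^sup>+x. ennreal (norm (?Dv x) powr p) \<partial>lborel) \<le> ennreal E"
      using nn_integral_mollified_le(2)[OF wg t p_gt_1] unfolding nnE .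
    have iv: "integrable lborel (\<lambda>x. \<bar>?v x\<bar> powr ps)"
      by (rule integrableI_bounded) (use le1 in \<open>auto intro: le_less_trans\<close>)
    have iDv: "integrable lborel (\<lambda>x. norm (?Dv x) powr p)"
      by (rule integrableI_bounded) (use le2 in \<open>auto intro: le_less_trans\<close>)
    define P' where "P' = (\<integral>x. \<bar>?v x\<bar> powr ps \<partial>lborel)"
    have P': "0 \<le> P'" unfolding P'_def by (intro Bochner_Integration.integral_nonneg) simp
    have "sharp_constant * P' powr \<beta> \<le> (\<integral>x. norm (?Dv x) powr p \<partial>lborel)"
      unfolding P'_def \<beta>_def by (rule sharp_sobolev_C1_global[OF dv cDv iv iDv])
    also have "\<dots> \<le> E"
    proof -
      have "ennreal (\<integral>x. norm (?Dv x) powr p \<partial>lborel) \<le> ennreal E"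
        using le2 nn_integral_eq_integral[OF iDv] by simp
      then show ?thesis using E0 by (simp add: ennreal_le_iff)
    qed
    finally have "P' powr \<beta> \<le> E / sharp_constant" using sharp_constant_pos by (simp add: field_simps)
    then have "(P' powr \<beta>) powr (1 / \<beta>) \<le> Q" unfolding Q_def using \<beta> by (intro powr_mono2) auto
    moreover have "(P' powr \<beta>) powr (1 / \<beta>) = P'" using \<beta> P' by (simp add: powr_powr)
    moreover have "(\<integral>\<^sup>+x. ennreal (\<bar>?v x\<bar> powr ps) \<partial>lborel) = ennreal P'"
      unfolding P'_def by (intro nn_integral_eq_integral iv) auto
    ultimately show "(\<integral>\<^sup>+x. ennreal (\<bar>?v x\<bar> powr ps) \<partial>lborel) \<le> ennreal Q" by (simp add: ennreal_leI)
  qed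
  then have "P \<le> Q" unfolding nnP by (simp add: Q_def ennreal_le_iff)
  then have "P powr \<beta> \<le> Q powr \<beta>" using P0 \<beta> by (intro powr_mono2) auto
  also have "Q powr \<beta> = E / sharp_constant" using \<beta> E0 sharp_constant_pos by (simp add: Q_def powr_powr)
  finally show ?thesis unfolding E_def[symmetric] P_def[symmetric] \<beta>_def[symmetric]
    using sharp_constant_pos by (simp add: field_simps)
qed

section \<open>The extremal function\<close>

lemma ps_eq: "sobolev_exponent CARD('n) p = ps"
  by (simp add: sobolev_exponent_def ps_def N_card)

lemma energy_lower_bound:
  fixes u :: "real ^ 'n \<Rightarrow> real"
  assumes u: "u \<in> homogeneous_sobolev p" and norm1: "Lp_norm ps u = 1"
  shows "sharp_constant \<le> gradient_energy p u"
proof -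
  let ?w = "weak_gradient u"
  have Lu: "u \<in> Lp_space ps" and ex: "\<exists>g. has_weak_gradient u g" and Lw: "(\<lambda>x. norm (?w x)) \<in> Lp_space p"
    using u unfolding homogeneous_sobolev_def ps_eq by auto
  have "has_weak_gradient u ?w" unfolding weak_gradient_def using ex by (rule someI_ex)
  then obtain u' G where G: "borel_weak_gradient u' G" "AE x in lborel. u x = u' x" "AE x in lborel. ?w x = G x"
    by (rule exists_borel_weak_gradient)
  have [measurable]: "u' \<in> borel_measurable borel" "G \<in> borel_measurable borel"
    using G(1) unfolding borel_weak_gradient_def loc_int_def by auto
  have mu: "(\<lambda>x. \<bar>u x\<bar> powr ps) \<in> borel_measurable lebesgue" and iu: "integrable lebesgue (\<lambda>x. \<bar>u x\<bar> powr ps)"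
    using Lu unfolding Lp_space_def by auto
  have mw: "(\<lambda>x. norm (?w x) powr p) \<in> borel_measurable lebesgue" and iw: "integrable lebesgue (\<lambda>x. norm (?w x) powr p)"
    using Lw unfolding Lp_space_def by auto
  have au: "AE x in lborel. \<bar>u x\<bar> powr ps = \<bar>u' x\<bar> powr ps" using G(2) by eventually_elim simp
  have aw: "AE x in lborel. norm (?w x) powr p = norm (G x) powr p" using G(3) by eventually_elim simp
  have m1: "(\<lambda>x. \<bar>u' x\<bar> powr ps) \<in> borel_measurable borel" and m2: "(\<lambda>x. norm (G x) powr p) \<in> borel_measurable borel"
    by measurable
  note tu = integral_lebesgue_eq_lborel_AE[OF mu m1 au] and tw = integral_lebesgue_eq_lborel_AE[OF mw m2 aw]
  have "sharp_constant * (\<integral>x. \<bar>u' x\<bar> powr ps \<partial>lborel) powr ((N - p) / N) \<le> (\<integral>x. norm (G x) powr p \<partial>lborel)"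
    using tu(2) tw(2) iu iw by (intro sharp_sobolev_weak[OF G(1)]) auto
  also have "(\<integral>x. norm (G x) powr p \<partial>lborel) = gradient_energy p u" using tw(1) by (simp add: gradient_energy_def)
  also have "(\<integral>x. \<bar>u' x\<bar> powr ps \<partial>lborel) = 1"
  proof -
    define P where "P = (\<integral>x. \<bar>u' x\<bar> powr ps \<partial>lborel)"
    have "P powr (1 / ps) = 1" using norm1 tu(1) by (simp add: Lp_norm_def P_def)
    moreover have "0 \<le> P" unfolding P_def by (intro Bochner_Integration.integral_nonneg) simp
    moreover have "0 < ps" using ps_gt p_gt_1 by simp
    ultimately have "P = 1"
      by (metis divide_self_if less_numeral_extra(3) nonzero_eq_divide_eq powr_one powr_one_eq_one powr_powr)
    then show ?thesis by (simp add: P_def)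
  qed
  finally show ?thesis by simp
qed

text \<open>The witness is \<open>U\<close> divided by its norm. Its weak gradient exists because it is continuously
differentiable, and the gradient that the energy refers to agrees with it almost everywhere.\<close>
lemma extremal_exists:
  "\<exists>u :: real ^ 'n \<Rightarrow> real. u \<in> homogeneous_sobolev p \<and> Lp_norm ps u = 1 \<and> gradient_energy p u = sharp_constant"
proof -
  define c where "c = 1 / Mg powr (1 / ps)"
  have ps0: "0 < ps" using ps_gt p_gt_1 by simp
  have c: "0 < c" unfolding c_def using profile_mass_pos by simp
  define u where "u x = c * U x" for x
  define Du where "Du x = c *\<^sub>R DU x" for x
  have du: "GDERIV u x :> Du x" for x
    using GDERIV_mult[OF GDERIV_const GDERIV_U, of c x] by (simp add: u_def[abs_def] Du_def)
  have cDu: "continuous_on UNIV Du" unfolding Du_def by (intro continuous_intros continuous_on_DU)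
  have cu: "continuous_on UNIV u" unfolding u_def by (intro continuous_intros continuous_on_U)
  have [measurable]: "u \<in> borel_measurable borel" "Du \<in> borel_measurable borel"
    by (intro borel_measurable_continuous_onI cu cDu)+
  have wg: "has_weak_gradient u Du" by (rule has_weak_gradient_C1[OF du cDu])
  then have wg': "has_weak_gradient u (weak_gradient u)"
    unfolding weak_gradient_def by (rule someI[of "has_weak_gradient u"])
  have "AE x in lebesgue. weak_gradient u x = Du x" by (rule weak_gradient_unique[OF wg' wg])
  then have ae: "AE x in lborel. weak_gradient u x = Du x" by (simp add: AE_completion_iff)
  have wm: "weak_gradient u \<in> borel_measurable lebesgue"
    using wg' unfolding has_weak_gradient_def by (intro locally_integrable_measurable) auto
  have um: "u \<in> borel_measurable lebesgue" by (rule measurable_completion) simp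
  have mu: "(\<lambda>x. \<bar>u x\<bar> powr ps) \<in> borel_measurable lebesgue" using um by measurable
  have mw: "(\<lambda>x. norm (weak_gradient u x) powr p) \<in> borel_measurable lebesgue" using wm by measurable
  have m1: "(\<lambda>x. \<bar>u x\<bar> powr ps) \<in> borel_measurable borel" and m2: "(\<lambda>x. norm (Du x) powr p) \<in> borel_measurable borel"
    by measurable
  have aw: "AE x in lborel. norm (weak_gradient u x) powr p = norm (Du x) powr p" using ae by eventually_elim simp
  note tu = integral_lebesgue_eq_lborel_AE[OF mu m1 AE_I2[OF refl]] and tw = integral_lebesgue_eq_lborel_AE[OF mw m2 aw]
  have eu: "\<bar>u x\<bar> powr ps = c powr ps * \<bar>U x\<bar> powr ps" for x using c by (simp add: u_def abs_mult powr_mult)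
  have eD: "norm (Du x) powr p = c powr p * norm (DU x) powr p" for x using c by (simp add: Du_def powr_mult)
  have iu: "integrable lborel (\<lambda>x. \<bar>u x\<bar> powr ps)" unfolding eu by (intro integrable_mult_right integral_U_powr_ps(2))
  have iD: "integrable lborel (\<lambda>x. norm (Du x) powr p)" unfolding eD by (intro integrable_mult_right integral_norm_DU_powr(2))
  have cps: "c powr ps = 1 / Mg" using ps0 profile_mass_pos by (simp add: c_def powr_divide powr_powr)
  have one: "(\<integral>x. \<bar>u x\<bar> powr ps \<partial>lborel) = 1"
    unfolding eu integral_mult_right_zero integral_U_powr_ps(1) cps using profile_mass_pos by simp
  have "u \<in> homogeneous_sobolev p"
    unfolding homogeneous_sobolev_def ps_eq Lp_space_def
    using um wm wg tu(2) tw(2) iu iD by auto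
  moreover have "Lp_norm ps u = 1" unfolding Lp_norm_def tu(1) one by simp
  moreover have "gradient_energy p u = sharp_constant"
  proof -
    have "gradient_energy p u = c powr p * (sharp_constant * Mg powr ((N - p) / N))"
      unfolding gradient_energy_def tw(1) eD integral_mult_right_zero U_attains ..
    also have "c powr p = 1 / Mg powr ((N - p) / N)"
    proof -
      have "1 / ps * p = (N - p) / N" using p_gt_1 p_less_N N_pos by (simp add: ps_def)
      then show ?thesis by (simp add: c_def powr_divide powr_powr)
    qed
    finally show ?thesis using profile_mass_pos by simp
  qed
  ultimately show ?thesis by blast
qed

end

theorem theorem1:
  fixes p :: real
  assumes "1 < p" and "p < real CARD('n::finite)"
  shows "\<exists>u :: real ^ 'n \<Rightarrow> real.
           u \<in> homogeneous_sobolev p \<and>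
           Lp_norm (sobolev_exponent CARD('n) p) u = 1 \<and>
           gradient_energy p u = sobolev_constant TYPE('n) p"
proof -
  obtain d where d: "CARD('n) = Suc d" using gr0_implies_Suc[of "CARD('n)"] by auto
  interpret sharp_exponents p "p / (p - 1)" d "TYPE('n)"
    using assms d by unfold_locales (auto simp: field_simps)
  obtain u :: "real ^ 'n \<Rightarrow> real" where u: "u \<in> homogeneous_sobolev p" "Lp_norm ps u = 1" "gradient_energy p u = sharp_constant"
    using extremal_exists by blast
  have "sobolev_constant TYPE('n) p = sharp_constant"
    unfolding sobolev_constant_def ps_eq
  proof (rule cInf_eq_minimum)
    show "sharp_constant \<in> {gradient_energy p u | u :: real ^ 'n \<Rightarrow> real. u \<in> homogeneous_sobolev p \<and> Lp_norm ps u = 1}"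
      using u by (intro CollectI exI[of _ u]) simp
  qed (use energy_lower_bound in auto)
  then show ?thesis using u unfolding ps_eq by auto
qed

end
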